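(* Let $K$ be an origin-symmetric star body in $\mathbb{R}^n$. If the space $(\mathbb{R}^n,\|\cdot\|_K)$ embeds in $L_0$, then it also embeds in $L_{-p}$ for every $0<p<n$.
   Context: An origin-symmetric star body in $\mathbb{R}^n$ is a compact set $K$, symmetric about the origin, such that every straight line through the origin crosses the boundary of $K$ at exactly two points, the boundary is continuous (i.e. the radial function $x\mapsto\|x\|_K^{-1}$ is continuous on $S^{n-1}$), and the origin is an interior point of $K$. Its Minkowski functional is $\|x\|_K=\min\{a\ge 0: x\in aK\}$. The space $(\mathbb{R}^n,\|\cdot\|_K)$ embeds in $L_0$ if there exist a finite Borel (non-negative) measure $\mu$ on $S^{n-1}$ and a constant $C\in\mathbb{R}$ such that for every $x\in\mathbb{R}^n$, $\ln\|x\|_K=\int_{S^{n-1}}\ln|(x,\xi)|\,d\mu(\xi)+C$. For $0<p<n$, the space embeds in $L_{-p}$ if there exists a finite symmetric (non-negative) Borel measure $\mu$ on $S^{n-1}$ such that for every Schwartz test function $\phi$ on $\mathbb{R}^n$, $\int_{\mathbb{R}^n}\|x\|_K^{-p}\phi(x)\,dx=\int_{S^{n-1}}d\mu(\xi)\int_{\mathbb{R}}|t|^{p-1}\hat\phi(t\xi)\,dt$, where $\hat\phi(\xi)=\int_{\mathbb{R}^n}\phi(x)e^{-i(x,\xi)}dx$. *)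

theory Defs
  imports "HOL-Analysis.Analysis"
begin

text \<open>The minimum is attained when \<^term>\<open>K\<close> is compact with \<open>0\<close> in its interior.\<close>

definition minkowski_functional :: "'a::euclidean_space set \<Rightarrow> 'a \<Rightarrow> real" where
  "minkowski_functional K x = (LEAST a. 0 \<le> a \<and> x \<in> (\<lambda>y. a *\<^sub>R y) ` K)"

definition symmetric_star_body :: "'a::euclidean_space set \<Rightarrow> bool" where
  "symmetric_star_body K \<longleftrightarrow>
     compact K \<and>
     (\<forall>x\<in>K. - x \<in> K) \<and>
     (\<forall>u. u \<noteq> 0 \<longrightarrow> card (frontier K \<inter> range (\<lambda>t. t *\<^sub>R u)) = 2) \<and>
     continuous_on (sphere 0 1) (\<lambda>x. inverse (minkowski_functional K x)) \<and>
     0 \<in> interior K"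

definition finite_sphere_measure :: "'a::euclidean_space measure \<Rightarrow> bool" where
  "finite_sphere_measure \<mu> \<longleftrightarrow>
     finite_measure \<mu> \<and> sets \<mu> = sets (restrict_space borel (sphere 0 1))"

definition symmetric_measure :: "'a::euclidean_space measure \<Rightarrow> bool" where
  "symmetric_measure \<mu> \<longleftrightarrow> (\<forall>A\<in>sets \<mu>. emeasure \<mu> (uminus ` A) = emeasure \<mu> A)"

text \<open>
  The defining identity is one between extended reals, with \<open>ln 0 = -\<infinity>\<close>, whereas
  HOL has \<open>ln 0 = 0\<close>. The integrand is bounded above by \<open>ln (norm x)\<close> and \<open>\<mu>\<close> is finite,
  so for \<open>x \<noteq> 0\<close>, where the left-hand side is finite, the identity means that the
  hyperplane orthogonal to \<open>x\<close> (on which the integrand is \<open>-\<infinity>\<close>) is \<open>\<mu>\<close>-null, that the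
  integrand is integrable, and that the two real numbers agree. For \<open>x = 0\<close> it reads
  \<open>-\<infinity> = -\<infinity>\<close>: replacing \<open>x\<close> by \<open>2x\<close> with \<open>x \<noteq> 0\<close> shows that \<open>\<mu>\<close> has total mass 1
  if \<open>N\<close> is positively homogeneous, so this case carries no information.
\<close>

definition embeds_in_L0 :: "('a::euclidean_space \<Rightarrow> real) \<Rightarrow> bool" where
  "embeds_in_L0 N \<longleftrightarrow>
     (\<exists>\<mu> C. finite_sphere_measure \<mu> \<and>
        (\<forall>x. x \<noteq> 0 \<longrightarrow>
           (AE \<xi> in \<mu>. x \<bullet> \<xi> \<noteq> 0) \<and>
           integrable \<mu> (\<lambda>\<xi>. ln \<bar>x \<bullet> \<xi>\<bar>) \<and>
           ln (N x) = (LINT \<xi>|\<mu>. ln \<bar>x \<bullet> \<xi>\<bar>) + C))"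

fun iterated_deriv :: "'a::euclidean_space list \<Rightarrow> ('a \<Rightarrow> complex) \<Rightarrow> 'a \<Rightarrow> complex" where
  "iterated_deriv [] f = f"
| "iterated_deriv (b # bs) f = (\<lambda>x. frechet_derivative (iterated_deriv bs f) (at x) b)"

definition schwartz_function :: "('a::euclidean_space \<Rightarrow> complex) \<Rightarrow> bool" where
  "schwartz_function \<phi> \<longleftrightarrow>
     (\<forall>bs. set bs \<subseteq> Basis \<longrightarrow>
        (\<forall>x. iterated_deriv bs \<phi> differentiable (at x)) \<and>
        (\<forall>k::nat. bounded (range (\<lambda>x. norm x ^ k *\<^sub>R iterated_deriv bs \<phi> x))))"

definition fourier_transform :: "('a::euclidean_space \<Rightarrow> complex) \<Rightarrow> 'a \<Rightarrow> complex" where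
  "fourier_transform \<phi> \<xi> = (LINT x|lborel. \<phi> x * exp (- \<i> * of_real (x \<bullet> \<xi>)))"

text \<open>
  Meant for \<open>0 < p < n\<close>. If \<open>N\<close> is the Minkowski functional of a star body, all integrals
  below converge absolutely for Schwartz \<open>\<phi>\<close>; the values of the powers at \<open>x = 0\<close> and
  \<open>t = 0\<close> are irrelevant, these being null sets.
\<close>

definition embeds_in_L_neg :: "real \<Rightarrow> ('a::euclidean_space \<Rightarrow> real) \<Rightarrow> bool" where
  "embeds_in_L_neg p N \<longleftrightarrow>
     (\<exists>\<mu>. finite_sphere_measure \<mu> \<and> symmetric_measure \<mu> \<and>
        (\<forall>\<phi>. schwartz_function \<phi> \<longrightarrow>
           (LINT x|lborel. of_real (N x powr (- p)) * \<phi> x) =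
           (LINT \<xi>|\<mu>. LINT t|lborel.
              of_real (\<bar>t\<bar> powr (p - 1)) * fourier_transform \<phi> (t *\<^sub>R \<xi>))))"

end

theory Submission
  imports Defs "HOL-Probability.Probability"
begin

text \<open>
  Homogeneity forces the measure \<open>\<mu>\<close> of the \<open>L_0\<close> representation to have mass 1, so up to a constant
  \<open>N x powr (- p)\<close> is \<open>exp (- \<theta> * \<integral> ln ((x \<bullet> \<xi>)\<^sup>2) d\<mu>)\<close> with \<open>\<theta> = p / 2\<close>. By the Markov--Krein identity
  this equals the expectation of \<open>Q(x) powr (- \<theta>)\<close> for the random quadratic form
  \<open>Q(x) = \<integral> (x \<bullet> \<xi>)\<^sup>2 dD\<close>, where \<open>D\<close> is a Dirichlet process with base measure \<open>\<theta> \<mu>\<close>; so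
  \<open>N powr (- p)\<close> is an average of ellipsoidal norms to the power \<open>- p\<close>.

  Sethuraman's stick breaking realises \<open>D\<close> as a random sum of point masses, and attaching independent
  normal variables to these gives a random vector \<open>Y\<close> with characteristic function \<open>g x = E (exp (- Q(x) / 2))\<close>.
  Then \<open>\<integral> \<bar>t\<bar> powr (p - 1) * g (t x) dt\<close> is a multiple of \<open>N x powr (- p)\<close>. Integrating against a Schwartz
  function and using Fubini, the representing measure on the sphere is the symmetrised law of \<open>Y / \<bar>Y\<bar>\<close>
  under the density \<open>\<bar>Y\<bar> powr (- p)\<close>, up to a constant. This density is integrable, as one sees by
  taking a Gaussian for the test function.
\<close>

section \<open>Integrals with power weights\<close>

text \<open>The representing measure must be non-negative; here it is the law of an actual random
  vector, so positivity needs no theorem on positive definite functions. Neither \<open>D\<close>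
  nor \<open>Q\<close> is constructed as an object. Conditioning on the first broken piece gives a
  recursion for the characteristic functions of the partial sums, and their Mellin integrals inherit
  it; Markov--Krein says that the geometric mean is a fixed point of the inherited recursion.

  Two obstacles shape this: the Mellin integral diverges already for the empty sum, whose
  characteristic function is 1, and the logarithm is unbounded near the hyperplane orthogonal to
  \<open>x\<close>. One parameter \<open>b > 0\<close> removes both. It is a Gaussian cutoff
  \<open>exp (- b * t\<^sup>2 / 2)\<close> on one side and the shift
  \<open>b + (x \<bullet> \<xi>)\<^sup>2\<close> on the other, and it absorbs the pieces broken off.
  For fixed \<open>b\<close>, stopping after \<open>m\<close> pieces costs an error of order
  \<open>(\<theta> / (\<theta> + 1)) ^ m\<close>, where \<open>\<theta> / (\<theta> + 1)\<close> is
  the mean proportion left by one break. Only afterwards does \<open>b\<close> tend to 0.\<close>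

lemma nn_integral_abs_powr_finite:
  fixes q :: real
  assumes q: "0 < q" "q < real M"
  shows "(\<integral>\<^sup>+t. ennreal (\<bar>t\<bar> powr (q - 1) / (1 + \<bar>t\<bar>) ^ M) \<partial>lborel) < \<infinity>"
proof -
  \<comment> \<open>A majorant on the positive half-line: up to 1 the denominator is dropped, beyond
    1 it is replaced by \<open>t ^ M\<close>. The reflected copy \<open>F (- t)\<close> covers
    negative \<open>t\<close>.\<close>
  define F where "F t = ennreal (t powr (q - 1)) * indicator {0..1} t
      + ennreal (t powr (q - 1 - real M)) * indicator {1..} t" for t :: real
  have [measurable]: "F \<in> borel_measurable borel"
    unfolding F_def by measurable
  have "((\<lambda>t. t powr (q - 1)) has_integral (1 powr (q - 1 + 1) / (q - 1 + 1))) {0..1}"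
    using q by (intro has_integral_powr_from_0) auto
  then have "(\<integral>\<^sup>+t. ennreal (t powr (q - 1)) * indicator {0..1} t \<partial>lborel) = ennreal (1 / q)"
    by (intro nn_integral_has_integral_lebesgue'[OF _ , THEN trans]) auto
  moreover have "(\<integral>\<^sup>+t. ennreal (t powr (q - 1 - real M)) * indicator {1..} t \<partial>lborel)
      = ennreal (0 - 1 powr (q - real M) / (q - real M))"
  proof (rule nn_integral_FTC_atLeast)
    show "((\<lambda>t. t powr (q - real M) / (q - real M)) \<longlongrightarrow> 0) at_top"
      using q by real_asymp
  next
    fix t :: real assume "1 \<le> t"
    then have "((\<lambda>t. t powr (q - real M) / (q - real M)) has_real_derivative t powr (q - real M - 1)) (at t)"
      using q by (auto intro!: derivative_eq_intros simp: divide_simps)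
    moreover have "q - real M - 1 = q - 1 - real M" by simp
    ultimately show "((\<lambda>t. t powr (q - real M) / (q - real M)) has_real_derivative t powr (q - 1 - real M)) (at t)"
      by (simp only:)
  qed auto
  ultimately have "(\<integral>\<^sup>+t. F t \<partial>lborel) < \<infinity>"
    unfolding F_def by (subst nn_integral_add) (auto simp: )
  moreover have "(\<integral>\<^sup>+t. F (- t) \<partial>lborel) = (\<integral>\<^sup>+t. F t \<partial>lborel)"
    by (subst (2) nn_integral_real_affine[where c="-1" and t=0]) auto
  moreover have "(\<integral>\<^sup>+t. ennreal (\<bar>t\<bar> powr (q - 1) / (1 + \<bar>t\<bar>) ^ M) \<partial>lborel) \<le> (\<integral>\<^sup>+t. F t + F (- t) \<partial>lborel)"
  proof (rule nn_integral_mono)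
    fix t :: real
    have 1: "\<bar>t\<bar> powr (q - 1) / (1 + \<bar>t\<bar>) ^ M \<le> \<bar>t\<bar> powr (q - 1)"
      by (simp add: divide_le_eq mult_le_cancel_left1 one_le_power)
    have 2: "\<bar>t\<bar> powr (q - 1) / (1 + \<bar>t\<bar>) ^ M \<le> \<bar>t\<bar> powr (q - 1 - real M)" if "1 \<le> \<bar>t\<bar>"
    proof -
      have "\<bar>t\<bar> powr (q - 1 - real M) = \<bar>t\<bar> powr (q - 1) / \<bar>t\<bar> ^ M"
        using that by (subst powr_diff) (auto simp: powr_realpow)
      then show ?thesis using that
        by (auto intro!: divide_left_mono power_mono)
    qed
    have "ennreal (\<bar>t\<bar> powr (q - 1) / (1 + \<bar>t\<bar>) ^ M) \<le> F \<bar>t\<bar>"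
    proof (cases "\<bar>t\<bar> \<le> 1")
      case True
      then show ?thesis
        unfolding F_def using 1 by (intro add_increasing2) (auto intro: ennreal_leI)
    next
      case False
      then show ?thesis
        unfolding F_def using 2 by (intro add_increasing) (auto intro: ennreal_leI)
    qed
    also have "\<dots> \<le> F t + F (- t)"
      by (cases "0 \<le> t") (auto simp: add_increasing2)
    finally show "ennreal (\<bar>t\<bar> powr (q - 1) / (1 + \<bar>t\<bar>) ^ M) \<le> F t + F (- t)" .
  qed
  ultimately show ?thesis
    by (auto simp: nn_integral_add intro: le_less_trans)
qed

lemma integrable_abs_powr:
  fixes q :: real
  assumes q: "0 < q" "q < real M"
  shows "integrable lborel (\<lambda>t. \<bar>t\<bar> powr (q - 1) / (1 + \<bar>t\<bar>) ^ M)"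
  using nn_integral_abs_powr_finite[OF q] by (intro integrableI_nonneg) auto

lemma power_mult_gaussian_bounded:
  fixes b :: real
  assumes b: "0 < b"
  shows "\<exists>C. \<forall>t::real. (1 + \<bar>t\<bar>) ^ M * exp (- (b * t\<^sup>2)) \<le> C"
proof -
  have "((\<lambda>t::real. (1 + t) ^ M * exp (- (b * t\<^sup>2))) \<longlongrightarrow> 0) at_top"
    using b by real_asymp
  then have "eventually (\<lambda>t::real. (1 + t) ^ M * exp (- (b * t\<^sup>2)) < 1) at_top"
    by (rule order_tendstoD) auto
  then obtain T where T: "\<And>t. T \<le> t \<Longrightarrow> (1 + t) ^ M * exp (- (b * t\<^sup>2)) < 1"
    by (auto simp: eventually_at_top_linorder)
  have "(1 + \<bar>t\<bar>) ^ M * exp (- (b * t\<^sup>2)) \<le> max 1 ((1 + \<bar>T\<bar>) ^ M)" for t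
  proof (cases "T \<le> \<bar>t\<bar>")
    case True then show ?thesis using T[of "\<bar>t\<bar>"] by (intro max.coboundedI1 less_imp_le) simp
  next
    case False
    have "(1 + \<bar>t\<bar>) ^ M * exp (- (b * t\<^sup>2)) \<le> (1 + \<bar>T\<bar>) ^ M * 1"
      using False b by (intro mult_mono power_mono) auto
    then show ?thesis by auto
  qed
  then show ?thesis by blast
qed

lemma integrable_gaussian_powr:
  fixes q b :: real
  assumes q: "0 < q" and b: "0 < b"
  shows "integrable lborel (\<lambda>t. \<bar>t\<bar> powr (q - 1) * exp (- (b * t\<^sup>2)))"
proof -
  obtain M where M: "q < real M" using reals_Archimedean2 by blast
  have "\<exists>C. \<forall>t::real. (1 + \<bar>t\<bar>) ^ M * exp (- (b * t\<^sup>2)) \<le> C"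
    by (rule power_mult_gaussian_bounded[OF b])
  then obtain C where C: "\<And>t::real. (1 + \<bar>t\<bar>) ^ M * exp (- (b * t\<^sup>2)) \<le> C" by blast
  show ?thesis
  proof (rule Bochner_Integration.integrable_bound)
    show "integrable lborel (\<lambda>t. C * (\<bar>t\<bar> powr (q - 1) / (1 + \<bar>t\<bar>) ^ M))"
      by (intro integrable_mult_right integrable_abs_powr[OF q M])
    have "\<bar>t\<bar> powr (q - 1) * exp (- (b * t\<^sup>2)) \<le> C * (\<bar>t\<bar> powr (q - 1) / (1 + \<bar>t\<bar>) ^ M)" for t
    proof -
      have "exp (- (b * t\<^sup>2)) \<le> C / (1 + \<bar>t\<bar>) ^ M"
        using C[of t] by (simp add: le_divide_eq mult.commute)
      from mult_left_mono[OF this, of "\<bar>t\<bar> powr (q - 1)"] show ?thesis by (simp add: mult.commute)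
    qed
    then show "AE t in lborel. norm (\<bar>t\<bar> powr (q - 1) * exp (- (b * t\<^sup>2)))
        \<le> norm (C * (\<bar>t\<bar> powr (q - 1) / (1 + \<bar>t\<bar>) ^ M))"
      by (intro AE_I2) (metis abs_ge_self abs_mult abs_exp_cancel order_trans powr_ge_zero abs_of_nonneg real_norm_def)
  qed auto
qed

lemma integral_gaussian_powr_pos:
  fixes q b :: real
  assumes q: "0 < q" and b: "0 < b"
  shows "0 < (LINT t|lborel. \<bar>t\<bar> powr (q - 1) * exp (- (b * t\<^sup>2)))"
proof -
  have "\<not> (AE t in lborel. \<bar>t\<bar> powr (q - 1) * exp (- (b * t\<^sup>2)) = 0)"
  proof
    assume "AE t in lborel. \<bar>t\<bar> powr (q - 1) * exp (- (b * t\<^sup>2)) = 0"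
    moreover have "AE t in lborel. t \<noteq> (0::real)" by (rule AE_lborel_singleton)
    ultimately have "AE t in (lborel::real measure). False"
      by eventually_elim simp
    then have "emeasure (lborel :: real measure) (space lborel) = 0"
      by (simp only: ae_filter_eq_bot_iff[symmetric] trivial_limit_def[symmetric] eventually_False)
    then show False by simp
  qed
  then have "(LINT t|lborel. \<bar>t\<bar> powr (q - 1) * exp (- (b * t\<^sup>2))) \<noteq> 0"
    by (subst integral_nonneg_eq_0_iff_AE[OF integrable_gaussian_powr[OF q b]]) auto
  moreover have "0 \<le> (LINT t|lborel. \<bar>t\<bar> powr (q - 1) * exp (- (b * t\<^sup>2)))"
    by simp
  ultimately show ?thesis by linarith
qed

text \<open>Substitution \<open>t \<mapsto> r * t\<close>: the Mellin integral is homogeneous of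
  degree \<open>- q\<close>. With \<open>r = sqrt b\<close> it evaluates Gaussian weights; with
  \<open>r\<close> the length of the random vector it produces the power of that length which
  becomes the density of the representing measure.\<close>

lemma nn_integral_abs_powr_scale:
  fixes q r :: real
  assumes f[measurable]: "f \<in> borel_measurable borel" and "r > 0"
  shows "(\<integral>\<^sup>+t. ennreal (\<bar>t\<bar> powr (q - 1)) * f (r * t) \<partial>lborel)
     = ennreal (r powr (- q)) * (\<integral>\<^sup>+t. ennreal (\<bar>t\<bar> powr (q - 1)) * f t \<partial>lborel)"
proof -
  have "(\<integral>\<^sup>+t. ennreal (\<bar>t\<bar> powr (q - 1)) * f t \<partial>lborel)
      = ennreal r * (\<integral>\<^sup>+t. ennreal (r powr (q - 1)) * (ennreal (\<bar>t\<bar> powr (q - 1)) * f (r * t)) \<partial>lborel)"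
    using assms by (subst nn_integral_real_affine[where c=r and t=0])
      (auto simp: abs_mult powr_mult ennreal_mult mult.assoc)
  also have "\<dots> = ennreal (r powr q) * (\<integral>\<^sup>+t. ennreal (\<bar>t\<bar> powr (q - 1)) * f (r * t) \<partial>lborel)"
    using assms by (subst nn_integral_cmult) (auto simp: mult.assoc[symmetric] ennreal_mult[symmetric] powr_diff)
  finally show ?thesis
    using assms by (simp add: mult.assoc[symmetric] ennreal_mult[symmetric] powr_minus)
qed

lemma
  fixes f :: "'a::euclidean_space \<Rightarrow> real \<Rightarrow> 'b::{real_normed_field,banach,second_countable_topology}"
  assumes f: "\<And>b. b \<in> Basis \<Longrightarrow> integrable lborel (f b)"
  shows integrable_lborel_prod: "integrable lborel (\<lambda>x. \<Prod>b\<in>Basis. f b (x \<bullet> b))"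
    and integral_lborel_prod: "(LINT x|lborel. (\<Prod>b\<in>Basis. f b (x \<bullet> b))) = (\<Prod>b\<in>Basis. (LINT t|lborel. f b t))"
proof -
  interpret product_sigma_finite "\<lambda>b::'a. lborel :: real measure" ..
  have [measurable]: "b \<in> Basis \<Longrightarrow> f b \<in> borel_measurable borel" for b
    using f[of b] by auto
  have meas: "(\<lambda>x. \<Prod>b\<in>Basis. f b (x \<bullet> b)) \<in> borel_measurable borel"
    by measurable
  have eq: "(\<Prod>b\<in>Basis. f b ((\<Sum>b\<in>Basis. x b *\<^sub>R b) \<bullet> b)) = (\<Prod>b\<in>Basis. f b (x b))" for x
    by (intro prod.cong refl) simp
  show "integrable lborel (\<lambda>x. \<Prod>b\<in>Basis. f b (x \<bullet> b))"
    by (subst lborel_eq, subst integrable_distr_eq)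
       (use meas f eq in \<open>auto intro!: product_integrable_prod\<close>)
  show "(LINT x|lborel. (\<Prod>b\<in>Basis. f b (x \<bullet> b))) = (\<Prod>b\<in>Basis. (LINT t|lborel. f b t))"
    by (subst lborel_eq, subst integral_distr)
       (use meas f eq in \<open>auto intro!: product_integral_prod\<close>)
qed

section \<open>Schwartz functions and their Fourier transforms\<close>

lemma iterated_deriv_append:
  "iterated_deriv (bs @ cs) f = iterated_deriv bs (iterated_deriv cs f)"
  by (induction bs) auto

lemma schwartz_function_iterated_deriv:
  assumes "schwartz_function \<phi>" "set cs \<subseteq> Basis"
  shows "schwartz_function (iterated_deriv cs \<phi>)"
  using assms unfolding schwartz_function_def iterated_deriv_append[symmetric] by auto

lemma schwartz_function_differentiable:
  "schwartz_function \<phi> \<Longrightarrow> \<phi> differentiable (at x)"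
  unfolding schwartz_function_def by (drule spec[of _ "[]"]) auto

lemma schwartz_function_measurable:
  fixes \<phi> :: "'a::euclidean_space \<Rightarrow> complex"
  assumes "schwartz_function \<phi>"
  shows "\<phi> \<in> borel_measurable borel"
proof (rule borel_measurable_continuous_onI)
  show "continuous_on UNIV \<phi>"
    using schwartz_function_differentiable[OF assms]
    by (auto simp: continuous_on_eq_continuous_within intro: differentiable_imp_continuous_within)
qed

lemma one_plus_power_le:
  fixes t :: real
  assumes "0 \<le> t"
  shows "(1 + t) ^ k \<le> 2 ^ k * (1 + t ^ k)"
proof -
  have "(1 + t) ^ k \<le> (2 * max 1 t) ^ k"
    using assms by (intro power_mono) auto
  also have "\<dots> \<le> 2 ^ k * (1 + t ^ k)"
    using assms by (auto simp: power_mult_distrib max_def)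
  finally show ?thesis .
qed

lemma schwartz_function_bound:
  fixes \<phi> :: "'a::euclidean_space \<Rightarrow> complex"
  assumes "schwartz_function \<phi>"
  obtains B where "0 \<le> B" "\<And>x. cmod (\<phi> x) * (1 + norm x) ^ k \<le> B"
proof -
  have bnd: "bounded (range (\<lambda>x. norm x ^ k *\<^sub>R \<phi> x))" for k
    using assms unfolding schwartz_function_def by (auto dest!: spec[of _ "[]"])
  obtain B0 where B0: "norm (norm x ^ 0 *\<^sub>R \<phi> x) \<le> B0" for x
    using bnd[of 0] unfolding bounded_iff by auto
  obtain B1 where B1: "norm (norm x ^ k *\<^sub>R \<phi> x) \<le> B1" for x
    using bnd[of k] unfolding bounded_iff by auto
  have "cmod (\<phi> x) * (1 + norm x) ^ k \<le> 2 ^ k * (B0 + B1)" for x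
  proof -
    have "cmod (\<phi> x) * (1 + norm x) ^ k \<le> cmod (\<phi> x) * (2 ^ k * (1 + norm x ^ k))"
      by (intro mult_left_mono one_plus_power_le) auto
    also have "\<dots> = 2 ^ k * (cmod (\<phi> x) + norm x ^ k * cmod (\<phi> x))"
      by (simp add: algebra_simps)
    also have "\<dots> \<le> 2 ^ k * (B0 + B1)"
      using B0[of x] B1[of x] by (intro mult_left_mono add_mono) auto
    finally show ?thesis .
  qed
  moreover have "0 \<le> 2 ^ k * (B0 + B1)"
    by (intro mult_nonneg_nonneg add_nonneg_nonneg order_trans[OF norm_ge_zero B0] order_trans[OF norm_ge_zero B1]) auto
  ultimately show ?thesis using that by blast
qed

lemma integrable_prod_powr:
  fixes a :: real
  assumes "0 \<le> a" "a < 1"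
  shows "integrable lborel (\<lambda>x::'a::euclidean_space. \<Prod>b\<in>Basis. \<bar>x \<bullet> b\<bar> powr (- a) / (1 + \<bar>x \<bullet> b\<bar>) ^ 2)"
  using assms integrable_abs_powr[of "1 - a" 2] by (intro integrable_lborel_prod) auto

lemma AE_inner_Basis_neq_0: "AE x in lborel. \<forall>b\<in>Basis. x \<bullet> (b::'a::euclidean_space) \<noteq> 0"
proof (subst AE_ball_countable)
  show "countable (Basis :: 'a set)" by (simp add: countable_finite)
  show "\<forall>b\<in>Basis. AE x::'a in lborel. x \<bullet> b \<noteq> 0"
  proof
    fix b :: 'a assume b: "b \<in> Basis"
    then have "negligible {x. b \<bullet> x = 0}"
      by (intro negligible_hyperplane) auto
    then have "{x. b \<bullet> x = 0} \<in> null_sets lebesgue"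
      by (simp add: negligible_iff_null_sets)
    moreover have "{x. b \<bullet> x = 0} \<in> sets borel" by measurable
    ultimately have "{x. b \<bullet> x = 0} \<in> null_sets lborel"
      by (simp add: null_sets_def)
    from AE_not_in[OF this] show "AE x::'a in lborel. x \<bullet> b \<noteq> 0"
      by (simp add: inner_commute)
  qed
qed

text \<open>With \<open>n = DIM('a)\<close>, \<open>norm x powr (- p)\<close> is at most the product of the \<open>\<bar>x \<bullet> b\<bar> powr (- p / n)\<close>,
  each of which is locally integrable on the line as \<open>p < n\<close>.\<close>

lemma integrable_norm_powr_decay:
  fixes f :: "'a::euclidean_space \<Rightarrow> 'b::{banach,second_countable_topology}" and p :: real
  assumes p: "0 \<le> p" "p < DIM('a)"
    and [measurable]: "f \<in> borel_measurable borel"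
    and B: "\<And>x. norm (f x) * (1 + norm x) ^ (2 * DIM('a)) \<le> B"
  shows "integrable lborel (\<lambda>x. norm x powr (- p) *\<^sub>R f x)"
proof -
  define a where "a = p / DIM('a)"
  have a: "0 \<le> a" "a < 1" using p by (auto simp: a_def)
  let ?P = "\<lambda>x::'a. \<Prod>b\<in>Basis. \<bar>x \<bullet> b\<bar> powr (- a) / (1 + \<bar>x \<bullet> b\<bar>) ^ 2"
  have 1: "integrable lborel (\<lambda>x::'a. B * ?P x)"
    by (intro integrable_mult_right integrable_prod_powr[OF a])
  have 2: "AE x in lborel. norm (norm x powr (- p) *\<^sub>R f x) \<le> norm (B * ?P x)"
    using AE_inner_Basis_neq_0
  proof eventually_elim
    case (elim x)
    then have x: "norm x > 0" by force
    have "norm x powr (- p) = (\<Prod>b\<in>(Basis::'a set). norm x powr (- a))"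
      using x by (simp add: powr_power a_def)
    also have "\<dots> \<le> (\<Prod>b\<in>Basis. \<bar>x \<bullet> b\<bar> powr (- a))"
      using elim a x by (intro prod_mono conjI powr_mono2' Basis_le_norm) auto
    finally have 1: "norm x powr (- p) \<le> (\<Prod>b\<in>Basis. \<bar>x \<bullet> b\<bar> powr (- a))" .
    have "(\<Prod>b\<in>Basis. (1 + \<bar>x \<bullet> b\<bar>) ^ 2) \<le> (\<Prod>b\<in>(Basis::'a set). (1 + norm x) ^ 2)"
      by (intro prod_mono conjI power_mono add_mono Basis_le_norm) auto
    also have "\<dots> = (1 + norm x) ^ (2 * DIM('a))"
      by (simp add: power_mult)
    finally have "norm (f x) * (\<Prod>b\<in>Basis. (1 + \<bar>x \<bullet> b\<bar>) ^ 2) \<le> B"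
      by (intro order_trans[OF mult_left_mono B]) auto
    moreover have pos: "0 < (\<Prod>b\<in>Basis. (1 + \<bar>x \<bullet> b\<bar>) ^ 2)"
      by (intro prod_pos ballI zero_less_power) auto
    ultimately have 2: "norm (f x) \<le> B / (\<Prod>b\<in>Basis. (1 + \<bar>x \<bullet> b\<bar>) ^ 2)"
      by (simp add: le_divide_eq)
    have "norm (norm x powr (- p) *\<^sub>R f x) = norm x powr (- p) * norm (f x)"
      by simp
    also have "\<dots> \<le> (\<Prod>b\<in>Basis. \<bar>x \<bullet> b\<bar> powr (- a)) * (B / (\<Prod>b\<in>Basis. (1 + \<bar>x \<bullet> b\<bar>) ^ 2))"
      using 1 2 by (intro mult_mono) (auto intro!: prod_nonneg)
    also have "\<dots> = B * ?P x"
      by (simp add: prod_dividef)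
    finally show ?case by simp
  qed
  show ?thesis
    by (rule Bochner_Integration.integrable_bound[OF 1 _ 2]) measurable
qed

lemma schwartz_function_integrable_powr:
  fixes \<phi> :: "'a::euclidean_space \<Rightarrow> complex" and p :: real
  assumes "schwartz_function \<phi>" "0 \<le> p" "p < DIM('a)"
  shows "integrable lborel (\<lambda>x. norm x powr (- p) *\<^sub>R \<phi> x)"
proof -
  obtain B where "\<And>x. cmod (\<phi> x) * (1 + norm x) ^ (2 * DIM('a)) \<le> B"
    using schwartz_function_bound[OF assms(1)] by blast
  then show ?thesis
    by (rule integrable_norm_powr_decay[OF assms(2,3) schwartz_function_measurable[OF assms(1)]])
qed

lemma schwartz_function_integrable:
  fixes \<phi> :: "'a::euclidean_space \<Rightarrow> complex"
  assumes "schwartz_function \<phi>"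
  shows "integrable lborel \<phi>"
proof (rule integrable_cong_AE_imp)
  show "integrable lborel (\<lambda>x. norm x powr (- 0) *\<^sub>R \<phi> x)"
    by (rule schwartz_function_integrable_powr[OF assms]) (simp_all add: DIM_positive)
  show "AE x in lborel. norm x powr (- 0) *\<^sub>R \<phi> x = \<phi> x"
    using AE_lborel_singleton[of 0] by eventually_elim simp
  show "\<phi> \<in> borel_measurable lborel" using schwartz_function_measurable[OF assms] by simp
qed

text \<open>The difference quotients integrate to zero by translation invariance, and they converge
  dominatedly.\<close>

lemma integral_directional_derivative_eq_0:
  fixes F :: "'a::euclidean_space \<Rightarrow> complex"
  assumes int: "integrable lborel F"
    and deriv: "\<And>x. (F has_derivative F' x) (at x)"
    and dom: "\<And>x. norm (F' x b) * (1 + norm x) ^ (2 * DIM('a)) \<le> B" and b: "norm b = 1"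
    and meas: "(\<lambda>x. F' x b) \<in> borel_measurable borel"
  shows "(LINT x|lborel. F' x b) = 0"
proof -
  define h where "h n = inverse (real (Suc n))" for n
  have h: "0 < h n" "h n \<le> 1" for n by (auto simp: h_def inverse_le_1_iff)
  have [measurable]: "F \<in> borel_measurable borel" using int by auto
  note meas[measurable]
  let ?N = "2 * DIM('a)"
  have dv: "((\<lambda>s. F (x + s *\<^sub>R b)) has_vector_derivative F' (x + s *\<^sub>R b) b) (at s within S)" for x s S
  proof -
    have "((\<lambda>s. x + s *\<^sub>R b) has_derivative (\<lambda>t. t *\<^sub>R b)) (at s within S)"
      by (auto intro!: derivative_eq_intros)
    from has_derivative_compose[OF this deriv]
    have "((\<lambda>s. F (x + s *\<^sub>R b)) has_derivative (\<lambda>t. F' (x + s *\<^sub>R b) (t *\<^sub>R b))) (at s within S)" .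
    moreover have "F' (x + s *\<^sub>R b) (t *\<^sub>R b) = t *\<^sub>R F' (x + s *\<^sub>R b) b" for t
      by (rule linear_scale[OF has_derivative_linear[OF deriv]])
    ultimately show ?thesis
      by (simp only: has_vector_derivative_def)
  qed
  have "(\<lambda>n. LINT x|lborel. (F (x + h n *\<^sub>R b) - F x) /\<^sub>R h n) \<longlonglongrightarrow> (LINT x|lborel. F' x b)"
  proof (rule integral_dominated_convergence)
    show "integrable lborel (\<lambda>x::'a. 2 ^ ?N * B * (1 / (1 + norm x) ^ ?N))"
    proof (rule integrable_mult_right, rule integrable_cong_AE_imp)
      show "integrable lborel (\<lambda>x::'a. norm x powr (- 0) *\<^sub>R (1 / (1 + norm x) ^ ?N))"
      proof (rule integrable_norm_powr_decay)
        fix x :: 'a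
        have "(1 + norm x) ^ ?N \<noteq> 0" by (smt (verit) norm_ge_zero power_not_zero)
        then show "norm (1 / (1 + norm x) ^ ?N) * (1 + norm x) ^ ?N \<le> 1"
          by (simp add: norm_divide norm_power)
      qed (simp_all add: DIM_positive)
      show "AE x in lborel. norm (x::'a) powr (- 0) *\<^sub>R (1 / (1 + norm x) ^ ?N) = (1 / (1 + norm x) ^ ?N)"
        using AE_lborel_singleton[of 0] by eventually_elim simp
    qed measurable
    show "AE x in lborel. (\<lambda>n. (F (x + h n *\<^sub>R b) - F x) /\<^sub>R h n) \<longlonglongrightarrow> F' x b"
    proof (rule AE_I2)
      fix x
      have "((\<lambda>s. F (x + s *\<^sub>R b)) has_vector_derivative F' x b) (at 0)"
        using dv[of x 0 UNIV] by simp
      then have "((\<lambda>s. norm (F (x + s *\<^sub>R b) - F x - s *\<^sub>R F' x b) / norm s) \<longlongrightarrow> 0) (at 0)"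
        by (simp add: has_vector_derivative_def has_derivative_at)
      moreover have "eventually (\<lambda>s. norm (F (x + s *\<^sub>R b) - F x - s *\<^sub>R F' x b) / norm s
          = norm ((F (x + s *\<^sub>R b) - F x) /\<^sub>R s - F' x b)) (at (0::real))"
      proof (rule eventually_at_filter[THEN iffD2], rule always_eventually, safe)
        fix s :: real assume "s \<noteq> 0"
        then have "(F (x + s *\<^sub>R b) - F x) /\<^sub>R s - F' x b = (F (x + s *\<^sub>R b) - F x - s *\<^sub>R F' x b) /\<^sub>R s"
          by (simp add: scaleR_diff_right[of "inverse s"])
        then show "norm (F (x + s *\<^sub>R b) - F x - s *\<^sub>R F' x b) / norm s
            = norm ((F (x + s *\<^sub>R b) - F x) /\<^sub>R s - F' x b)"
          by (simp add: divide_inverse mult.commute)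
      qed
      ultimately have "((\<lambda>s. norm ((F (x + s *\<^sub>R b) - F x) /\<^sub>R s - F' x b)) \<longlongrightarrow> 0) (at 0)"
        by (rule Lim_transform_eventually)
      then have "((\<lambda>s. (F (x + s *\<^sub>R b) - F x) /\<^sub>R s) \<longlongrightarrow> F' x b) (at 0)"
        by (rule LIM_zero_cancel[OF tendsto_norm_zero_cancel])
      moreover have "filterlim h (at 0) sequentially"
        unfolding filterlim_at h_def using LIMSEQ_inverse_real_of_nat by auto
      ultimately show "(\<lambda>n. (F (x + h n *\<^sub>R b) - F x) /\<^sub>R h n) \<longlonglongrightarrow> F' x b"
        by (rule filterlim_compose)
    qed
    fix n
    show "AE x in lborel. norm ((F (x + h n *\<^sub>R b) - F x) /\<^sub>R h n) \<le> 2 ^ ?N * B * (1 / (1 + norm x) ^ ?N)"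
    proof (rule AE_I2)
      fix x
      have "norm (F (x + h n *\<^sub>R b) - F (x + 0 *\<^sub>R b)) \<le> (2 ^ ?N * B * (1 / (1 + norm x) ^ ?N)) * norm (h n - 0)"
      proof (rule differentiable_bound[where S="{0..h n}" and f="\<lambda>s. F (x + s *\<^sub>R b)"])
        fix s assume s: "s \<in> {0..h n}"
        show "((\<lambda>s. F (x + s *\<^sub>R b)) has_derivative (\<lambda>t. t *\<^sub>R F' (x + s *\<^sub>R b) b)) (at s within {0..h n})"
          using dv by (simp add: has_vector_derivative_def)
        let ?y = "x + s *\<^sub>R b"
        \<comment> \<open>The segment has length at most 1, so \<open>1 + norm x\<close> is at most
          twice \<open>1 + norm ?y\<close>. Decay of the derivative at the intermediate point thus
          becomes decay in \<open>x\<close>, at the cost of the factor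
          \<open>2 ^ ?N\<close>.\<close>
        have "norm x \<le> norm ?y + norm (s *\<^sub>R b)"
          by (metis add_diff_cancel_right' norm_triangle_ineq4)
        moreover have "norm (s *\<^sub>R b) \<le> 1" using s h[of n] b by auto
        moreover have "1 + r \<le> 2 * (1 + r')" if "r \<le> r' + r''" "r'' \<le> 1" "0 \<le> r'" for r r' r'' :: real
          using that by (simp add: algebra_simps)
        ultimately have "1 + norm x \<le> 2 * (1 + norm ?y)"
          using norm_ge_zero by blast
        then have "(1 + norm x) ^ ?N \<le> (2 * (1 + norm ?y)) ^ ?N"
          by (intro power_mono) auto
        then have "norm (F' ?y b) * (1 + norm x) ^ ?N \<le> 2 ^ ?N * (norm (F' ?y b) * (1 + norm ?y) ^ ?N)"
          by (metis mult_left_mono norm_ge_zero power_mult_distrib mult.left_commute)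
        also have "\<dots> \<le> 2 ^ ?N * B" by (intro mult_left_mono dom) auto
        finally have le: "norm (F' ?y b) \<le> 2 ^ ?N * B * (1 / (1 + norm x) ^ ?N)"
          by (simp add: le_divide_eq add_pos_nonneg)
        show "onorm (\<lambda>t. t *\<^sub>R F' ?y b) \<le> 2 ^ ?N * B * (1 / (1 + norm x) ^ ?N)"
          using mult_right_mono[OF le abs_ge_zero] by (intro onorm_le) (simp add: mult.commute)
      qed (use h[of n] in auto)
      then show "norm ((F (x + h n *\<^sub>R b) - F x) /\<^sub>R h n) \<le> 2 ^ ?N * B * (1 / (1 + norm x) ^ ?N)"
        using h[of n] by (simp add: inverse_eq_divide divide_le_eq)
    qed
  qed measurable
  moreover have "(LINT x|lborel. (F (x + h n *\<^sub>R b) - F x) /\<^sub>R h n) = 0" for n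
  proof -
    have "integrable (distr lborel borel ((+) (h n *\<^sub>R b))) F"
      using int by (simp only: lborel_distr_plus)
    then have 1: "integrable lborel (\<lambda>x. F (h n *\<^sub>R b + x))"
      by (rule integrable_distr[rotated]) measurable
    have "(LINT x|distr lborel borel ((+) (h n *\<^sub>R b)). F x) = (LINT x|lborel. F (h n *\<^sub>R b + x))"
      by (rule integral_distr) auto
    then have "(LINT x|lborel. F x) = (LINT x|lborel. F (h n *\<^sub>R b + x))"
      by (simp only: lborel_distr_plus)
    with 1 int show ?thesis by (simp add: add.commute[of _ "h n *\<^sub>R b"])
  qed
  ultimately have "(\<lambda>n::nat. 0) \<longlonglongrightarrow> (LINT x|lborel. F' x b)" by (simp only:)
  then show ?thesis by (metis LIMSEQ_unique tendsto_const)
qed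

text \<open>Integration by parts without boundary terms: in the proof \<open>F' x b\<close> is the
  derivative along \<open>b\<close> of \<open>\<phi> x * e x\<close>, and its integral vanishes by
  \<open>integral_directional_derivative_eq_0\<close>.\<close>

lemma fourier_transform_iterated_deriv:
  fixes \<phi> :: "'a::euclidean_space \<Rightarrow> complex"
  assumes \<phi>: "schwartz_function \<phi>" and b: "b \<in> Basis"
  shows "fourier_transform (iterated_deriv [b] \<phi>) y = \<i> * of_real (y \<bullet> b) * fourier_transform \<phi> y"
proof -
  define e where "e x = exp (- \<i> * of_real (x \<bullet> y))" for x :: 'a
  have norm_e: "norm (e x) = 1" for x by (simp add: e_def norm_exp)
  have [measurable]: "e \<in> borel_measurable borel"
    unfolding e_def by measurable
  let ?d = "iterated_deriv [b] \<phi>"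
  have d: "schwartz_function ?d"
    using b by (intro schwartz_function_iterated_deriv \<phi>) auto
  note [measurable] = schwartz_function_measurable[OF \<phi>] schwartz_function_measurable[OF d]
  have int: "integrable lborel (\<lambda>x. f x * e x)" if "schwartz_function f" for f
    using schwartz_function_integrable[OF that] schwartz_function_measurable[OF that]
    by (intro Bochner_Integration.integrable_bound[OF schwartz_function_integrable[OF that]])
       (auto simp: norm_mult norm_e)
  define F' where "F' x v = frechet_derivative \<phi> (at x) v * e x + \<phi> x * (- \<i> * of_real (v \<bullet> y) * e x)" for x v
  have F'b: "F' x b = ?d x * e x + (- \<i> * of_real (y \<bullet> b)) * (\<phi> x * e x)" for x
    by (simp add: F'_def inner_commute algebra_simps)
  obtain B1 where B1: "0 \<le> B1" "\<And>x. cmod (?d x) * (1 + norm x) ^ (2 * DIM('a)) \<le> B1"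
    using schwartz_function_bound[OF d] by blast
  obtain B2 where B2: "0 \<le> B2" "\<And>x. cmod (\<phi> x) * (1 + norm x) ^ (2 * DIM('a)) \<le> B2"
    using schwartz_function_bound[OF \<phi>] by blast
  have "(LINT x|lborel. F' x b) = 0"
  proof (rule integral_directional_derivative_eq_0)
    show "integrable lborel (\<lambda>x. \<phi> x * e x)" by (rule int[OF \<phi>])
    show "((\<lambda>x. \<phi> x * e x) has_derivative F' x) (at x)" for x
    proof -
      have 1: "(\<phi> has_derivative frechet_derivative \<phi> (at x)) (at x)"
        using schwartz_function_differentiable[OF \<phi>] by (simp add: frechet_derivative_works)
      have 2: "(e has_derivative (\<lambda>v. - \<i> * of_real (v \<bullet> y) * e x)) (at x)"
      proof -
        have "bounded_linear (\<lambda>v::'a. - \<i> * of_real (v \<bullet> y))"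
          by (intro bounded_linear_compose[OF bounded_linear_mult_right]
              bounded_linear_compose[OF bounded_linear_of_real] bounded_linear_inner_left)
        from has_derivative_compose[OF bounded_linear_imp_has_derivative[OF this] DERIV_exp[unfolded has_field_derivative_def]]
        show ?thesis unfolding e_def by (simp add: mult.commute)
      qed
      show ?thesis
        using has_derivative_mult[OF 1 2] by (rule has_derivative_eq_rhs) (auto simp: F'_def fun_eq_iff)
    qed
    show "norm (F' x b) * (1 + norm x) ^ (2 * DIM('a)) \<le> B1 + \<bar>y \<bullet> b\<bar> * B2" for x
    proof -
      have "norm (F' x b) \<le> cmod (?d x) + \<bar>y \<bullet> b\<bar> * cmod (\<phi> x)"
        unfolding F'b by (rule order_trans[OF norm_triangle_ineq]) (simp add: norm_mult norm_e)
      then have "norm (F' x b) * (1 + norm x) ^ (2 * DIM('a))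
          \<le> (cmod (?d x) + \<bar>y \<bullet> b\<bar> * cmod (\<phi> x)) * (1 + norm x) ^ (2 * DIM('a))"
        by (intro mult_right_mono) auto
      also have "\<dots> = cmod (?d x) * (1 + norm x) ^ (2 * DIM('a))
          + \<bar>y \<bullet> b\<bar> * (cmod (\<phi> x) * (1 + norm x) ^ (2 * DIM('a)))"
        by (simp only: distrib_right mult.assoc)
      also have "\<dots> \<le> B1 + \<bar>y \<bullet> b\<bar> * B2"
        by (intro add_mono mult_left_mono B1 B2) auto
      finally show ?thesis .
    qed
    show "norm b = 1" using b by simp
    show "(\<lambda>x. F' x b) \<in> borel_measurable borel"
      unfolding F'b by measurable
  qed
  moreover have "(LINT x|lborel. F' x b) = (LINT x|lborel. ?d x * e x) + (- \<i> * of_real (y \<bullet> b)) * (LINT x|lborel. \<phi> x * e x)"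
    unfolding F'b by (subst Bochner_Integration.integral_add[OF int[OF d] integrable_mult_right[OF int[OF \<phi>]]]) simp
  ultimately show ?thesis
    unfolding fourier_transform_def e_def[symmetric] by (simp add: algebra_simps)
qed

lemma fourier_transform_decay_Basis:
  fixes \<phi> :: "'a::euclidean_space \<Rightarrow> complex"
  assumes \<phi>: "schwartz_function \<phi>" and b: "b \<in> Basis"
  shows "\<exists>B. \<forall>y. \<bar>y \<bullet> b\<bar> ^ k * cmod (fourier_transform \<phi> y) \<le> B"
  using \<phi>
proof (induction k arbitrary: \<phi>)
  case 0
  have "cmod (fourier_transform \<phi> y) \<le> (LINT x|lborel. cmod (\<phi> x))" for y
    unfolding fourier_transform_def
    by (rule order_trans[OF integral_norm_bound]) (simp add: norm_mult norm_exp)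
  then show ?case by auto
next
  case (Suc k)
  have "schwartz_function (iterated_deriv [b] \<phi>)"
    using b by (intro schwartz_function_iterated_deriv Suc) auto
  from Suc.IH[OF this] obtain B where
    B: "\<And>y. \<bar>y \<bullet> b\<bar> ^ k * cmod (fourier_transform (iterated_deriv [b] \<phi>) y) \<le> B" by blast
  have "\<bar>y \<bullet> b\<bar> ^ Suc k * cmod (fourier_transform \<phi> y) \<le> B" for y
    using B[of y] unfolding fourier_transform_iterated_deriv[OF Suc.prems b]
    by (simp add: norm_mult algebra_simps)
  then show ?case by blast
qed

text \<open>Taken later with an exponent above \<open>2 * \<theta>\<close>, which makes the
  transform integrable along rays against \<open>\<bar>t\<bar> powr (2 * \<theta> - 1)\<close>. The
  coordinatewise bounds combine because the largest coordinate controls the norm up to the factor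
  \<open>DIM('a)\<close>.\<close>

lemma fourier_transform_decay:
  fixes \<phi> :: "'a::euclidean_space \<Rightarrow> complex"
  assumes \<phi>: "schwartz_function \<phi>"
  obtains B where "0 \<le> B" "\<And>y. cmod (fourier_transform \<phi> y) * (1 + norm y) ^ k \<le> B"
proof -
  have "\<exists>B. \<forall>b\<in>Basis. \<forall>y. \<bar>y \<bullet> b\<bar> ^ k * cmod (fourier_transform \<phi> y) \<le> B b"
    by (intro bchoice ballI fourier_transform_decay_Basis \<phi>)
  then obtain B where B: "\<And>b y. b \<in> Basis \<Longrightarrow> \<bar>y \<bullet> b\<bar> ^ k * cmod (fourier_transform \<phi> y) \<le> B b" by blast
  have B_nonneg: "0 \<le> B b" if "b \<in> Basis" for b
    using B[OF that, of 0] by (rule order_trans[rotated]) auto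
  obtain b0 :: 'a where "b0 \<in> Basis" using nonempty_Basis by blast
  then obtain B0 where B0: "\<And>y. cmod (fourier_transform \<phi> y) \<le> B0"
    using fourier_transform_decay_Basis[OF \<phi>, of b0 0] by auto
  define C where "C = 2 ^ k * (B0 + real DIM('a) ^ k * (\<Sum>b\<in>Basis. B b))"
  have "cmod (fourier_transform \<phi> y) * (1 + norm y) ^ k \<le> C" for y
  proof -
    have "(\<lambda>b. \<bar>y \<bullet> b\<bar>) ` Basis \<noteq> {}" by simp
    then obtain c where c: "c \<in> Basis" "\<And>b. b \<in> Basis \<Longrightarrow> \<bar>y \<bullet> b\<bar> \<le> \<bar>y \<bullet> c\<bar>"
      using finite_Basis Max_in[of "(\<lambda>b. \<bar>y \<bullet> b\<bar>) ` Basis"] Max_ge[of "(\<lambda>b. \<bar>y \<bullet> b\<bar>) ` Basis"]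
      by (smt (verit, best) finite_imageI imageE imageI)
    have "norm y \<le> (\<Sum>b\<in>Basis. \<bar>y \<bullet> b\<bar>)" by (rule norm_le_l1)
    also have "\<dots> \<le> (\<Sum>b\<in>(Basis::'a set). \<bar>y \<bullet> c\<bar>)" by (intro sum_mono c)
    finally have "norm y ^ k \<le> (real DIM('a) * \<bar>y \<bullet> c\<bar>) ^ k" by (intro power_mono) auto
    then have "cmod (fourier_transform \<phi> y) * norm y ^ k
        \<le> cmod (fourier_transform \<phi> y) * (real DIM('a) * \<bar>y \<bullet> c\<bar>) ^ k"
      by (intro mult_left_mono) auto
    also have "\<dots> = real DIM('a) ^ k * (\<bar>y \<bullet> c\<bar> ^ k * cmod (fourier_transform \<phi> y))"
      by (simp add: power_mult_distrib)
    also have "\<dots> \<le> real DIM('a) ^ k * B c"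
      by (intro mult_left_mono B c) auto
    also have "\<dots> \<le> real DIM('a) ^ k * (\<Sum>b\<in>Basis. B b)"
      by (intro mult_left_mono member_le_sum c B_nonneg) auto
    finally have *: "cmod (fourier_transform \<phi> y) * norm y ^ k \<le> real DIM('a) ^ k * (\<Sum>b\<in>Basis. B b)" .
    have "cmod (fourier_transform \<phi> y) * (1 + norm y) ^ k
        \<le> cmod (fourier_transform \<phi> y) * (2 ^ k * (1 + norm y ^ k))"
      by (intro mult_left_mono one_plus_power_le) auto
    also have "\<dots> = 2 ^ k * (cmod (fourier_transform \<phi> y) + cmod (fourier_transform \<phi> y) * norm y ^ k)"
      by (simp add: algebra_simps)
    also have "\<dots> \<le> C"
      unfolding C_def by (intro mult_left_mono add_mono B0 *) auto
    finally show ?thesis .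
  qed
  moreover from this[of 0] have "0 \<le> C" by (rule order_trans[rotated]) auto
  ultimately show ?thesis using that by blast
qed

lemma fourier_transform_measurable[measurable]:
  fixes \<phi> :: "'a::euclidean_space \<Rightarrow> complex"
  assumes [measurable]: "\<phi> \<in> borel_measurable borel"
  shows "fourier_transform \<phi> \<in> borel_measurable borel"
  unfolding fourier_transform_def by measurable

section \<open>The Markov--Krein identity\<close>

text \<open>The law of \<open>v / (1 - v)\<close> for a \<open>Beta(1, \<theta>)\<close> variable
  \<open>v\<close>, so that \<open>1 / (1 + u)\<close> is the proportion of the stick that remains.
  In this variable the substitution behind the Markov--Krein identity is a mere rescaling of the
  half-line.\<close>

definition stick_measure :: "real \<Rightarrow> real measure" where
  "stick_measure \<theta> = density lborel (\<lambda>u. ennreal (\<theta> * (1 + u) powr (- \<theta> - 1)) * indicator {0..} u)"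

lemma sets_stick_measure[simp, measurable_cong]: "sets (stick_measure \<theta>) = sets borel"
  by (simp add: stick_measure_def)

lemma nn_integral_stick_measure:
  assumes [measurable]: "f \<in> borel_measurable borel"
  shows "(\<integral>\<^sup>+u. f u \<partial>stick_measure \<theta>)
    = (\<integral>\<^sup>+u. ennreal (\<theta> * (1 + u) powr (- \<theta> - 1)) * indicator {0..} u * f u \<partial>lborel)"
  unfolding stick_measure_def by (subst nn_integral_density) auto

lemma AE_stick_measure_nonneg: "AE u in stick_measure \<theta>. 0 \<le> u"
  unfolding stick_measure_def by (subst AE_density) (auto intro!: AE_I2 split: split_indicator_asm)

text \<open>Moments of the remaining proportion \<open>1 / (1 + u)\<close>. The exponent 0 gives
  total mass 1, \<open>1 / 2\<close> the convergence of the random series, and 1 the contraction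
  factor in \<open>gauss_mellin_le\<close>.\<close>

lemma nn_integral_stick_measure_powr:
  assumes "0 < \<theta>" "0 \<le> c"
  shows "(\<integral>\<^sup>+u. ennreal ((1 + u) powr (- c)) \<partial>stick_measure \<theta>) = ennreal (\<theta> / (\<theta> + c))"
proof -
  have "(\<integral>\<^sup>+u. ennreal ((1 + u) powr (- c)) \<partial>stick_measure \<theta>)
      = (\<integral>\<^sup>+u. ennreal (\<theta> * (1 + u) powr (- \<theta> - c - 1)) * indicator {0..} u \<partial>lborel)"
  proof (subst nn_integral_stick_measure)
    have "(1 + u) powr (- \<theta> - c - 1) = (1 + u) powr (- \<theta> - 1) * (1 + u) powr (- c)" for u :: real
    proof -
      have "- \<theta> - c - 1 = (- \<theta> - 1) + (- c)" by simp
      then show ?thesis by (simp only: powr_add)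
    qed
    then show "(\<integral>\<^sup>+u. ennreal (\<theta> * (1 + u) powr (- \<theta> - 1)) * indicator {0..} u * ennreal ((1 + u) powr (- c)) \<partial>lborel)
      = (\<integral>\<^sup>+u. ennreal (\<theta> * (1 + u) powr (- \<theta> - c - 1)) * indicator {0..} u \<partial>lborel)"
      using assms by (auto intro!: nn_integral_cong simp: ennreal_mult[symmetric] mult.assoc split: split_indicator)
  qed measurable
  also have "\<dots> = ennreal (0 - - (\<theta> / (\<theta> + c) * (1 + 0) powr (- \<theta> - c)))"
  proof (rule nn_integral_FTC_atLeast)
    fix u :: real assume "0 \<le> u"
    then have "((\<lambda>u. - (\<theta> / (\<theta> + c) * (1 + u) powr (- \<theta> - c))) has_real_derivative
        - (\<theta> / (\<theta> + c) * ((- \<theta> - c) * (1 + u) powr (- \<theta> - c - 1)))) (at u)"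
      using assms by (auto intro!: derivative_eq_intros)
    moreover have "- (\<theta> / (\<theta> + c) * ((- \<theta> - c) * r)) = \<theta> * r" for r
      using assms by (simp add: field_simps)
    ultimately show "((\<lambda>u. - (\<theta> / (\<theta> + c) * (1 + u) powr (- \<theta> - c))) has_real_derivative
        \<theta> * (1 + u) powr (- \<theta> - c - 1)) (at u)" by (simp only:)
  next
    show "((\<lambda>u. - (\<theta> / (\<theta> + c) * (1 + u) powr (- \<theta> - c))) \<longlongrightarrow> 0) at_top"
      using assms by real_asymp
  qed (use assms in auto)
  finally show ?thesis by simp
qed

lemma prob_space_stick_measure: "0 < \<theta> \<Longrightarrow> prob_space (stick_measure \<theta>)"
proof
  assume "0 < \<theta>"
  have "emeasure (stick_measure \<theta>) (space (stick_measure \<theta>)) = (\<integral>\<^sup>+u. 1 \<partial>stick_measure \<theta>)"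
    by simp
  also have "\<dots> = (\<integral>\<^sup>+u. ennreal ((1 + u) powr (- 0)) \<partial>stick_measure \<theta>)"
    using AE_stick_measure_nonneg[of \<theta>] by (intro nn_integral_cong_AE) (auto elim!: eventually_mono)
  finally show "emeasure (stick_measure \<theta>) (space (stick_measure \<theta>)) = 1"
    using nn_integral_stick_measure_powr[OF \<open>0 < \<theta>\<close>, of 0] \<open>0 < \<theta>\<close> by simp
qed

text \<open>The measure lives on the Borel sets of the whole space rather than on the sphere, so
  that measurability is plain Borel measurability; the sphere survives in the almost sure bound on
  the norm.\<close>

locale direction_measure = prob_space \<mu> for \<mu> :: "'a::euclidean_space measure" +
  assumes sets_directions[measurable_cong, simp]: "sets \<mu> = sets borel"
    and norm_direction_le: "AE \<xi> in \<mu>. norm \<xi> \<le> 1"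
begin

lemma space_directions[simp]: "space \<mu> = UNIV"
  using sets_eq_imp_space_eq[OF sets_directions] by simp

lemma prob_UNIV[simp]: "prob UNIV = 1"
  using prob_space by simp

text \<open>The power \<open>- \<theta>\<close> of the geometric mean of
  \<open>b + (x \<bullet> \<xi>)\<^sup>2\<close>. For \<open>b > 0\<close> the logarithm is almost
  surely bounded, even when \<open>x\<close> is orthogonal to directions of positive mass. As
  \<open>b\<close> tends to 0, the limit is \<open>N x powr (- (2 * \<theta>))\<close> up to a
  constant.\<close>

definition geom_mean :: "real \<Rightarrow> 'a \<Rightarrow> real \<Rightarrow> real" where
  "geom_mean \<theta> x b = exp (- \<theta> * (LINT \<xi>|\<mu>. ln (b + (x \<bullet> \<xi>)\<^sup>2)))"

lemma geom_mean_measurable[measurable (raw)]: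
  assumes [measurable]: "f \<in> borel_measurable N" "g \<in> borel_measurable N"
  shows "(\<lambda>w. geom_mean \<theta> (f w) (g w)) \<in> borel_measurable N"
  unfolding geom_mean_def by measurable

lemma geom_mean_pos: "0 < geom_mean \<theta> x b"
  by (simp add: geom_mean_def)

lemma AE_inner_square_le: "AE \<xi> in \<mu>. (x \<bullet> \<xi>)\<^sup>2 \<le> (norm x)\<^sup>2"
  using norm_direction_le
proof eventually_elim
  case (elim \<xi>)
  have "\<bar>x \<bullet> \<xi>\<bar> \<le> norm x * norm \<xi>" by (rule Cauchy_Schwarz_ineq2)
  also have "\<dots> \<le> norm x" using elim by (simp add: mult_left_le)
  finally show ?case by (metis abs_le_square_iff abs_norm_cancel)
qed

lemma integrable_ln:
  assumes b: "0 < b"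
  shows "integrable \<mu> (\<lambda>\<xi>. ln (b + (x \<bullet> \<xi>)\<^sup>2))"
proof (rule integrable_const_bound)
  show "AE \<xi> in \<mu>. norm (ln (b + (x \<bullet> \<xi>)\<^sup>2)) \<le> \<bar>ln b\<bar> + \<bar>ln (b + (norm x)\<^sup>2)\<bar>"
    using AE_inner_square_le[of x]
  proof eventually_elim
    case (elim \<xi>)
    have "ln b \<le> ln (b + (x \<bullet> \<xi>)\<^sup>2)" "ln (b + (x \<bullet> \<xi>)\<^sup>2) \<le> ln (b + (norm x)\<^sup>2)"
      using b elim by (auto intro!: ln_mono add_pos_nonneg)
    then show ?case by auto
  qed
qed measurable

lemma geom_mean_le:
  assumes b: "0 < b" and "0 \<le> \<theta>"
  shows "geom_mean \<theta> x b \<le> b powr (- \<theta>)"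
proof -
  have "ln b = (LINT \<xi>|\<mu>. ln b)" by (simp add: prob_space)
  also have "\<dots> \<le> (LINT \<xi>|\<mu>. ln (b + (x \<bullet> \<xi>)\<^sup>2))"
    using b by (intro integral_mono integrable_ln) (auto intro!: ln_mono add_pos_nonneg)
  finally have "\<theta> * ln b \<le> \<theta> * (LINT \<xi>|\<mu>. ln (b + (x \<bullet> \<xi>)\<^sup>2))"
    using assms by (intro mult_left_mono) auto
  then show ?thesis
    using b by (simp add: geom_mean_def powr_def)
qed

text \<open>From \<open>ln (b + h) \<le> ln b + h / b\<close> and \<open>exp y \<ge> 1 + y\<close>.
  The point is the quadratic dependence on \<open>x\<close>: a stick-breaking step divides
  \<open>(norm x)\<^sup>2\<close> by \<open>1 + u\<close>, so this initial error shrinks under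
  iteration.\<close>

lemma geom_mean_ge:
  assumes b: "0 < b" and \<theta>: "0 \<le> \<theta>"
  shows "b powr (- \<theta>) - geom_mean \<theta> x b \<le> \<theta> * b powr (- \<theta> - 1) * (norm x)\<^sup>2"
proof -
  have "(LINT \<xi>|\<mu>. ln (b + (x \<bullet> \<xi>)\<^sup>2)) \<le> (LINT \<xi>|\<mu>. ln b + (norm x)\<^sup>2 / b)"
  proof (rule integral_mono_AE)
    show "AE \<xi> in \<mu>. ln (b + (x \<bullet> \<xi>)\<^sup>2) \<le> ln b + (norm x)\<^sup>2 / b"
      using AE_inner_square_le[of x]
    proof eventually_elim
      case (elim \<xi>)
      have "ln (b + (x \<bullet> \<xi>)\<^sup>2) - ln b \<le> (b + (x \<bullet> \<xi>)\<^sup>2 - b) / b"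
        using b by (intro ln_diff_le add_pos_nonneg) auto
      also have "\<dots> \<le> (norm x)\<^sup>2 / b" using elim b by (intro divide_right_mono) auto
      finally show ?case by simp
    qed
  qed (use b in \<open>auto intro: integrable_ln\<close>)
  also have "\<dots> = ln b + (norm x)\<^sup>2 / b" by (simp add: prob_space)
  finally have "- \<theta> * (ln b + (norm x)\<^sup>2 / b) \<le> - \<theta> * (LINT \<xi>|\<mu>. ln (b + (x \<bullet> \<xi>)\<^sup>2))"
    using \<theta> by (intro mult_left_mono_neg) auto
  then have "exp (- \<theta> * (ln b + (norm x)\<^sup>2 / b)) \<le> geom_mean \<theta> x b"
    by (simp add: geom_mean_def)
  moreover have "exp (- \<theta> * (ln b + (norm x)\<^sup>2 / b)) = b powr (- \<theta>) * exp (- \<theta> * (norm x)\<^sup>2 / b)"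
    using b by (simp add: powr_def exp_add[symmetric] algebra_simps)
  moreover have "b powr (- \<theta>) * (1 - \<theta> * (norm x)\<^sup>2 / b) \<le> b powr (- \<theta>) * exp (- \<theta> * (norm x)\<^sup>2 / b)"
    using exp_ge_add_one_self[of "- \<theta> * (norm x)\<^sup>2 / b"] by (intro mult_left_mono) auto
  moreover have "b powr (- \<theta>) * (1 - \<theta> * (norm x)\<^sup>2 / b) = b powr (- \<theta>) - \<theta> * b powr (- \<theta> - 1) * (norm x)\<^sup>2"
    using b by (simp add: powr_diff algebra_simps)
  ultimately show ?thesis by simp
qed

lemma has_derivative_integral_ln:
  assumes b: "0 < b" and s: "0 \<le> s"
  shows "((\<lambda>s. LINT \<xi>|\<mu>. ln (b + s + (x \<bullet> \<xi>)\<^sup>2)) has_real_derivative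
    (LINT \<xi>|\<mu>. 1 / (b + s + (x \<bullet> \<xi>)\<^sup>2))) (at s)"
proof -
  \<comment> \<open>An open set containing \<open>s\<close>, also for \<open>s = 0\<close>, on which
    \<open>b + y\<close> stays above \<open>b / 2\<close>. The difference quotients of the logarithm
    are therefore bounded by \<open>2 / b\<close>, uniformly in the direction.\<close>
  let ?S = "{- b / 2 <..}"
  have sS: "s \<in> ?S" using b s by auto
  let ?q = "\<lambda>y \<xi>. (ln (b + y + (x \<bullet> \<xi>)\<^sup>2) - ln (b + s + (x \<bullet> \<xi>)\<^sup>2)) / (y - s)"
  have 1: "((\<lambda>y. LINT \<xi>|\<mu>. ?q y \<xi>) \<longlongrightarrow> (LINT \<xi>|\<mu>. 1 / (b + s + (x \<bullet> \<xi>)\<^sup>2))) (at s within ?S)"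
    unfolding tendsto_at_iff_sequentially comp_def
  proof (intro allI impI)
    fix X assume X: "\<forall>i. X i \<in> ?S - {s}" and lim: "X \<longlonglongrightarrow> s"
    show "(\<lambda>n. LINT \<xi>|\<mu>. ?q (X n) \<xi>) \<longlonglongrightarrow> (LINT \<xi>|\<mu>. 1 / (b + s + (x \<bullet> \<xi>)\<^sup>2))"
    proof (rule integral_dominated_convergence)
      show "integrable \<mu> (\<lambda>\<xi>. 2 / b)" by simp
      show "AE \<xi> in \<mu>. (\<lambda>n. ?q (X n) \<xi>) \<longlonglongrightarrow> 1 / (b + s + (x \<bullet> \<xi>)\<^sup>2)"
      proof (rule AE_I2)
        fix \<xi>
        have "((\<lambda>y. ln (b + y + (x \<bullet> \<xi>)\<^sup>2)) has_real_derivative 1 / (b + s + (x \<bullet> \<xi>)\<^sup>2)) (at s within ?S)"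
          using b s by (auto intro!: derivative_eq_intros add_pos_nonneg)
        then have "((\<lambda>y. ?q y \<xi>) \<longlongrightarrow> 1 / (b + s + (x \<bullet> \<xi>)\<^sup>2)) (at s within ?S)"
          by (simp add: has_field_derivative_iff)
        then show "(\<lambda>n. ?q (X n) \<xi>) \<longlonglongrightarrow> 1 / (b + s + (x \<bullet> \<xi>)\<^sup>2)"
          using X lim unfolding tendsto_at_iff_sequentially comp_def by blast
      qed
      fix n
      show "AE \<xi> in \<mu>. norm (?q (X n) \<xi>) \<le> 2 / b"
      proof (rule AE_I2)
        fix \<xi>
        have lip: "ln (b + y + h) - ln (b + y' + h) \<le> 2 / b * \<bar>y - y'\<bar>"
          if "y \<in> ?S" "y' \<in> ?S" "0 \<le> h" for y y' h
        proof -
          have pos: "b / 2 \<le> b + y' + h" "b / 2 \<le> b + y + h" using that by auto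
          have "ln (b + y + h) - ln (b + y' + h) \<le> (b + y + h - (b + y' + h)) / (b + y' + h)"
            using pos b by (intro ln_diff_le) linarith+
          also have "\<dots> \<le> \<bar>y - y'\<bar> / (b + y' + h)"
            using pos b by (intro divide_right_mono) linarith+
          also have "\<dots> \<le> \<bar>y - y'\<bar> / (b / 2)"
            using pos b by (intro divide_left_mono) (auto intro!: mult_pos_pos)
          finally show ?thesis by (simp add: mult.commute)
        qed
        have Xn: "X n \<in> ?S" "X n \<noteq> s" using X by auto
        have "\<bar>ln (b + X n + (x \<bullet> \<xi>)\<^sup>2) - ln (b + s + (x \<bullet> \<xi>)\<^sup>2)\<bar> \<le> 2 / b * \<bar>X n - s\<bar>"
          using lip[OF Xn(1) sS, of "(x \<bullet> \<xi>)\<^sup>2"] lip[OF sS Xn(1), of "(x \<bullet> \<xi>)\<^sup>2"]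
          by (simp add: abs_le_iff abs_minus_commute)
        then show "norm (?q (X n) \<xi>) \<le> 2 / b"
          using Xn(2) by (simp add: abs_divide pos_divide_le_eq)
      qed
    qed measurable
  qed
  have 2: "eventually (\<lambda>y. (LINT \<xi>|\<mu>. ?q y \<xi>)
      = ((LINT \<xi>|\<mu>. ln (b + y + (x \<bullet> \<xi>)\<^sup>2)) - (LINT \<xi>|\<mu>. ln (b + s + (x \<bullet> \<xi>)\<^sup>2))) / (y - s)) (at s within ?S)"
  proof (unfold eventually_at_filter, rule always_eventually, intro allI impI)
    fix y assume "y \<in> ?S"
    then show "(LINT \<xi>|\<mu>. ?q y \<xi>)
      = ((LINT \<xi>|\<mu>. ln (b + y + (x \<bullet> \<xi>)\<^sup>2)) - (LINT \<xi>|\<mu>. ln (b + s + (x \<bullet> \<xi>)\<^sup>2))) / (y - s)"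
      using b s by (simp add: integrable_ln)
  qed
  have "((\<lambda>s. LINT \<xi>|\<mu>. ln (b + s + (x \<bullet> \<xi>)\<^sup>2)) has_real_derivative
    (LINT \<xi>|\<mu>. 1 / (b + s + (x \<bullet> \<xi>)\<^sup>2))) (at s within ?S)"
    by (rule has_field_derivative_iff[THEN iffD2, OF Lim_transform_eventually[OF 1 2]])
  moreover have "at s within ?S = at s"
    using sS by (intro at_within_open) auto
  ultimately show ?thesis by (simp only:)
qed

lemma has_derivative_geom_mean:
  assumes b: "0 < b" and s: "0 \<le> s"
  shows "((\<lambda>s. - geom_mean \<theta> x (b + s)) has_real_derivative
    \<theta> * (LINT \<xi>|\<mu>. 1 / (b + s + (x \<bullet> \<xi>)\<^sup>2)) * geom_mean \<theta> x (b + s)) (at s)"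
  unfolding geom_mean_def
  by (rule derivative_eq_intros has_derivative_integral_ln[OF b s] refl)+ simp

text \<open>The Markov--Krein identity in recursive form. After substituting \<open>s = u * (b + (x \<bullet> \<xi>)\<^sup>2)\<close>
  and averaging over \<open>\<xi>\<close>, the integrand is the derivative of \<open>- geom_mean \<theta> x (b + s)\<close> in \<open>s\<close>.\<close>

lemma geom_mean_stick:
  assumes b: "0 < b" and \<theta>: "0 < \<theta>"
  shows "(\<integral>\<^sup>+\<xi>. \<integral>\<^sup>+u. ennreal (geom_mean \<theta> (x /\<^sub>R sqrt (1 + u)) (b + u / (1 + u) * (x \<bullet> \<xi>)\<^sup>2)) \<partial>stick_measure \<theta> \<partial>\<mu>)
    = ennreal (geom_mean \<theta> x b)"
proof -
  let ?c = "\<lambda>\<xi>. b + (x \<bullet> \<xi>)\<^sup>2"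
  have c: "0 < ?c \<xi>" for \<xi> using b by (simp add: add_pos_nonneg)
  \<comment> \<open>Over the common denominator \<open>1 + u\<close> the argument of the logarithm
    is \<open>(b + ?c \<xi> * u + (x \<bullet> \<eta>)\<^sup>2) / (1 + u)\<close>. As
    \<open>\<mu>\<close> has mass 1, the denominator comes out of the mean as
    \<open>(1 + u) powr \<theta>\<close> and cancels all but one power of \<open>1 + u\<close> in
    the density of \<open>stick_measure\<close>.\<close>
  have scale: "geom_mean \<theta> (x /\<^sub>R sqrt (1 + u)) (b + u / (1 + u) * (x \<bullet> \<xi>)\<^sup>2)
      = (1 + u) powr \<theta> * geom_mean \<theta> x (b + ?c \<xi> * u)" if u: "0 \<le> u" for u \<xi>
  proof -
    have bu: "0 < b + ?c \<xi> * u" using b c[of \<xi>] u by (intro add_pos_nonneg mult_nonneg_nonneg) auto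
    have "(LINT \<eta>|\<mu>. ln (b + u / (1 + u) * (x \<bullet> \<xi>)\<^sup>2 + ((x /\<^sub>R sqrt (1 + u)) \<bullet> \<eta>)\<^sup>2))
        = (LINT \<eta>|\<mu>. ln (b + ?c \<xi> * u + (x \<bullet> \<eta>)\<^sup>2) - ln (1 + u))"
    proof (intro Bochner_Integration.integral_cong refl)
      fix \<eta>
      have "b + u / (1 + u) * (x \<bullet> \<xi>)\<^sup>2 + ((x /\<^sub>R sqrt (1 + u)) \<bullet> \<eta>)\<^sup>2 = (b + ?c \<xi> * u + (x \<bullet> \<eta>)\<^sup>2) / (1 + u)"
      proof -
        have 1: "((x /\<^sub>R sqrt (1 + u)) \<bullet> \<eta>)\<^sup>2 = (x \<bullet> \<eta>)\<^sup>2 / (1 + u)"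
          using u by (simp add: power_mult_distrib power_inverse divide_inverse mult.commute)
        have 2: "b = b * (1 + u) / (1 + u)" using u by simp
        show ?thesis
          unfolding 1 by (subst 2) (simp add: add_divide_distrib[symmetric] algebra_simps)
      qed
      moreover have "0 < b + ?c \<xi> * u + (x \<bullet> \<eta>)\<^sup>2"
        using bu by (rule add_pos_nonneg) simp
      ultimately show "ln (b + u / (1 + u) * (x \<bullet> \<xi>)\<^sup>2 + ((x /\<^sub>R sqrt (1 + u)) \<bullet> \<eta>)\<^sup>2)
          = ln (b + ?c \<xi> * u + (x \<bullet> \<eta>)\<^sup>2) - ln (1 + u)"
        using u by (smt (verit) ln_div)
    qed
    also have "\<dots> = (LINT \<eta>|\<mu>. ln (b + ?c \<xi> * u + (x \<bullet> \<eta>)\<^sup>2)) - ln (1 + u)"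
      using integrable_ln[OF bu, of x] by (simp add: prob_space)
    finally have eq: "(LINT \<eta>|\<mu>. ln (b + u / (1 + u) * (x \<bullet> \<xi>)\<^sup>2 + ((x /\<^sub>R sqrt (1 + u)) \<bullet> \<eta>)\<^sup>2))
        = (LINT \<eta>|\<mu>. ln (b + ?c \<xi> * u + (x \<bullet> \<eta>)\<^sup>2)) - ln (1 + u)" .
    have "exp (- \<theta> * (A - ln (1 + u))) = (1 + u) powr \<theta> * exp (- \<theta> * A)" for A
      using u by (simp add: powr_def exp_add[symmetric] algebra_simps)
    then show ?thesis
      unfolding geom_mean_def eq .
  qed
  \<comment> \<open>The integrand after \<open>s = ?c \<xi> * u\<close>: the surviving
    \<open>\<theta> / (1 + u) du\<close> turns into \<open>\<theta> / (?c \<xi> + s) ds\<close>. The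
    direction now occurs only in this rational factor, so the average over it can be taken
    inside.\<close>
  define f where "f \<xi> s = ennreal (\<theta> / (?c \<xi> + s) * geom_mean \<theta> x (b + s)) * indicator {0..} s" for \<xi> s
  have [measurable]: "(\<lambda>(\<xi>, s). f \<xi> s) \<in> borel_measurable (\<mu> \<Otimes>\<^sub>M lborel)"
    unfolding f_def by measurable
  have [measurable]: "f \<xi> \<in> borel_measurable borel" for \<xi>
    unfolding f_def by measurable
  have "(\<integral>\<^sup>+u. ennreal (geom_mean \<theta> (x /\<^sub>R sqrt (1 + u)) (b + u / (1 + u) * (x \<bullet> \<xi>)\<^sup>2)) \<partial>stick_measure \<theta>)
      = (\<integral>\<^sup>+s. f \<xi> s \<partial>lborel)" for \<xi>
  proof -
    have "(\<integral>\<^sup>+s. f \<xi> s \<partial>lborel) = ennreal (?c \<xi>) * (\<integral>\<^sup>+u. f \<xi> (0 + ?c \<xi> * u) \<partial>lborel)"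
      using c[of \<xi>] by (subst nn_integral_real_affine[where c="?c \<xi>" and t=0]) auto
    also have "\<dots> = (\<integral>\<^sup>+u. ennreal (?c \<xi>) * f \<xi> (0 + ?c \<xi> * u) \<partial>lborel)"
      by (rule nn_integral_cmult[symmetric]) measurable
    also have "\<dots> = (\<integral>\<^sup>+u. ennreal (\<theta> * (1 + u) powr (- \<theta> - 1)) * indicator {0..} u *
        ennreal (geom_mean \<theta> (x /\<^sub>R sqrt (1 + u)) (b + u / (1 + u) * (x \<bullet> \<xi>)\<^sup>2)) \<partial>lborel)"
    proof (rule nn_integral_cong)
      fix u :: real
      show "ennreal (?c \<xi>) * f \<xi> (0 + ?c \<xi> * u) = ennreal (\<theta> * (1 + u) powr (- \<theta> - 1)) * indicator {0..} u *
        ennreal (geom_mean \<theta> (x /\<^sub>R sqrt (1 + u)) (b + u / (1 + u) * (x \<bullet> \<xi>)\<^sup>2))"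
      proof (cases "0 \<le> u")
        case True
        have "?c \<xi> * (\<theta> / (?c \<xi> + ?c \<xi> * u)) = \<theta> / (1 + u)"
        proof -
          have "?c \<xi> + ?c \<xi> * u = ?c \<xi> * (1 + u)" by (simp add: distrib_left)
          then show ?thesis using c[of \<xi>] by simp
        qed
        also have "\<dots> = \<theta> * (1 + u) powr (- \<theta> - 1) * (1 + u) powr \<theta>"
          using True by (simp add: powr_diff powr_minus divide_inverse)
        finally have "?c \<xi> * (\<theta> / (?c \<xi> + ?c \<xi> * u) * geom_mean \<theta> x (b + ?c \<xi> * u))
          = \<theta> * (1 + u) powr (- \<theta> - 1) * ((1 + u) powr \<theta> * geom_mean \<theta> x (b + ?c \<xi> * u))"
          by (simp only: mult.assoc[symmetric])
        moreover have "0 \<le> ?c \<xi> * u" using c[of \<xi>] True by simp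
        ultimately show ?thesis
          using True c[of \<xi>] \<theta> unfolding scale[OF True] f_def
          by (simp add: ennreal_mult[symmetric] geom_mean_pos less_imp_le)
      next
        case False
        then have "?c \<xi> * u < 0" using c[of \<xi>] by (simp add: mult_pos_neg)
        then show ?thesis using False by (simp add: f_def)
      qed
    qed
    also have "\<dots> = (\<integral>\<^sup>+u. ennreal (geom_mean \<theta> (x /\<^sub>R sqrt (1 + u)) (b + u / (1 + u) * (x \<bullet> \<xi>)\<^sup>2)) \<partial>stick_measure \<theta>)"
      by (rule nn_integral_stick_measure[symmetric]) measurable
    finally show ?thesis ..
  qed
  then have "(\<integral>\<^sup>+\<xi>. \<integral>\<^sup>+u. ennreal (geom_mean \<theta> (x /\<^sub>R sqrt (1 + u)) (b + u / (1 + u) * (x \<bullet> \<xi>)\<^sup>2)) \<partial>stick_measure \<theta> \<partial>\<mu>)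
      = (\<integral>\<^sup>+\<xi>. \<integral>\<^sup>+s. f \<xi> s \<partial>lborel \<partial>\<mu>)" by simp
  also have "\<dots> = (\<integral>\<^sup>+s. \<integral>\<^sup>+\<xi>. f \<xi> s \<partial>\<mu> \<partial>lborel)"
  proof -
    interpret pair_sigma_finite \<mu> "lborel :: real measure" ..
    show ?thesis by (rule Fubini'[symmetric]) measurable
  qed
  also have "\<dots> = (\<integral>\<^sup>+s. ennreal (\<theta> * (LINT \<xi>|\<mu>. 1 / (b + s + (x \<bullet> \<xi>)\<^sup>2)) * geom_mean \<theta> x (b + s)) * indicator {0..} s \<partial>lborel)"
  proof (rule nn_integral_cong)
    fix s :: real
    show "(\<integral>\<^sup>+\<xi>. f \<xi> s \<partial>\<mu>) = ennreal (\<theta> * (LINT \<xi>|\<mu>. 1 / (b + s + (x \<bullet> \<xi>)\<^sup>2)) * geom_mean \<theta> x (b + s)) * indicator {0..} s"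
    proof (cases "0 \<le> s")
      case True
      have bs: "0 < b + s" using b True by simp
      have int: "integrable \<mu> (\<lambda>\<xi>. 1 / (b + s + (x \<bullet> \<xi>)\<^sup>2))"
      proof (rule integrable_const_bound)
        show "AE \<xi> in \<mu>. norm (1 / (b + s + (x \<bullet> \<xi>)\<^sup>2)) \<le> 1 / (b + s)"
          using bs by (intro AE_I2) (auto intro!: frac_le)
      qed measurable
      have "(\<integral>\<^sup>+\<xi>. f \<xi> s \<partial>\<mu>) = (\<integral>\<^sup>+\<xi>. ennreal (\<theta> * geom_mean \<theta> x (b + s)) * ennreal (1 / (b + s + (x \<bullet> \<xi>)\<^sup>2)) \<partial>\<mu>)"
      proof (rule nn_integral_cong)
        fix \<xi>
        have "0 < b + s + (x \<bullet> \<xi>)\<^sup>2" using bs by (rule add_pos_nonneg) simp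
        moreover have "?c \<xi> + s = b + s + (x \<bullet> \<xi>)\<^sup>2" by simp
        ultimately show "f \<xi> s = ennreal (\<theta> * geom_mean \<theta> x (b + s)) * ennreal (1 / (b + s + (x \<bullet> \<xi>)\<^sup>2))"
          using True \<theta> by (simp add: f_def ennreal_mult[symmetric] geom_mean_pos less_imp_le del: add_ac)
      qed
      also have "\<dots> = ennreal (\<theta> * geom_mean \<theta> x (b + s)) * (\<integral>\<^sup>+\<xi>. ennreal (1 / (b + s + (x \<bullet> \<xi>)\<^sup>2)) \<partial>\<mu>)"
        by (rule nn_integral_cmult) measurable
      also have "(\<integral>\<^sup>+\<xi>. ennreal (1 / (b + s + (x \<bullet> \<xi>)\<^sup>2)) \<partial>\<mu>) = ennreal (LINT \<xi>|\<mu>. 1 / (b + s + (x \<bullet> \<xi>)\<^sup>2))"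
        using bs by (intro nn_integral_eq_integral int) auto
      finally show ?thesis
        using True \<theta> bs by (simp add: ennreal_mult[symmetric] geom_mean_pos less_imp_le mult_ac)
    qed (simp add: f_def)
  qed
  also have "\<dots> = ennreal (0 - - geom_mean \<theta> x (b + 0))"
  proof (rule nn_integral_FTC_atLeast)
    fix s :: real assume s: "0 \<le> s"
    show "((\<lambda>s. - geom_mean \<theta> x (b + s)) has_real_derivative
        \<theta> * (LINT \<xi>|\<mu>. 1 / (b + s + (x \<bullet> \<xi>)\<^sup>2)) * geom_mean \<theta> x (b + s)) (at s)"
      by (rule has_derivative_geom_mean[OF b s])
    show "0 \<le> \<theta> * (LINT \<xi>|\<mu>. 1 / (b + s + (x \<bullet> \<xi>)\<^sup>2)) * geom_mean \<theta> x (b + s)"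
    proof (intro mult_nonneg_nonneg Bochner_Integration.integral_nonneg)
      fix \<xi>
      have "0 < b + s + (x \<bullet> \<xi>)\<^sup>2" using b s by (intro add_pos_nonneg) auto
      then show "0 \<le> 1 / (b + s + (x \<bullet> \<xi>)\<^sup>2)" by simp
    qed (use \<theta> geom_mean_pos[of \<theta> x "b + s"] in auto)
  next
    have "((\<lambda>s. (b + s) powr (- \<theta>)) \<longlongrightarrow> 0) at_top"
      using \<theta> by real_asymp
    then have "((\<lambda>s. geom_mean \<theta> x (b + s)) \<longlongrightarrow> 0) at_top"
    proof (rule tendsto_sandwich[rotated 3])
      show "eventually (\<lambda>s. geom_mean \<theta> x (b + s) \<le> (b + s) powr (- \<theta>)) at_top"
        using eventually_ge_at_top[of 0] by eventually_elim (use b \<theta> in \<open>auto intro!: geom_mean_le\<close>)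
    qed (auto simp: geom_mean_pos less_imp_le)
    then show "((\<lambda>s. - geom_mean \<theta> x (b + s)) \<longlongrightarrow> 0) at_top"
      using tendsto_minus[of "\<lambda>s. geom_mean \<theta> x (b + s)" 0 at_top] by simp
  qed measurable
  finally show ?thesis by simp
qed

end

section \<open>Stick breaking\<close>

lemma (in prob_space) stream_space_eq_distr_pair:
  "stream_space M = distr (M \<Otimes>\<^sub>M stream_space M) (stream_space M) (\<lambda>(x, s). x ## s)"
proof (rule measure_eqI)
  interpret S: prob_space "stream_space M" by (rule prob_space_stream_space)
  fix A assume A[measurable]: "A \<in> sets (stream_space M)"
  have "emeasure (distr (M \<Otimes>\<^sub>M stream_space M) (stream_space M) (\<lambda>(x, s). x ## s)) A
      = (\<integral>\<^sup>+w. indicator A (fst w ## snd w) \<partial>(M \<Otimes>\<^sub>M stream_space M))"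
    by (simp add: nn_integral_indicator[symmetric] nn_integral_distr split_beta' del: nn_integral_indicator)
  also have "\<dots> = (\<integral>\<^sup>+x. \<integral>\<^sup>+s. indicator A (x ## s) \<partial>stream_space M \<partial>M)"
    by (subst S.nn_integral_fst[symmetric]) auto
  also have "\<dots> = (\<integral>\<^sup>+s. indicator A s \<partial>stream_space M)"
    by (rule nn_integral_stream_space[symmetric]) measurable
  finally show "emeasure (stream_space M) A
      = emeasure (distr (M \<Otimes>\<^sub>M stream_space M) (stream_space M) (\<lambda>(x, s). x ## s)) A"
    by simp
qed simp

text \<open>Conditioning on the first entry in Bochner form, needed because characteristic functions
  are integrals of complex-valued functions.\<close>

lemma (in prob_space) integral_stream_space:
  fixes f :: "'a stream \<Rightarrow> 'b::{banach, second_countable_topology}"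
  assumes f: "integrable (stream_space M) f"
  shows "(LINT s|stream_space M. f s) = (LINT x|M. LINT s|stream_space M. f (x ## s))"
proof -
  interpret S: prob_space "stream_space M" by (rule prob_space_stream_space)
  interpret pair_sigma_finite M "stream_space M" ..
  note [measurable] = borel_measurable_integrable[OF f]
  have int: "integrable (M \<Otimes>\<^sub>M stream_space M) (\<lambda>w. f (case w of (x, s) \<Rightarrow> x ## s))"
    by (rule integrable_distr[of _ _ "stream_space M"]) (use f stream_space_eq_distr_pair in auto)
  have "(LINT s|stream_space M. f s) = (LINT w|(M \<Otimes>\<^sub>M stream_space M). f (case w of (x, s) \<Rightarrow> x ## s))"
    by (subst (1) stream_space_eq_distr_pair, rule integral_distr) auto
  also have "\<dots> = (LINT x|M. LINT s|stream_space M. f (x ## s))"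
    using integral_fst'[OF int] by simp
  finally show ?thesis .
qed

primrec stream_weight :: "('a \<Rightarrow> ennreal) \<Rightarrow> ('a \<Rightarrow> ennreal) \<Rightarrow> nat \<Rightarrow> 'a stream \<Rightarrow> ennreal" where
  "stream_weight c e 0 s = e (shd s)"
| "stream_weight c e (Suc m) s = c (shd s) * stream_weight c e m (stl s)"

lemma stream_weight_measurable[measurable]:
  assumes [measurable]: "c \<in> borel_measurable M" "e \<in> borel_measurable M"
  shows "stream_weight c e m \<in> borel_measurable (stream_space M)"
  by (induction m) simp_all

lemma (in prob_space) nn_integral_stream_weight:
  assumes [measurable]: "c \<in> borel_measurable M" "e \<in> borel_measurable M"
  shows "(\<integral>\<^sup>+s. stream_weight c e m s \<partial>stream_space M) = (\<integral>\<^sup>+x. c x \<partial>M) ^ m * (\<integral>\<^sup>+x. e x \<partial>M)"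
proof (induction m)
  case 0
  interpret S: prob_space "stream_space M" by (rule prob_space_stream_space)
  show ?case by (subst nn_integral_stream_space) (simp_all add: S.emeasure_space_1)
next
  case (Suc m)
  then show ?case
    by (subst nn_integral_stream_space) (simp_all add: nn_integral_cmult nn_integral_multc mult_ac)
qed

text \<open>By independence of the entries the expectations of the terms form a geometric series
  with ratio the mean of \<open>c\<close>, so the sum has finite expectation.\<close>

lemma (in prob_space) AE_stream_weight_suminf:
  assumes [measurable]: "c \<in> borel_measurable M" "e \<in> borel_measurable M"
    and c: "(\<integral>\<^sup>+x. c x \<partial>M) < 1" and e: "(\<integral>\<^sup>+x. e x \<partial>M) < \<infinity>"
  shows "AE s in stream_space M. (\<Sum>m. stream_weight c e m s) \<noteq> \<infinity>"
proof (rule nn_integral_PInf_AE)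
  obtain c' where c': "(\<integral>\<^sup>+x. c x \<partial>M) = ennreal c'" "0 \<le> c'" "c' < 1"
    using c by (cases "\<integral>\<^sup>+x. c x \<partial>M") (auto simp: ennreal_less_one_iff)
  obtain e' where e': "(\<integral>\<^sup>+x. e x \<partial>M) = ennreal e'" "0 \<le> e'"
    using e by (cases "\<integral>\<^sup>+x. e x \<partial>M") auto
  have "(\<integral>\<^sup>+s. (\<Sum>m. stream_weight c e m s) \<partial>stream_space M) = (\<Sum>m. \<integral>\<^sup>+s. stream_weight c e m s \<partial>stream_space M)"
    by (rule nn_integral_suminf) measurable
  also have "\<dots> = (\<Sum>m. ennreal (c' ^ m * e'))"
    using c' e' by (simp add: nn_integral_stream_weight ennreal_mult ennreal_power)
  also have "\<dots> = ennreal (\<Sum>m. c' ^ m * e')"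
    using c' e' by (intro suminf_ennreal2 summable_mult2 summable_geometric) auto
  finally show "(\<integral>\<^sup>+s. (\<Sum>m. stream_weight c e m s) \<partial>stream_space M) \<noteq> \<infinity>" by simp
qed measurable

locale stick_breaking = direction_measure \<mu> for \<mu> :: "'a::euclidean_space measure" +
  fixes \<theta> :: real
  assumes \<theta>: "0 < \<theta>"
begin

text \<open>The variable \<open>u\<close> with law \<open>stick\<close> encodes the proportion \<open>u / (1 + u)\<close> broken off the stick, which
  is \<open>Beta(1, \<theta>)\<close> distributed.\<close>

abbreviation "stick \<equiv> stick_measure \<theta>"
abbreviation "normal \<equiv> std_normal_distribution"

sublocale stick: prob_space stick
  by (rule prob_space_stick_measure[OF \<theta>])

sublocale normal: prob_space normal
  by (rule prob_space_normal_density) simp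

definition steps :: "('a \<times> real \<times> real) measure" where
  "steps = \<mu> \<Otimes>\<^sub>M (stick \<Otimes>\<^sub>M normal)"

lemma sets_steps[measurable_cong, simp]: "sets steps = sets (borel \<Otimes>\<^sub>M (borel \<Otimes>\<^sub>M borel))"
  unfolding steps_def by (intro sets_pair_measure_cong) auto

sublocale stick_normal: pair_prob_space stick normal ..

sublocale steps: prob_space steps
proof -
  interpret P: pair_prob_space \<mu> "stick \<Otimes>\<^sub>M normal" ..
  show "prob_space steps" unfolding steps_def by (rule P.prob_space_axioms)
qed

lemma nn_integral_steps:
  assumes [measurable]: "f \<in> borel_measurable steps"
  shows "(\<integral>\<^sup>+w. f w \<partial>steps) = (\<integral>\<^sup>+\<xi>. \<integral>\<^sup>+u. \<integral>\<^sup>+z. f (\<xi>, u, z) \<partial>normal \<partial>stick \<partial>\<mu>)"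
proof -
  have "f \<in> borel_measurable (\<mu> \<Otimes>\<^sub>M (stick \<Otimes>\<^sub>M normal))"
    using assms by (simp add: steps_def)
  note [measurable] = this
  show ?thesis
    unfolding steps_def
    by (simp add: stick_normal.nn_integral_fst[symmetric] normal.nn_integral_fst[symmetric])
qed

lemma integral_steps:
  fixes f :: "_ \<Rightarrow> complex"
  assumes [measurable]: "f \<in> borel_measurable steps" and bnd: "\<And>w. norm (f w) \<le> B"
  shows "(LINT w|steps. f w) = (LINT \<xi>|\<mu>. LINT u|stick. LINT z|normal. f (\<xi>, u, z))"
proof -
  interpret P: pair_prob_space \<mu> "stick \<Otimes>\<^sub>M normal" ..
  have f[measurable]: "f \<in> borel_measurable (\<mu> \<Otimes>\<^sub>M (stick \<Otimes>\<^sub>M normal))"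
    using assms by (simp add: steps_def)
  have "integrable (\<mu> \<Otimes>\<^sub>M (stick \<Otimes>\<^sub>M normal)) f"
    by (rule P.integrable_const_bound[where B=B]) (auto simp: bnd)
  from P.integral_fst'[OF this]
  have "(LINT w|steps. f w) = (LINT \<xi>|\<mu>. LINT v|(stick \<Otimes>\<^sub>M normal). f (\<xi>, v))"
    unfolding steps_def by simp
  moreover have "(LINT v|(stick \<Otimes>\<^sub>M normal). f (\<xi>, v)) = (LINT u|stick. LINT z|normal. f (\<xi>, u, z))" for \<xi>
  proof -
    have "integrable (stick \<Otimes>\<^sub>M normal) (\<lambda>v. f (\<xi>, v))"
      by (rule stick_normal.integrable_const_bound[where B=B]) (auto simp: bnd)
    from stick_normal.integral_fst'[OF this] show ?thesis by simp
  qed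
  ultimately show ?thesis by (simp only:)
qed

abbreviation "paths \<equiv> stream_space steps"

sublocale paths: prob_space paths
  by (rule steps.prob_space_stream_space)

text \<open>Square roots of the stick lengths appear because the lengths are to be the conditional
  variances: given directions and sticks, \<open>x \<bullet> partial_sum m s\<close> is centred
  normal, with variance a truncation of \<open>Q(x)\<close>. Recursing at the head of the stream,
  with the tail rescaled, yields the recursion pattern of \<open>geom_mean_stick\<close>.\<close>

primrec partial_sum :: "nat \<Rightarrow> ('a \<times> real \<times> real) stream \<Rightarrow> 'a" where
  "partial_sum 0 s = 0"
| "partial_sum (Suc m) s = (sqrt (fst (snd (shd s)) / (1 + fst (snd (shd s)))) * snd (snd (shd s))) *\<^sub>R fst (shd s)
     + partial_sum m (stl s) /\<^sub>R sqrt (1 + fst (snd (shd s)))"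

lemma partial_sum_measurable[measurable]: "partial_sum m \<in> borel_measurable paths"
proof (induction m)
  case (Suc m)
  note [measurable] = Suc
  have [measurable]: "fst \<in> measurable steps borel" "(\<lambda>w. fst (snd w)) \<in> measurable steps borel" "(\<lambda>w. snd (snd w)) \<in> measurable steps borel"
    by measurable
  show ?case by simp
qed simp

definition step_scale :: "'a \<times> real \<times> real \<Rightarrow> ennreal" where
  "step_scale w = ennreal \<bar>inverse (sqrt (1 + fst (snd w)))\<bar>"

definition step_size :: "'a \<times> real \<times> real \<Rightarrow> ennreal" where
  "step_size w = ennreal (\<bar>sqrt (fst (snd w) / (1 + fst (snd w))) * snd (snd w)\<bar> * norm (fst w))"

lemma step_measurable[measurable]:
  "step_scale \<in> borel_measurable steps" "step_size \<in> borel_measurable steps"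
  unfolding step_scale_def step_size_def by measurable

text \<open>Consecutive sums share their first \<open>m\<close> pieces; what remains is the new
  piece, shrunk by the scales of the \<open>m\<close> steps before it.\<close>

lemma norm_partial_sum_diff:
  "ennreal (norm (partial_sum (Suc m) s - partial_sum m s)) = stream_weight step_scale step_size m s"
proof (induction m arbitrary: s)
  case 0
  show ?case by (simp add: step_size_def abs_mult)
next
  case (Suc m)
  let ?r = "inverse (sqrt (1 + fst (snd (shd s))))"
  have "partial_sum (Suc (Suc m)) s - partial_sum (Suc m) s
      = ?r *\<^sub>R (partial_sum (Suc m) (stl s) - partial_sum m (stl s))"
    by (subst (1 2) partial_sum.simps) (simp only: scaleR_diff_right add_diff_cancel_left)
  then have "norm (partial_sum (Suc (Suc m)) s - partial_sum (Suc m) s)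
      = \<bar>?r\<bar> * norm (partial_sum (Suc m) (stl s) - partial_sum m (stl s))"
    by (simp only: norm_scaleR)
  then show ?case
    using Suc[of "stl s"] by (simp only: stream_weight.simps step_scale_def ennreal_mult' norm_ge_zero ennreal_mult abs_ge_zero)
qed

lemma nn_integral_step_scale: "(\<integral>\<^sup>+w. step_scale w \<partial>steps) < 1"
proof -
  have "(\<integral>\<^sup>+w. step_scale w \<partial>steps) = (\<integral>\<^sup>+u. ennreal \<bar>inverse (sqrt (1 + u))\<bar> \<partial>stick)"
    using normal.emeasure_space_1 emeasure_space_1 by (simp add: nn_integral_steps step_scale_def)
  also have "\<dots> = (\<integral>\<^sup>+u. ennreal ((1 + u) powr (- (1 / 2))) \<partial>stick)"
    using AE_stick_measure_nonneg[of \<theta>]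
    by (intro nn_integral_cong_AE) (auto elim!: eventually_mono simp: powr_minus powr_half_sqrt)
  also have "\<dots> = ennreal (\<theta> / (\<theta> + 1 / 2))"
    using \<theta> by (intro nn_integral_stick_measure_powr) auto
  also have "\<dots> < 1" using \<theta> by (simp add: ennreal_less_one_iff)
  finally show ?thesis .
qed

lemma nn_integral_step_size: "(\<integral>\<^sup>+w. step_size w \<partial>steps) < \<infinity>"
proof -
  have "(\<integral>\<^sup>+w. step_size w \<partial>steps) \<le> (\<integral>\<^sup>+\<xi>. \<integral>\<^sup>+u. \<integral>\<^sup>+z. ennreal \<bar>z\<bar> \<partial>normal \<partial>stick \<partial>\<mu>)"
  proof (subst nn_integral_steps)
    show "(\<integral>\<^sup>+\<xi>. \<integral>\<^sup>+u. \<integral>\<^sup>+z. step_size (\<xi>, u, z) \<partial>normal \<partial>stick \<partial>\<mu>)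
        \<le> (\<integral>\<^sup>+\<xi>. \<integral>\<^sup>+u. \<integral>\<^sup>+z. ennreal \<bar>z\<bar> \<partial>normal \<partial>stick \<partial>\<mu>)"
    proof (rule nn_integral_mono_AE)
      show "AE \<xi> in \<mu>. (\<integral>\<^sup>+u. \<integral>\<^sup>+z. step_size (\<xi>, u, z) \<partial>normal \<partial>stick) \<le> (\<integral>\<^sup>+u. \<integral>\<^sup>+z. ennreal \<bar>z\<bar> \<partial>normal \<partial>stick)"
        using norm_direction_le
      proof eventually_elim
        case (elim \<xi>)
        show ?case
        proof (rule nn_integral_mono_AE)
          show "AE u in stick. (\<integral>\<^sup>+z. step_size (\<xi>, u, z) \<partial>normal) \<le> (\<integral>\<^sup>+z. ennreal \<bar>z\<bar> \<partial>normal)"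
            using AE_stick_measure_nonneg
          proof eventually_elim
            case u: (elim u)
            show ?case
            proof (rule nn_integral_mono)
              fix z :: real
              have "\<bar>sqrt (u / (1 + u))\<bar> \<le> 1" using u by simp
              then have "\<bar>sqrt (u / (1 + u)) * z\<bar> * norm \<xi> \<le> 1 * \<bar>z\<bar> * 1"
                unfolding abs_mult using elim by (intro mult_mono) auto
              then show "step_size (\<xi>, u, z) \<le> ennreal \<bar>z\<bar>"
                by (simp add: step_size_def ennreal_leI)
            qed
          qed
        qed
      qed
    qed
  qed measurable
  also have "\<dots> = (\<integral>\<^sup>+z. ennreal \<bar>z\<bar> \<partial>normal)"
    using stick.emeasure_space_1 emeasure_space_1 by simp
  also have "\<dots> < \<infinity>"
  proof -
    have "integrable normal (\<lambda>z. z ^ 1)" by (rule integrable_std_normal_distribution_moment)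
    then show ?thesis by (simp add: integrable_iff_bounded)
  qed
  finally show ?thesis .
qed

lemma AE_partial_sum_convergent: "AE s in paths. convergent (\<lambda>m. partial_sum m s)"
  using steps.AE_stream_weight_suminf[OF step_measurable nn_integral_step_scale nn_integral_step_size]
proof eventually_elim
  case (elim s)
  have "(\<Sum>m. ennreal (norm (partial_sum (Suc m) s - partial_sum m s))) \<noteq> top"
    using elim unfolding norm_partial_sum_diff by simp
  then have "summable (\<lambda>m. norm (partial_sum (Suc m) s - partial_sum m s))"
    by (intro summable_suminf_not_top) auto
  then have "summable (\<lambda>m. partial_sum (Suc m) s - partial_sum m s)"
    by (rule summable_norm_cancel)
  then have "convergent (\<lambda>n. \<Sum>m<n. partial_sum (Suc m) s - partial_sum m s)"
    by (simp add: summable_iff_convergent)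
  then show ?case
    by (simp add: sum_lessThan_telescope[of "\<lambda>m. partial_sum m s"] del: partial_sum.simps(2))
qed

text \<open>The random vector \<open>Y\<close> of the overview. Divergent paths form a null set, so
  the unspecified value of \<open>lim\<close> there does not matter.\<close>

definition limit_sum :: "('a \<times> real \<times> real) stream \<Rightarrow> 'a" where
  "limit_sum s = lim (\<lambda>m. partial_sum m s)"

lemma limit_sum_measurable[measurable]: "limit_sum \<in> borel_measurable paths"
  unfolding limit_sum_def by measurable


section \<open>Characteristic functions of the stick-breaking sums\<close>

primrec partial_char :: "nat \<Rightarrow> 'a \<Rightarrow> real" where
  "partial_char 0 x = 1"
| "partial_char (Suc m) x =
     (LINT \<xi>|\<mu>. LINT u|stick. exp (- (u / (1 + u) * (x \<bullet> \<xi>)\<^sup>2 / 2)) * partial_char m (x /\<^sub>R sqrt (1 + u)))"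

lemma partial_char_measurable[measurable]: "partial_char m \<in> borel_measurable borel"
proof (induction m)
  case (Suc m)
  note [measurable] = Suc
  show ?case by simp measurable
qed simp

lemma partial_char_integrand_bounds:
  assumes "\<And>x. 0 \<le> partial_char m x \<and> partial_char m x \<le> 1"
  shows "AE u in stick. 0 \<le> exp (- (u / (1 + u) * (x \<bullet> \<xi>)\<^sup>2 / 2)) * partial_char m (x /\<^sub>R sqrt (1 + u))"
    and "AE u in stick. exp (- (u / (1 + u) * (x \<bullet> \<xi>)\<^sup>2 / 2)) * partial_char m (x /\<^sub>R sqrt (1 + u)) \<le> 1"
    and "AE u in stick. norm (exp (- (u / (1 + u) * (x \<bullet> \<xi>)\<^sup>2 / 2)) * partial_char m (x /\<^sub>R sqrt (1 + u))) \<le> 1"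
proof -
  let ?f = "\<lambda>u. exp (- (u / (1 + u) * (x \<bullet> \<xi>)\<^sup>2 / 2)) * partial_char m (x /\<^sub>R sqrt (1 + u))"
  have nonneg: "0 \<le> ?f u" for u using assms by simp
  then show "AE u in stick. 0 \<le> ?f u" by simp
  show "AE u in stick. ?f u \<le> 1"
    using AE_stick_measure_nonneg[of \<theta>]
  proof eventually_elim
    case (elim u)
    then have "?f u \<le> 1 * 1"
      using assms by (intro mult_mono) auto
    then show ?case by simp
  qed
  then show "AE u in stick. norm (?f u) \<le> 1"
    by eventually_elim (simp only: real_norm_def abs_of_nonneg[OF nonneg])
qed

lemma partial_char_bounds: "0 \<le> partial_char m x \<and> partial_char m x \<le> 1"
proof (induction m arbitrary: x)
  case (Suc m)
  let ?f = "\<lambda>\<xi> u. exp (- (u / (1 + u) * (x \<bullet> \<xi>)\<^sup>2 / 2)) * partial_char m (x /\<^sub>R sqrt (1 + u))"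
  have 1: "0 \<le> (LINT u|stick. ?f \<xi> u) \<and> (LINT u|stick. ?f \<xi> u) \<le> 1" for \<xi>
  proof
    note bnd = partial_char_integrand_bounds[OF Suc, of x \<xi>]
    show "0 \<le> (LINT u|stick. ?f \<xi> u)"
      by (rule integral_nonneg_AE[OF bnd(1)])
    have "integrable stick (?f \<xi>)"
      by (rule stick.integrable_const_bound[OF bnd(3)]) measurable
    then show "(LINT u|stick. ?f \<xi> u) \<le> 1"
      by (rule stick.integral_le_const[OF _ bnd(2)])
  qed
  have "0 \<le> (LINT \<xi>|\<mu>. LINT u|stick. ?f \<xi> u)"
    using 1 by (intro integral_nonneg_AE) auto
  moreover have "(LINT \<xi>|\<mu>. LINT u|stick. ?f \<xi> u) \<le> 1"
    using 1 by (intro integral_le_const integrable_const_bound[where B=1]) (auto intro!: AE_I2)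
  ultimately show ?case by simp
qed simp

text \<open>The recursion restated for non-negative integrals, so that the exchange with the
  integral over \<open>t\<close> in \<open>gauss_mellin_Suc\<close> is Tonelli and asks for no
  integrability.\<close>

lemma ennreal_partial_char_Suc:
  "ennreal (partial_char (Suc m) x) =
     (\<integral>\<^sup>+\<xi>. \<integral>\<^sup>+u. ennreal (exp (- (u / (1 + u) * (x \<bullet> \<xi>)\<^sup>2 / 2)) * partial_char m (x /\<^sub>R sqrt (1 + u))) \<partial>stick \<partial>\<mu>)"
proof -
  let ?f = "\<lambda>\<xi> u. exp (- (u / (1 + u) * (x \<bullet> \<xi>)\<^sup>2 / 2)) * partial_char m (x /\<^sub>R sqrt (1 + u))"
  note bnd = partial_char_integrand_bounds[OF partial_char_bounds, of x _ m]
  have int: "integrable stick (?f \<xi>)" for \<xi>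
    by (rule stick.integrable_const_bound[OF bnd(3)]) measurable
  have nonneg: "0 \<le> (LINT u|stick. ?f \<xi> u)" for \<xi>
    by (rule integral_nonneg_AE[OF bnd(1)])
  have le: "(LINT u|stick. ?f \<xi> u) \<le> 1" for \<xi>
    by (rule stick.integral_le_const[OF int bnd(2)])
  have "(\<integral>\<^sup>+\<xi>. \<integral>\<^sup>+u. ennreal (?f \<xi> u) \<partial>stick \<partial>\<mu>) = (\<integral>\<^sup>+\<xi>. ennreal (LINT u|stick. ?f \<xi> u) \<partial>\<mu>)"
    by (intro nn_integral_cong nn_integral_eq_integral int bnd(1))
  also have "\<dots> = ennreal (LINT \<xi>|\<mu>. LINT u|stick. ?f \<xi> u)"
    using nonneg le by (intro nn_integral_eq_integral integrable_const_bound[where B=1]) auto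
  finally show ?thesis by simp
qed

lemma integral_exp_normal:
  "(LINT z|normal. exp (\<i> * of_real (a * z))) = of_real (exp (- (a\<^sup>2 / 2)))"
proof -
  have "(LINT z|normal. exp (\<i> * of_real (a * z))) = char normal a"
    by (simp add: char_def)
  then show ?thesis by (simp add: char_std_normal_distribution)
qed

text \<open>Condition on the first step. Its normal variable integrates to the Gaussian factor with
  variance \<open>u / (1 + u) * (x \<bullet> \<xi>)\<^sup>2\<close>, and the independent tail
  contributes the same function one index lower at the rescaled point.\<close>

lemma char_partial_sum:
  "(LINT s|paths. exp (\<i> * of_real (x \<bullet> partial_sum m s))) = of_real (partial_char m x)"
proof (induction m arbitrary: x)
  case 0
  then show ?case using paths.prob_space by simp
next
  case (Suc m)
  let ?e = "\<lambda>m x s. exp (\<i> * of_real (x \<bullet> partial_sum m s)) :: complex"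
  have norm_e: "norm (?e m x s) = 1" for m x s by (simp add: norm_exp)
  have int: "integrable paths (?e m x)" for m x
    by (rule paths.integrable_const_bound[where B=1]) (auto simp: norm_e)
  let ?a = "\<lambda>\<xi> u. sqrt (u / (1 + u)) * (x \<bullet> \<xi>)"
  have [measurable]: "fst \<in> measurable steps borel" "(\<lambda>w. fst (snd w)) \<in> measurable steps borel" "(\<lambda>w. snd (snd w)) \<in> measurable steps borel"
    by measurable
  let ?g = "\<lambda>w. exp (\<i> * of_real (?a (fst w) (fst (snd w)) * snd (snd w))) *
      of_real (partial_char m (x /\<^sub>R sqrt (1 + fst (snd w)))) :: complex"
  have "(LINT s|paths. ?e (Suc m) x s) = (LINT w|steps. LINT s|paths. ?e (Suc m) x (w ## s))"
    by (rule steps.integral_stream_space[OF int])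
  also have "\<dots> = (LINT w|steps. ?g w)"
  proof (rule Bochner_Integration.integral_cong[OF refl])
    fix w
    have "?e (Suc m) x (w ## s) = exp (\<i> * of_real (?a (fst w) (fst (snd w)) * snd (snd w)))
        * ?e m (x /\<^sub>R sqrt (1 + fst (snd w))) s" for s
      by (simp add: exp_add[symmetric] inner_add_right algebra_simps)
    then show "(LINT s|paths. ?e (Suc m) x (w ## s)) = ?g w"
      using Suc by (simp only: integral_mult_right_zero)
  qed
  also have "\<dots> = (LINT \<xi>|\<mu>. LINT u|stick. LINT z|normal. ?g (\<xi>, u, z))"
  proof (rule integral_steps)
    show "norm (?g w) \<le> 1" for w
      using partial_char_bounds by (simp add: norm_mult norm_exp)
  qed measurable
  also have "\<dots> = (LINT \<xi>|\<mu>. LINT u|stick. complex_of_real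
      (exp (- (u / (1 + u) * (x \<bullet> \<xi>)\<^sup>2 / 2)) * partial_char m (x /\<^sub>R sqrt (1 + u))))"
  proof (rule Bochner_Integration.integral_cong[OF refl], rule integral_cong_AE)
    fix \<xi>
    show "AE u in stick. (LINT z|normal. ?g (\<xi>, u, z)) = complex_of_real
      (exp (- (u / (1 + u) * (x \<bullet> \<xi>)\<^sup>2 / 2)) * partial_char m (x /\<^sub>R sqrt (1 + u)))"
      using AE_stick_measure_nonneg[of \<theta>]
    proof eventually_elim
      case (elim u)
      have "(LINT z|normal. ?g (\<xi>, u, z)) = (LINT z|normal. exp (\<i> * of_real (?a \<xi> u * z)))
          * of_real (partial_char m (x /\<^sub>R sqrt (1 + u)))"
        by (simp only: fst_conv snd_conv integral_mult_left_zero)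
      also have "\<dots> = complex_of_real (exp (- ((?a \<xi> u)\<^sup>2 / 2)) * partial_char m (x /\<^sub>R sqrt (1 + u)))"
        unfolding integral_exp_normal by (simp only: of_real_mult)
      also have "(?a \<xi> u)\<^sup>2 = u / (1 + u) * (x \<bullet> \<xi>)\<^sup>2"
        using elim by (simp add: power_mult_distrib power_divide real_sqrt_divide)
      finally show ?case .
    qed
  qed measurable
  also have "\<dots> = of_real (partial_char (Suc m) x)"
    by (simp only: integral_complex_of_real partial_char.simps)
  finally show ?case .
qed

text \<open>The function \<open>g\<close> of the overview. Taking the real part loses nothing: the
  integral is a limit of real numbers, as \<open>char_limit_sum\<close> records.\<close>

definition limit_char :: "'a \<Rightarrow> real" where
  "limit_char x = Re (LINT s|paths. exp (\<i> * of_real (x \<bullet> limit_sum s)))"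

lemma limit_char_measurable[measurable]: "limit_char \<in> borel_measurable borel"
  unfolding limit_char_def by measurable

lemma partial_char_tendsto:
  "(\<lambda>m. complex_of_real (partial_char m x)) \<longlonglongrightarrow> (LINT s|paths. exp (\<i> * of_real (x \<bullet> limit_sum s)))"
  unfolding char_partial_sum[symmetric]
proof (rule integral_dominated_convergence[where w="\<lambda>_. 1"])
  show "AE s in paths. (\<lambda>m. exp (\<i> * complex_of_real (x \<bullet> partial_sum m s))) \<longlonglongrightarrow> exp (\<i> * of_real (x \<bullet> limit_sum s))"
    using AE_partial_sum_convergent
  proof eventually_elim
    case (elim s)
    then have "(\<lambda>m. partial_sum m s) \<longlonglongrightarrow> limit_sum s"
      by (simp add: limit_sum_def convergent_LIMSEQ_iff)
    then show ?case by (intro tendsto_intros)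
  qed
qed (auto simp: norm_exp)

lemma limit_char_LIMSEQ: "(\<lambda>m. partial_char m x) \<longlonglongrightarrow> limit_char x"
  using tendsto_Re[OF partial_char_tendsto[of x]] by (simp add: limit_char_def)

lemma char_limit_sum: "(LINT s|paths. exp (\<i> * of_real (x \<bullet> limit_sum s))) = of_real (limit_char x)"
  using tendsto_of_real[OF limit_char_LIMSEQ] partial_char_tendsto by (rule LIMSEQ_unique[symmetric])

lemma limit_char_bounds: "0 \<le> limit_char x" "limit_char x \<le> 1"
  using partial_char_bounds limit_char_LIMSEQ[of x]
  by (auto intro: LIMSEQ_le_const LIMSEQ_le_const2)

end

section \<open>Mellin integrals with a Gaussian cutoff and the Markov--Krein limit\<close>

context stick_breaking begin

declare partial_char.simps(2)[simp del]

text \<open>The cutoff is normalised so that multiplying by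
  \<open>exp (- (Q * t\<^sup>2 / 2))\<close> just replaces \<open>b\<close> by \<open>b + Q\<close>,
  while the integral over \<open>t\<close> is a constant times \<open>b powr (- \<theta>)\<close>.
  It also makes the integral finite for \<open>partial_char 0\<close>, which is constantly
  1.\<close>

definition gauss_weight :: "real \<Rightarrow> real \<Rightarrow> real" where
  "gauss_weight b t = \<bar>t\<bar> powr (2 * \<theta> - 1) * exp (- (b / 2 * t\<^sup>2))"

definition gauss_moment :: real where
  "gauss_moment = (LINT t|lborel. gauss_weight 1 t)"

definition gauss_mellin :: "('a \<Rightarrow> real) \<Rightarrow> 'a \<Rightarrow> real \<Rightarrow> ennreal" where
  "gauss_mellin f x b = (\<integral>\<^sup>+t. ennreal (gauss_weight b t * f (t *\<^sub>R x)) \<partial>lborel)"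

lemma gauss_weight_nonneg: "0 \<le> gauss_weight b t"
  by (simp add: gauss_weight_def)

lemma gauss_weight_measurable[measurable (raw)]:
  assumes [measurable]: "f \<in> borel_measurable N" "g \<in> borel_measurable N"
  shows "(\<lambda>w. gauss_weight (f w) (g w)) \<in> borel_measurable N"
  unfolding gauss_weight_def by measurable

lemma gauss_moment_pos: "0 < gauss_moment"
  unfolding gauss_moment_def gauss_weight_def
  using integral_gaussian_powr_pos[of "2 * \<theta>" "1 / 2"] \<theta> by simp

lemma gauss_mellin_measurable[measurable (raw)]:
  assumes [measurable]: "f \<in> borel_measurable borel" "g \<in> borel_measurable N" "h \<in> borel_measurable N"
  shows "(\<lambda>w. gauss_mellin f (g w) (h w)) \<in> borel_measurable N"
  unfolding gauss_mellin_def by measurable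

lemma nn_integral_gauss_weight:
  assumes b: "0 < b"
  shows "(\<integral>\<^sup>+t. ennreal (gauss_weight b t) \<partial>lborel) = ennreal (gauss_moment * b powr (- \<theta>))"
proof -
  have int: "integrable lborel (gauss_weight 1)"
    unfolding gauss_weight_def using integrable_gaussian_powr[of "2 * \<theta>" "1 / 2"] \<theta> by simp
  have "(\<integral>\<^sup>+t. ennreal (gauss_weight b t) \<partial>lborel)
      = (\<integral>\<^sup>+t. ennreal (\<bar>t\<bar> powr (2 * \<theta> - 1)) * ennreal (exp (- (1 / 2 * (sqrt b * t)\<^sup>2))) \<partial>lborel)"
    using b by (simp add: gauss_weight_def ennreal_mult[symmetric] power_mult_distrib)
  also have "\<dots> = ennreal (sqrt b powr (- (2 * \<theta>))) * (\<integral>\<^sup>+t. ennreal (\<bar>t\<bar> powr (2 * \<theta> - 1)) * ennreal (exp (- (1 / 2 * t\<^sup>2))) \<partial>lborel)"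
    using b by (intro nn_integral_abs_powr_scale[where f="\<lambda>t. ennreal (exp (- (1 / 2 * t\<^sup>2)))"]) auto
  also have "sqrt b powr (- (2 * \<theta>)) = b powr (- \<theta>)"
    using b by (simp add: powr_half_sqrt[symmetric] powr_powr)
  also have "(\<integral>\<^sup>+t. ennreal (\<bar>t\<bar> powr (2 * \<theta> - 1)) * ennreal (exp (- (1 / 2 * t\<^sup>2))) \<partial>lborel) = (\<integral>\<^sup>+t. ennreal (gauss_weight 1 t) \<partial>lborel)"
    by (simp add: gauss_weight_def ennreal_mult[symmetric])
  also have "\<dots> = ennreal gauss_moment"
    unfolding gauss_moment_def by (intro nn_integral_eq_integral int) (simp add: gauss_weight_nonneg)
  finally show ?thesis
    using gauss_moment_pos by (simp add: ennreal_mult[symmetric] mult.commute)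
qed

lemma gauss_mellin_0: "0 < b \<Longrightarrow> gauss_mellin (partial_char 0) x b = ennreal (gauss_moment * b powr (- \<theta>))"
  unfolding gauss_mellin_def by (simp add: nn_integral_gauss_weight)

text \<open>The Gaussian factor of the first piece merges with the cutoff and moves \<open>b\<close>
  to \<open>b + u / (1 + u) * (x \<bullet> \<xi>)\<^sup>2\<close>. By
  \<open>geom_mean_stick\<close>, the function \<open>geom_mean \<theta>\<close> is a fixed point of
  the resulting operator.\<close>

lemma gauss_mellin_Suc:
  "gauss_mellin (partial_char (Suc m)) x b =
     (\<integral>\<^sup>+\<xi>. \<integral>\<^sup>+u. gauss_mellin (partial_char m) (x /\<^sub>R sqrt (1 + u)) (b + u / (1 + u) * (x \<bullet> \<xi>)\<^sup>2) \<partial>stick \<partial>\<mu>)"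
proof -
  interpret P1: pair_sigma_finite \<mu> "lborel :: real measure" ..
  interpret P2: pair_sigma_finite stick "lborel :: real measure" ..
  let ?G = "\<lambda>\<xi> u t. ennreal (gauss_weight (b + u / (1 + u) * (x \<bullet> \<xi>)\<^sup>2) t * partial_char m (t *\<^sub>R (x /\<^sub>R sqrt (1 + u))))"
  have "ennreal (gauss_weight b t * partial_char (Suc m) (t *\<^sub>R x)) = (\<integral>\<^sup>+\<xi>. \<integral>\<^sup>+u. ?G \<xi> u t \<partial>stick \<partial>\<mu>)" for t
  proof -
    have eq: "ennreal (gauss_weight b t) * ennreal (exp (- (u / (1 + u) * ((t *\<^sub>R x) \<bullet> \<xi>)\<^sup>2 / 2)) * partial_char m ((t *\<^sub>R x) /\<^sub>R sqrt (1 + u)))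
        = ?G \<xi> u t" for \<xi> u
    proof -
      have "gauss_weight b t * exp (- (u / (1 + u) * ((t *\<^sub>R x) \<bullet> \<xi>)\<^sup>2 / 2)) = gauss_weight (b + u / (1 + u) * (x \<bullet> \<xi>)\<^sup>2) t"
        unfolding gauss_weight_def mult.assoc exp_add[symmetric]
        by (rule arg_cong[where f="\<lambda>r. \<bar>t\<bar> powr (2 * \<theta> - 1) * exp r"])
          (simp add: power_mult_distrib distrib_right add_divide_distrib)
      moreover have "(t *\<^sub>R x) /\<^sub>R sqrt (1 + u) = t *\<^sub>R (x /\<^sub>R sqrt (1 + u))"
        by (simp add: mult.commute)
      moreover have "ennreal r * ennreal (r' * partial_char m y) = ennreal (r * r' * partial_char m y)"
        if "0 \<le> r" "0 \<le> r'" for r r' y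
        using that partial_char_bounds[of m y] by (simp add: ennreal_mult[symmetric] mult.assoc)
      ultimately show ?thesis
        using gauss_weight_nonneg exp_ge_zero by metis
    qed
    have "ennreal (gauss_weight b t * partial_char (Suc m) (t *\<^sub>R x))
        = ennreal (gauss_weight b t) * ennreal (partial_char (Suc m) (t *\<^sub>R x))"
      by (rule ennreal_mult[OF gauss_weight_nonneg conjunct1[OF partial_char_bounds]])
    also have "\<dots> = (\<integral>\<^sup>+\<xi>. \<integral>\<^sup>+u. ennreal (gauss_weight b t) * ennreal (exp (- (u / (1 + u) * ((t *\<^sub>R x) \<bullet> \<xi>)\<^sup>2 / 2)) * partial_char m ((t *\<^sub>R x) /\<^sub>R sqrt (1 + u))) \<partial>stick \<partial>\<mu>)"
      unfolding ennreal_partial_char_Suc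
      by (subst nn_integral_cmult[symmetric], measurable, subst nn_integral_cmult[symmetric], measurable)
    finally show ?thesis unfolding eq .
  qed
  then have "gauss_mellin (partial_char (Suc m)) x b = (\<integral>\<^sup>+t. \<integral>\<^sup>+\<xi>. \<integral>\<^sup>+u. ?G \<xi> u t \<partial>stick \<partial>\<mu> \<partial>lborel)"
    unfolding gauss_mellin_def by (simp only:)
  also have "\<dots> = (\<integral>\<^sup>+\<xi>. \<integral>\<^sup>+t. \<integral>\<^sup>+u. ?G \<xi> u t \<partial>stick \<partial>lborel \<partial>\<mu>)"
    by (rule P1.Fubini') measurable
  also have "\<dots> = (\<integral>\<^sup>+\<xi>. \<integral>\<^sup>+u. \<integral>\<^sup>+t. ?G \<xi> u t \<partial>lborel \<partial>stick \<partial>\<mu>)"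
    by (intro nn_integral_cong P2.Fubini') measurable
  finally show ?thesis unfolding gauss_mellin_def .
qed

lemma nn_integral_cmult_iterated:
  assumes [measurable]: "(\<lambda>(\<xi>, u). F \<xi> u) \<in> borel_measurable (\<mu> \<Otimes>\<^sub>M stick)"
  shows "(\<integral>\<^sup>+\<xi>. \<integral>\<^sup>+u. c * F \<xi> u \<partial>stick \<partial>\<mu>) = c * (\<integral>\<^sup>+\<xi>. \<integral>\<^sup>+u. F \<xi> u \<partial>stick \<partial>\<mu>)"
proof -
  have "(\<integral>\<^sup>+\<xi>. \<integral>\<^sup>+u. c * F \<xi> u \<partial>stick \<partial>\<mu>) = (\<integral>\<^sup>+\<xi>. c * (\<integral>\<^sup>+u. F \<xi> u \<partial>stick) \<partial>\<mu>)"
    by (intro nn_integral_cong nn_integral_cmult) measurable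
  also have "\<dots> = c * (\<integral>\<^sup>+\<xi>. \<integral>\<^sup>+u. F \<xi> u \<partial>stick \<partial>\<mu>)"
    by (rule nn_integral_cmult) measurable
  finally show ?thesis .
qed

lemma nn_integral_gauss_moment_geom_mean:
  assumes "0 < b"
  shows "(\<integral>\<^sup>+\<xi>. \<integral>\<^sup>+u. ennreal gauss_moment * ennreal (geom_mean \<theta> (x /\<^sub>R sqrt (1 + u)) (b + u / (1 + u) * (x \<bullet> \<xi>)\<^sup>2)) \<partial>stick \<partial>\<mu>)
    = ennreal (gauss_moment * geom_mean \<theta> x b)"
proof -
  have "(\<integral>\<^sup>+\<xi>. \<integral>\<^sup>+u. ennreal gauss_moment * ennreal (geom_mean \<theta> (x /\<^sub>R sqrt (1 + u)) (b + u / (1 + u) * (x \<bullet> \<xi>)\<^sup>2)) \<partial>stick \<partial>\<mu>)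
    = ennreal gauss_moment * ennreal (geom_mean \<theta> x b)"
    unfolding geom_mean_stick[OF assms \<theta>, symmetric] by (rule nn_integral_cmult_iterated) measurable
  also have "\<dots> = ennreal (gauss_moment * geom_mean \<theta> x b)"
    by (intro ennreal_mult[symmetric] less_imp_le gauss_moment_pos geom_mean_pos)
  finally show ?thesis .
qed

text \<open>The recursion is monotone and fixes
  \<open>gauss_moment * geom_mean \<theta> x b\<close>. So the inequality at the start,
  \<open>geom_mean_le\<close>, persists.\<close>

lemma gauss_mellin_ge:
  assumes "0 < b"
  shows "ennreal (gauss_moment * geom_mean \<theta> x b) \<le> gauss_mellin (partial_char m) x b"
  using assms
proof (induction m arbitrary: x b)
  case 0
  then show ?case
    unfolding gauss_mellin_0[OF 0] using geom_mean_le[of b \<theta> x] \<theta> gauss_moment_pos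
    by (intro ennreal_leI mult_left_mono) auto
next
  case (Suc m)
  have "ennreal (gauss_moment * geom_mean \<theta> x b)
      = (\<integral>\<^sup>+\<xi>. \<integral>\<^sup>+u. ennreal gauss_moment * ennreal (geom_mean \<theta> (x /\<^sub>R sqrt (1 + u)) (b + u / (1 + u) * (x \<bullet> \<xi>)\<^sup>2)) \<partial>stick \<partial>\<mu>)"
    by (rule nn_integral_gauss_moment_geom_mean[OF Suc.prems, symmetric])
  also have "\<dots> \<le> gauss_mellin (partial_char (Suc m)) x b"
    unfolding gauss_mellin_Suc
  proof (rule nn_integral_mono, rule nn_integral_mono_AE)
    fix \<xi>
    show "AE u in stick. ennreal gauss_moment * ennreal (geom_mean \<theta> (x /\<^sub>R sqrt (1 + u)) (b + u / (1 + u) * (x \<bullet> \<xi>)\<^sup>2))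
        \<le> gauss_mellin (partial_char m) (x /\<^sub>R sqrt (1 + u)) (b + u / (1 + u) * (x \<bullet> \<xi>)\<^sup>2)"
      using AE_stick_measure_nonneg[of \<theta>]
    proof eventually_elim
      case (elim u)
      then have "0 < b + u / (1 + u) * (x \<bullet> \<xi>)\<^sup>2"
        using Suc.prems by (intro add_pos_nonneg) auto
      from Suc.IH[OF this] show ?case
        using gauss_moment_pos geom_mean_pos by (simp only: ennreal_mult less_imp_le)
    qed
  qed
  finally show ?case .
qed

text \<open>The initial error comes from \<open>geom_mean_ge\<close>. In each step \<open>b\<close>
  does not decrease, so the factor \<open>b powr (- \<theta> - 1)\<close> does not grow, while
  \<open>(norm x)\<^sup>2\<close> is divided by \<open>1 + u\<close>; the mean of
  \<open>1 / (1 + u)\<close> is the ratio \<open>\<theta> / (\<theta> + 1)\<close>.\<close>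

lemma gauss_mellin_le:
  assumes "0 < b"
  shows "gauss_mellin (partial_char m) x b \<le> ennreal (gauss_moment * geom_mean \<theta> x b)
    + ennreal (gauss_moment * \<theta> * b powr (- \<theta> - 1) * (norm x)\<^sup>2 * (\<theta> / (\<theta> + 1)) ^ m)"
  using assms
proof (induction m arbitrary: x b)
  case 0
  have "gauss_moment * b powr (- \<theta>) \<le> gauss_moment * (geom_mean \<theta> x b + \<theta> * b powr (- \<theta> - 1) * (norm x)\<^sup>2)"
    using geom_mean_ge[OF 0, of \<theta> x] \<theta> gauss_moment_pos by (intro mult_left_mono) auto
  also have "\<dots> = gauss_moment * geom_mean \<theta> x b + gauss_moment * \<theta> * b powr (- \<theta> - 1) * (norm x)\<^sup>2 * (\<theta> / (\<theta> + 1)) ^ 0"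
    by (simp add: algebra_simps)
  finally have "ennreal (gauss_moment * b powr (- \<theta>)) \<le> ennreal (gauss_moment * geom_mean \<theta> x b
      + gauss_moment * \<theta> * b powr (- \<theta> - 1) * (norm x)\<^sup>2 * (\<theta> / (\<theta> + 1)) ^ 0)"
    by (rule ennreal_leI)
  moreover have "0 \<le> gauss_moment * geom_mean \<theta> x b"
    "0 \<le> gauss_moment * \<theta> * b powr (- \<theta> - 1) * (norm x)\<^sup>2 * (\<theta> / (\<theta> + 1)) ^ 0"
    using \<theta> gauss_moment_pos geom_mean_pos[of \<theta> x b] by auto
  ultimately show ?case
    unfolding gauss_mellin_0[OF 0] by (simp only: ennreal_plus)
next
  case (Suc m)
  let ?b' = "\<lambda>u \<xi>. b + u / (1 + u) * (x \<bullet> \<xi>)\<^sup>2"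
  let ?K = "gauss_moment * \<theta> * b powr (- \<theta> - 1) * (norm x)\<^sup>2 * (\<theta> / (\<theta> + 1)) ^ m"
  let ?A = "\<lambda>\<xi> u. ennreal gauss_moment * ennreal (geom_mean \<theta> (x /\<^sub>R sqrt (1 + u)) (?b' u \<xi>))"
  let ?B = "\<lambda>u. ennreal ?K * ennreal ((1 + u) powr (- 1))"
  have K: "0 \<le> ?K" using \<theta> gauss_moment_pos by simp
  have "gauss_mellin (partial_char (Suc m)) x b
      \<le> (\<integral>\<^sup>+\<xi>. \<integral>\<^sup>+u. ennreal gauss_moment * ennreal (geom_mean \<theta> (x /\<^sub>R sqrt (1 + u)) (?b' u \<xi>)) + ennreal ?K * ennreal ((1 + u) powr (- 1)) \<partial>stick \<partial>\<mu>)"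
    unfolding gauss_mellin_Suc
  proof (rule nn_integral_mono, rule nn_integral_mono_AE)
    fix \<xi>
    show "AE u in stick. gauss_mellin (partial_char m) (x /\<^sub>R sqrt (1 + u)) (?b' u \<xi>)
        \<le> ennreal gauss_moment * ennreal (geom_mean \<theta> (x /\<^sub>R sqrt (1 + u)) (?b' u \<xi>)) + ennreal ?K * ennreal ((1 + u) powr (- 1))"
      using AE_stick_measure_nonneg[of \<theta>]
    proof eventually_elim
      case (elim u)
      have b': "0 < ?b' u \<xi>" "b \<le> ?b' u \<xi>" using elim Suc.prems by (auto intro!: add_pos_nonneg)
      have "gauss_mellin (partial_char m) (x /\<^sub>R sqrt (1 + u)) (?b' u \<xi>)
        \<le> ennreal (gauss_moment * geom_mean \<theta> (x /\<^sub>R sqrt (1 + u)) (?b' u \<xi>))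
        + ennreal (gauss_moment * \<theta> * ?b' u \<xi> powr (- \<theta> - 1) * (norm (x /\<^sub>R sqrt (1 + u)))\<^sup>2 * (\<theta> / (\<theta> + 1)) ^ m)"
        by (rule Suc.IH[OF b'(1)])
      also have "\<dots> \<le> ennreal (gauss_moment * geom_mean \<theta> (x /\<^sub>R sqrt (1 + u)) (?b' u \<xi>))
        + ennreal (gauss_moment * \<theta> * b powr (- \<theta> - 1) * ((norm x)\<^sup>2 * (1 + u) powr (- 1)) * (\<theta> / (\<theta> + 1)) ^ m)"
      proof (intro add_left_mono ennreal_leI mult_right_mono mult_mono)
        show "?b' u \<xi> powr (- \<theta> - 1) \<le> b powr (- \<theta> - 1)"
          using b' Suc.prems \<theta> by (intro powr_mono2') auto
        show "(norm (x /\<^sub>R sqrt (1 + u)))\<^sup>2 \<le> (norm x)\<^sup>2 * (1 + u) powr (- 1)"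
          using elim by (simp add: power_mult_distrib power_inverse powr_minus mult.commute)
      qed (use \<theta> gauss_moment_pos in auto)
      also have "\<dots> = ennreal gauss_moment * ennreal (geom_mean \<theta> (x /\<^sub>R sqrt (1 + u)) (?b' u \<xi>)) + ennreal ?K * ennreal ((1 + u) powr (- 1))"
        using K gauss_moment_pos by (simp add: ennreal_mult[symmetric] geom_mean_pos less_imp_le mult_ac)
      finally show ?case .
    qed
  qed
  also have "\<dots> = ennreal (gauss_moment * geom_mean \<theta> x b)
    + ennreal (gauss_moment * \<theta> * b powr (- \<theta> - 1) * (norm x)\<^sup>2 * (\<theta> / (\<theta> + 1)) ^ Suc m)"
  proof -
    have "(\<integral>\<^sup>+\<xi>. \<integral>\<^sup>+u. ?A \<xi> u + ?B u \<partial>stick \<partial>\<mu>)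
        = (\<integral>\<^sup>+\<xi>. (\<integral>\<^sup>+u. ?A \<xi> u \<partial>stick) + (\<integral>\<^sup>+u. ?B u \<partial>stick) \<partial>\<mu>)"
      by (intro nn_integral_cong nn_integral_add) measurable
    also have "\<dots> = (\<integral>\<^sup>+\<xi>. \<integral>\<^sup>+u. ?A \<xi> u \<partial>stick \<partial>\<mu>) + (\<integral>\<^sup>+\<xi>. \<integral>\<^sup>+u. ?B u \<partial>stick \<partial>\<mu>)"
      by (rule nn_integral_add) measurable
    also have "(\<integral>\<^sup>+\<xi>. \<integral>\<^sup>+u. ?B u \<partial>stick \<partial>\<mu>) = (\<integral>\<^sup>+u. ?B u \<partial>stick)"
      using emeasure_space_1 by simp
    also have "(\<integral>\<^sup>+u. ?B u \<partial>stick) = ennreal ?K * ennreal (\<theta> / (\<theta> + 1))"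
      using \<theta> by (subst nn_integral_cmult, measurable) (simp only: nn_integral_stick_measure_powr zero_le_one)
    also have "\<dots> = ennreal (?K * (\<theta> / (\<theta> + 1)))"
      using \<theta> K by (intro ennreal_mult[symmetric]) auto
    also have "?K * (\<theta> / (\<theta> + 1)) = gauss_moment * \<theta> * b powr (- \<theta> - 1) * (norm x)\<^sup>2 * (\<theta> / (\<theta> + 1)) ^ Suc m"
      by simp
    finally show ?thesis
      unfolding nn_integral_gauss_moment_geom_mean[OF Suc.prems] .
  qed
  finally show ?case .
qed

text \<open>The Markov--Krein identity proper: the left side amounts to \<open>gauss_moment\<close>
  times the expectation of \<open>(b + Q(x)) powr (- \<theta>)\<close>. Dominated convergence
  identifies the limit of the partial Mellin integrals, and the two preceding bounds give its
  value.\<close>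

lemma gauss_mellin_limit:
  assumes b: "0 < b"
  shows "gauss_mellin limit_char x b = ennreal (gauss_moment * geom_mean \<theta> x b)"
proof (rule LIMSEQ_unique)
  show "(\<lambda>m. gauss_mellin (partial_char m) x b) \<longlonglongrightarrow> gauss_mellin limit_char x b"
    unfolding gauss_mellin_def
  proof (rule nn_integral_dominated_convergence[where w="\<lambda>t. ennreal (gauss_weight b t)"])
    show "(\<integral>\<^sup>+t. ennreal (gauss_weight b t) \<partial>lborel) < \<infinity>"
      using b by (simp add: nn_integral_gauss_weight)
    fix m
    show "AE t in lborel. ennreal (gauss_weight b t * partial_char m (t *\<^sub>R x)) \<le> ennreal (gauss_weight b t)"
      using partial_char_bounds by (intro AE_I2 ennreal_leI mult_right_le_one_le) (auto simp: gauss_weight_nonneg)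
  next
    show "AE t in lborel. (\<lambda>m. ennreal (gauss_weight b t * partial_char m (t *\<^sub>R x))) \<longlonglongrightarrow> ennreal (gauss_weight b t * limit_char (t *\<^sub>R x))"
      by (intro AE_I2 tendsto_ennrealI tendsto_mult tendsto_const limit_char_LIMSEQ)
  qed measurable
  let ?K = "gauss_moment * \<theta> * b powr (- \<theta> - 1) * (norm x)\<^sup>2"
  have "(\<lambda>m. (\<theta> / (\<theta> + 1)) ^ m) \<longlonglongrightarrow> 0"
    using \<theta> by (intro LIMSEQ_power_zero) auto
  then have "(\<lambda>m. ?K * (\<theta> / (\<theta> + 1)) ^ m) \<longlonglongrightarrow> ?K * 0"
    by (intro tendsto_mult tendsto_const)
  then have "(\<lambda>m. ennreal (gauss_moment * geom_mean \<theta> x b) + ennreal (?K * (\<theta> / (\<theta> + 1)) ^ m))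
      \<longlonglongrightarrow> ennreal (gauss_moment * geom_mean \<theta> x b) + ennreal (?K * 0)"
    by (rule tendsto_add[OF tendsto_const tendsto_ennrealI])
  then have upper: "(\<lambda>m. ennreal (gauss_moment * geom_mean \<theta> x b) + ennreal (?K * (\<theta> / (\<theta> + 1)) ^ m))
      \<longlonglongrightarrow> ennreal (gauss_moment * geom_mean \<theta> x b)"
    by simp
  show "(\<lambda>m. gauss_mellin (partial_char m) x b) \<longlonglongrightarrow> ennreal (gauss_moment * geom_mean \<theta> x b)"
    by (rule tendsto_sandwich[OF _ _ tendsto_const upper])
      (rule always_eventually, rule allI, rule gauss_mellin_ge[OF b],
       rule always_eventually, rule allI, rule gauss_mellin_le[OF b])
qed

text \<open>Removal of the cutoff along \<open>b n = 1 / (n + 1)\<close>. The left side increases,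
  so monotone convergence applies with no prior finiteness. On the right,
  \<open>0 < b n \<le> 1\<close> places the logarithm between
  \<open>2 * ln \<bar>x \<bullet> \<xi>\<bar>\<close> and
  \<open>ln (1 + (x \<bullet> \<xi>)\<^sup>2)\<close>, both integrable; the pointwise limit uses
  that \<open>x \<bullet> \<xi>\<close> is almost surely nonzero.\<close>

lemma mellin_limit_char:
  assumes nz: "AE \<xi> in \<mu>. x \<bullet> \<xi> \<noteq> 0" and int: "integrable \<mu> (\<lambda>\<xi>. ln \<bar>x \<bullet> \<xi>\<bar>)"
  shows "(\<integral>\<^sup>+t. ennreal (\<bar>t\<bar> powr (2 * \<theta> - 1) * limit_char (t *\<^sub>R x)) \<partial>lborel)
    = ennreal (gauss_moment * exp (- (2 * \<theta>) * (LINT \<xi>|\<mu>. ln \<bar>x \<bullet> \<xi>\<bar>)))"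
proof (rule LIMSEQ_unique)
  define b where "b n = inverse (real (Suc n))" for n
  have b: "0 < b n" "b n \<le> 1" for n by (auto simp: b_def inverse_le_1_iff)
  have b_lim: "b \<longlonglongrightarrow> 0" unfolding b_def by (rule LIMSEQ_inverse_real_of_nat)
  have b_dec: "b n \<le> b m" if "m \<le> n" for m n
    using that unfolding b_def by (intro le_imp_inverse_le) auto
  show "(\<lambda>n. gauss_mellin limit_char x (b n)) \<longlonglongrightarrow> (\<integral>\<^sup>+t. ennreal (\<bar>t\<bar> powr (2 * \<theta> - 1) * limit_char (t *\<^sub>R x)) \<partial>lborel)"
    unfolding gauss_mellin_def
  proof (rule nn_integral_LIMSEQ)
    show "incseq (\<lambda>n t. ennreal (gauss_weight (b n) t * limit_char (t *\<^sub>R x)))"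
    proof (intro incseq_SucI le_funI ennreal_leI mult_right_mono limit_char_bounds)
      fix n t
      show "gauss_weight (b n) t \<le> gauss_weight (b (Suc n)) t"
        unfolding gauss_weight_def using b_dec[of n "Suc n"]
        by (intro mult_left_mono) (auto intro!: mult_right_mono)
    qed
    fix t
    have "(\<lambda>n. gauss_weight (b n) t) \<longlonglongrightarrow> \<bar>t\<bar> powr (2 * \<theta> - 1) * exp (- (0 / 2 * t\<^sup>2))"
      unfolding gauss_weight_def by (intro tendsto_intros b_lim) auto
    then show "(\<lambda>n. ennreal (gauss_weight (b n) t * limit_char (t *\<^sub>R x))) \<longlonglongrightarrow> ennreal (\<bar>t\<bar> powr (2 * \<theta> - 1) * limit_char (t *\<^sub>R x))"
      by (intro tendsto_ennrealI tendsto_mult tendsto_const) simp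
  qed measurable
  have "(\<lambda>n. LINT \<xi>|\<mu>. ln (b n + (x \<bullet> \<xi>)\<^sup>2)) \<longlonglongrightarrow> (LINT \<xi>|\<mu>. 2 * ln \<bar>x \<bullet> \<xi>\<bar>)"
  proof (rule integral_dominated_convergence)
    show "integrable \<mu> (\<lambda>\<xi>. \<bar>2 * ln \<bar>x \<bullet> \<xi>\<bar>\<bar> + \<bar>ln (1 + (x \<bullet> \<xi>)\<^sup>2)\<bar>)"
      using int by (intro Bochner_Integration.integrable_add integrable_abs integrable_ln integrable_mult_right) auto
    show "AE \<xi> in \<mu>. (\<lambda>n. ln (b n + (x \<bullet> \<xi>)\<^sup>2)) \<longlonglongrightarrow> 2 * ln \<bar>x \<bullet> \<xi>\<bar>"
      using nz
    proof eventually_elim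
      case (elim \<xi>)
      have "(\<lambda>n. ln (b n + (x \<bullet> \<xi>)\<^sup>2)) \<longlonglongrightarrow> ln (0 + (x \<bullet> \<xi>)\<^sup>2)"
        using elim by (intro tendsto_intros b_lim) auto
      moreover have "ln (0 + (x \<bullet> \<xi>)\<^sup>2) = 2 * ln \<bar>x \<bullet> \<xi>\<bar>"
        using elim ln_realpow[of "\<bar>x \<bullet> \<xi>\<bar>" 2] by simp
      ultimately show ?case by simp
    qed
    fix n
    show "AE \<xi> in \<mu>. norm (ln (b n + (x \<bullet> \<xi>)\<^sup>2)) \<le> \<bar>2 * ln \<bar>x \<bullet> \<xi>\<bar>\<bar> + \<bar>ln (1 + (x \<bullet> \<xi>)\<^sup>2)\<bar>"
      using nz
    proof eventually_elim
      case (elim \<xi>)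
      have "ln ((x \<bullet> \<xi>)\<^sup>2) \<le> ln (b n + (x \<bullet> \<xi>)\<^sup>2)" "ln (b n + (x \<bullet> \<xi>)\<^sup>2) \<le> ln (1 + (x \<bullet> \<xi>)\<^sup>2)"
        using elim b[of n] by (auto intro!: ln_mono add_pos_nonneg simp: less_imp_le)
      moreover have "ln ((x \<bullet> \<xi>)\<^sup>2) = 2 * ln \<bar>x \<bullet> \<xi>\<bar>"
        using elim ln_realpow[of "\<bar>x \<bullet> \<xi>\<bar>" 2] by simp
      ultimately show ?case unfolding real_norm_def by linarith
    qed
  qed (use int in auto)
  then have "(\<lambda>n. geom_mean \<theta> x (b n)) \<longlonglongrightarrow> exp (- \<theta> * (LINT \<xi>|\<mu>. 2 * ln \<bar>x \<bullet> \<xi>\<bar>))"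
    unfolding geom_mean_def by (intro tendsto_intros)
  then have "(\<lambda>n. ennreal (gauss_moment * geom_mean \<theta> x (b n))) \<longlonglongrightarrow> ennreal (gauss_moment * exp (- \<theta> * (LINT \<xi>|\<mu>. 2 * ln \<bar>x \<bullet> \<xi>\<bar>)))"
    by (intro tendsto_ennrealI tendsto_mult tendsto_const)
  moreover have "- \<theta> * (LINT \<xi>|\<mu>. 2 * ln \<bar>x \<bullet> \<xi>\<bar>) = - (2 * \<theta>) * (LINT \<xi>|\<mu>. ln \<bar>x \<bullet> \<xi>\<bar>)"
    by simp
  ultimately show "(\<lambda>n. gauss_mellin limit_char x (b n)) \<longlonglongrightarrow> ennreal (gauss_moment * exp (- (2 * \<theta>) * (LINT \<xi>|\<mu>. ln \<bar>x \<bullet> \<xi>\<bar>)))"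
    unfolding gauss_mellin_limit[OF b(1)] by (simp only:)
qed

end

section \<open>Representation of the negative power\<close>

lemma gaussian_prod:
  fixes x :: "'a::euclidean_space"
  shows "exp (- ((norm x)\<^sup>2 / 2)) = (\<Prod>b\<in>Basis. exp (- ((x \<bullet> b)\<^sup>2 / 2)))"
proof -
  have "(norm x)\<^sup>2 = (\<Sum>b\<in>Basis. (x \<bullet> b)\<^sup>2)"
    by (subst power2_norm_eq_inner, subst euclidean_inner) (simp only: power2_eq_square)
  then show ?thesis
    by (simp add: exp_sum[symmetric] sum_negf sum_divide_distrib)
qed

lemma
  fixes a :: real
  shows integrable_gaussian_fourier: "integrable lborel (\<lambda>t. of_real (exp (- (t\<^sup>2 / 2))) * exp (\<i> * of_real (a * t)) :: complex)"
    and integral_gaussian_fourier: "(LINT t|lborel. of_real (exp (- (t\<^sup>2 / 2))) * exp (\<i> * of_real (a * t)))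
      = complex_of_real (sqrt (2 * pi) * exp (- (a\<^sup>2 / 2)))"
proof -
  interpret prob_space std_normal_distribution by (rule prob_space_normal_density) simp
  let ?e = "\<lambda>t. exp (\<i> * of_real (a * t)) :: complex"
  have dens: "std_normal_density t *\<^sub>R ?e t = of_real (1 / sqrt (2 * pi)) * (of_real (exp (- (t\<^sup>2 / 2))) * ?e t)" for t
    by (simp add: std_normal_density_def scaleR_conv_of_real)
  have "integrable std_normal_distribution ?e"
    by (rule integrable_const_bound[where B=1]) (auto simp: norm_exp)
  then have "integrable lborel (\<lambda>t. std_normal_density t *\<^sub>R ?e t)"
    by (subst (asm) integrable_density) (auto intro: normal_density_nonneg)
  then have *: "integrable lborel (\<lambda>t. of_real (1 / sqrt (2 * pi)) * (of_real (exp (- (t\<^sup>2 / 2))) * ?e t))"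
    unfolding dens .
  have cancel: "of_real (sqrt (2 * pi)) * (of_real (1 / sqrt (2 * pi)) * z) = z" for z :: complex
    by simp
  show "integrable lborel (\<lambda>t. of_real (exp (- (t\<^sup>2 / 2))) * ?e t)"
    using integrable_mult_right[OF *, of "of_real (sqrt (2 * pi))"] unfolding cancel .
  have "char std_normal_distribution a = (LINT t|lborel. std_normal_density t *\<^sub>R ?e t)"
    unfolding char_def
    by (subst integral_density) (auto intro: normal_density_nonneg)
  also have "\<dots> = of_real (1 / sqrt (2 * pi)) * (LINT t|lborel. of_real (exp (- (t\<^sup>2 / 2))) * ?e t)"
    unfolding dens by (rule integral_mult_right_zero)
  finally have "of_real (sqrt (2 * pi)) * of_real (exp (- (a\<^sup>2 / 2)))
      = of_real (sqrt (2 * pi)) * (of_real (1 / sqrt (2 * pi)) * (LINT t|lborel. of_real (exp (- (t\<^sup>2 / 2))) * ?e t))"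
    by (simp only: char_std_normal_distribution minus_divide_left)
  then show "(LINT t|lborel. of_real (exp (- (t\<^sup>2 / 2))) * ?e t) = complex_of_real (sqrt (2 * pi) * exp (- (a\<^sup>2 / 2)))"
    unfolding cancel by simp
qed

lemma
  fixes y :: "'a::euclidean_space"
  shows integrable_gaussian_norm: "integrable lborel (\<lambda>x::'a. exp (- ((norm x)\<^sup>2 / 2)))"
    and integral_gaussian_norm: "(LINT x|lborel. of_real (exp (- ((norm x)\<^sup>2 / 2))) * exp (\<i> * of_real (x \<bullet> y)))
      = complex_of_real (sqrt (2 * pi) ^ DIM('a) * exp (- ((norm y)\<^sup>2 / 2)))"
proof -
  have eq: "of_real (exp (- ((norm x)\<^sup>2 / 2))) * exp (\<i> * of_real (x \<bullet> y))
      = (\<Prod>b\<in>Basis. of_real (exp (- ((x \<bullet> b)\<^sup>2 / 2))) * exp (\<i> * of_real ((y \<bullet> b) * (x \<bullet> b))) :: complex)" for x y :: 'a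
  proof -
    have "exp (\<i> * of_real (x \<bullet> y)) = (\<Prod>b\<in>Basis. exp (\<i> * of_real ((y \<bullet> b) * (x \<bullet> b))) :: complex)"
      by (simp add: exp_sum[symmetric] euclidean_inner[of x y] sum_distrib_left[symmetric] of_real_sum[symmetric] mult.commute
          del: of_real_mult of_real_sum)
    then show ?thesis by (simp add: gaussian_prod prod.distrib)
  qed
  have "integrable lborel (\<lambda>x::'a. of_real (exp (- ((norm x)\<^sup>2 / 2))) * exp (\<i> * of_real (x \<bullet> 0)) :: complex)"
    unfolding eq by (rule integrable_lborel_prod) (rule integrable_gaussian_fourier)
  then have "integrable lborel (\<lambda>x::'a. complex_of_real (exp (- ((norm x)\<^sup>2 / 2))))" by simp
  then show "integrable lborel (\<lambda>x::'a. exp (- ((norm x)\<^sup>2 / 2)))"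
    by (simp only: complex_of_real_integrable_eq)
  show "(LINT x|lborel. of_real (exp (- ((norm x)\<^sup>2 / 2))) * exp (\<i> * of_real (x \<bullet> y)))
      = complex_of_real (sqrt (2 * pi) ^ DIM('a) * exp (- ((norm y)\<^sup>2 / 2)))"
    unfolding eq
    by (subst integral_lborel_prod, rule integrable_gaussian_fourier)
      (simp only: integral_gaussian_fourier, simp add: gaussian_prod prod.distrib)
qed

lemma integrable_norm_powr_gaussian:
  fixes p :: real
  assumes "0 \<le> p" "p < DIM('a::euclidean_space)"
  shows "integrable lborel (\<lambda>x::'a. norm x powr (- p) *\<^sub>R exp (- ((norm x)\<^sup>2 / 2)))"
proof -
  let ?M = "2 * DIM('a)"
  obtain B where "\<And>t::real. (1 + \<bar>t\<bar>) ^ ?M * exp (- (1 / 2 * t\<^sup>2)) \<le> B"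
    using power_mult_gaussian_bounded[of "1 / 2" ?M] by auto
  from this[of "norm (_::'a)"] show ?thesis
    by (intro integrable_norm_powr_decay[where B=B] assms) (auto simp: mult.commute)
qed

context stick_breaking begin

lemma limit_char_uminus: "limit_char (- x) = limit_char x"
proof -
  have "limit_char (- x) = Re (LINT s|paths. cnj (exp (\<i> * of_real (x \<bullet> limit_sum s))))"
    by (simp add: limit_char_def exp_cnj)
  also have "\<dots> = limit_char x"
    by (simp only: Bochner_Integration.integral_cnj complex_cnj limit_char_def cnj.sel)
  finally show ?thesis .
qed

text \<open>Parseval's relation between \<open>f\<close> and the law of
  \<open>t *\<^sub>R limit_sum\<close>. It is used twice, with a Gaussian to obtain finiteness and
  with a Schwartz function to obtain the representation.\<close>

lemma integral_fourier_paths: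
  fixes f :: "'a \<Rightarrow> complex"
  assumes f: "integrable lborel f"
  shows "(LINT s|paths. LINT x|lborel. f x * exp (\<i> * of_real (x \<bullet> (t *\<^sub>R limit_sum s))))
    = (LINT x|lborel. f x * of_real (limit_char (t *\<^sub>R x)))"
proof -
  interpret P: pair_sigma_finite paths "lborel :: 'a measure" ..
  note [measurable] = borel_measurable_integrable[OF f, simplified]
  let ?F = "\<lambda>s x. f x * exp (\<i> * of_real (x \<bullet> (t *\<^sub>R limit_sum s)))"
  have "integrable (paths \<Otimes>\<^sub>M lborel) (case_prod ?F)"
  proof (rule integrableI_bounded)
    have "(\<integral>\<^sup>+w. ennreal (norm (case_prod ?F w)) \<partial>(paths \<Otimes>\<^sub>M lborel)) = (\<integral>\<^sup>+s. \<integral>\<^sup>+x. ennreal (norm (f x)) \<partial>lborel \<partial>paths)"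
      by (subst lborel.nn_integral_fst[symmetric]) (auto simp: norm_mult norm_exp)
    also have "\<dots> < \<infinity>"
      using f paths.emeasure_space_1 by (simp add: integrable_iff_bounded)
    finally show "(\<integral>\<^sup>+w. ennreal (norm (case_prod ?F w)) \<partial>(paths \<Otimes>\<^sub>M lborel)) < \<infinity>" .
  qed measurable
  then have "(LINT s|paths. LINT x|lborel. ?F s x) = (LINT x|lborel. LINT s|paths. ?F s x)"
    by (rule P.Fubini_integral[symmetric])
  moreover have "(LINT s|paths. ?F s x) = f x * of_real (limit_char (t *\<^sub>R x))" for x
    using char_limit_sum[of "t *\<^sub>R x"] by simp
  ultimately show ?thesis by (simp only:)
qed

end

text \<open>The star body enters through the linear lower bound on \<open>N\<close>. It dominates
  \<open>N x powr (- (2 * \<theta>))\<close> by a multiple of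
  \<open>norm x powr (- (2 * \<theta>))\<close>, which is locally integrable because of
  \<open>dim\<close>.\<close>

locale log_embedding = stick_breaking \<mu> \<theta> for \<mu> :: "'a::euclidean_space measure" and \<theta> +
  fixes N :: "'a \<Rightarrow> real" and C c :: real
  assumes dim: "2 * \<theta> < DIM('a)"
    and c: "0 < c" and N_ge: "\<And>x. c * norm x \<le> N x"
    and nonorthogonal: "\<And>x. x \<noteq> 0 \<Longrightarrow> AE \<xi> in \<mu>. x \<bullet> \<xi> \<noteq> 0"
    and ln_integrable: "\<And>x. x \<noteq> 0 \<Longrightarrow> integrable \<mu> (\<lambda>\<xi>. ln \<bar>x \<bullet> \<xi>\<bar>)"
    and ln_N: "\<And>x. x \<noteq> 0 \<Longrightarrow> ln (N x) = (LINT \<xi>|\<mu>. ln \<bar>x \<bullet> \<xi>\<bar>) + C"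
begin

text \<open>The constant between the Mellin integral of \<open>limit_char\<close> and the power of
  \<open>N\<close>: in \<open>ln_N\<close> the mean of the logarithm is \<open>ln (N x) - C\<close>,
  whence the factor \<open>exp (2 * \<theta> * C)\<close>.\<close>

definition mass :: real where
  "mass = gauss_moment * exp (2 * \<theta> * C)"

lemma mass_pos: "0 < mass"
  by (simp add: mass_def gauss_moment_pos)

lemma mellin_limit_char_N:
  assumes x: "x \<noteq> 0"
  shows "(\<integral>\<^sup>+t. ennreal (\<bar>t\<bar> powr (2 * \<theta> - 1) * limit_char (t *\<^sub>R x)) \<partial>lborel) = ennreal (mass * N x powr (- (2 * \<theta>)))"
proof -
  have "0 < c * norm x" using x c by simp
  then have "0 < N x" using N_ge[of x] by linarith
  then have "mass * N x powr (- (2 * \<theta>)) = gauss_moment * exp (- (2 * \<theta>) * (LINT \<xi>|\<mu>. ln \<bar>x \<bullet> \<xi>\<bar>))"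
    using x by (simp add: mass_def powr_def ln_N exp_add[symmetric] algebra_simps)
  then show ?thesis
    using mellin_limit_char[OF nonorthogonal[OF x] ln_integrable[OF x]] by simp
qed

text \<open>Off the origin the function is, up to a constant, a parameter-dependent integral of a
  measurable function; the single point 0 is treated separately.\<close>

lemma N_powr_measurable[measurable]: "(\<lambda>x. N x powr (- (2 * \<theta>))) \<in> borel_measurable borel"
proof -
  have "(\<lambda>x. N x powr (- (2 * \<theta>))) = (\<lambda>x. if x = 0 then N 0 powr (- (2 * \<theta>))
      else enn2real (\<integral>\<^sup>+t. ennreal (\<bar>t\<bar> powr (2 * \<theta> - 1) * limit_char (t *\<^sub>R x)) \<partial>lborel) / mass)"
    using mass_pos by (auto simp: fun_eq_iff mellin_limit_char_N)
  also have "\<dots> \<in> borel_measurable borel" by measurable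
  finally show ?thesis .
qed

lemma N_powr_le:
  assumes "x \<noteq> 0"
  shows "N x powr (- (2 * \<theta>)) \<le> c powr (- (2 * \<theta>)) * norm x powr (- (2 * \<theta>))"
proof -
  have "N x powr (- (2 * \<theta>)) \<le> (c * norm x) powr (- (2 * \<theta>))"
    using assms c \<theta> N_ge[of x] by (intro powr_mono2') auto
  then show ?thesis using c by (simp add: powr_mult)
qed

text \<open>Tonelli puts the integral over \<open>t\<close> inside, where
  \<open>mellin_limit_char_N\<close> evaluates it to a multiple of
  \<open>N x powr (- (2 * \<theta>))\<close>; the lower bound on \<open>N\<close> then compares with
  the assumed integrability.\<close>

lemma nn_integral_limit_char_le:
  fixes f :: "'a \<Rightarrow> real"
  assumes [measurable]: "f \<in> borel_measurable borel" and nonneg: "\<And>x. 0 \<le> f x"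
    and int: "integrable lborel (\<lambda>x. norm x powr (- (2 * \<theta>)) *\<^sub>R f x)"
  shows "(\<integral>\<^sup>+t. \<integral>\<^sup>+x. ennreal (\<bar>t\<bar> powr (2 * \<theta> - 1) * (f x * limit_char (t *\<^sub>R x))) \<partial>lborel \<partial>lborel) < \<infinity>"
proof -
  have "(\<integral>\<^sup>+t. \<integral>\<^sup>+x. ennreal (\<bar>t\<bar> powr (2 * \<theta> - 1) * (f x * limit_char (t *\<^sub>R x))) \<partial>lborel \<partial>lborel)
      = (\<integral>\<^sup>+x. \<integral>\<^sup>+t. ennreal (\<bar>t\<bar> powr (2 * \<theta> - 1) * (f x * limit_char (t *\<^sub>R x))) \<partial>lborel \<partial>lborel)"
    by (rule lborel_pair.Fubini'[symmetric]) measurable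
  also have "\<dots> = (\<integral>\<^sup>+x. ennreal (f x) * (\<integral>\<^sup>+t. ennreal (\<bar>t\<bar> powr (2 * \<theta> - 1) * limit_char (t *\<^sub>R x)) \<partial>lborel) \<partial>lborel)"
  proof (rule nn_integral_cong)
    fix x
    have "(\<integral>\<^sup>+t. ennreal (\<bar>t\<bar> powr (2 * \<theta> - 1) * (f x * limit_char (t *\<^sub>R x))) \<partial>lborel)
        = (\<integral>\<^sup>+t. ennreal (f x) * ennreal (\<bar>t\<bar> powr (2 * \<theta> - 1) * limit_char (t *\<^sub>R x)) \<partial>lborel)"
      using nonneg limit_char_bounds by (simp add: ennreal_mult[symmetric] mult.left_commute)
    also have "\<dots> = ennreal (f x) * (\<integral>\<^sup>+t. ennreal (\<bar>t\<bar> powr (2 * \<theta> - 1) * limit_char (t *\<^sub>R x)) \<partial>lborel)"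
      by (rule nn_integral_cmult) measurable
    finally show "(\<integral>\<^sup>+t. ennreal (\<bar>t\<bar> powr (2 * \<theta> - 1) * (f x * limit_char (t *\<^sub>R x))) \<partial>lborel)
      = ennreal (f x) * (\<integral>\<^sup>+t. ennreal (\<bar>t\<bar> powr (2 * \<theta> - 1) * limit_char (t *\<^sub>R x)) \<partial>lborel)" .
  qed
  also have "\<dots> \<le> (\<integral>\<^sup>+x. ennreal (mass * c powr (- (2 * \<theta>))) * ennreal (norm x powr (- (2 * \<theta>)) *\<^sub>R f x) \<partial>lborel)"
  proof (rule nn_integral_mono_AE)
    show "AE x in lborel. ennreal (f x) * (\<integral>\<^sup>+t. ennreal (\<bar>t\<bar> powr (2 * \<theta> - 1) * limit_char (t *\<^sub>R x)) \<partial>lborel)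
        \<le> ennreal (mass * c powr (- (2 * \<theta>))) * ennreal (norm x powr (- (2 * \<theta>)) *\<^sub>R f x)"
      using AE_lborel_singleton[of "0::'a"]
    proof eventually_elim
      case (elim x)
      have "f x * (mass * N x powr (- (2 * \<theta>))) \<le> f x * (mass * (c powr (- (2 * \<theta>)) * norm x powr (- (2 * \<theta>))))"
        using nonneg mass_pos by (intro mult_left_mono N_powr_le elim) auto
      also have "\<dots> = mass * c powr (- (2 * \<theta>)) * (norm x powr (- (2 * \<theta>)) *\<^sub>R f x)" by simp
      finally show ?case
        using nonneg mass_pos unfolding mellin_limit_char_N[OF elim]
        by (simp only: ennreal_mult[symmetric] mult_nonneg_nonneg powr_ge_zero less_imp_le scaleR_nonneg_nonneg ennreal_leI)
    qed
  qed
  also have "\<dots> = ennreal (mass * c powr (- (2 * \<theta>))) * (\<integral>\<^sup>+x. ennreal (norm x powr (- (2 * \<theta>)) *\<^sub>R f x) \<partial>lborel)"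
    by (rule nn_integral_cmult) measurable
  also have "(\<integral>\<^sup>+x. ennreal (norm x powr (- (2 * \<theta>)) *\<^sub>R f x) \<partial>lborel) = ennreal (LINT x|lborel. norm x powr (- (2 * \<theta>)) *\<^sub>R f x)"
    using nonneg by (intro nn_integral_eq_integral int) auto
  finally show ?thesis
    by (simp add: ennreal_mult_less_top le_less_trans)
qed

lemma nn_integral_gauss_weight_limit_sum:
  "(\<integral>\<^sup>+s. \<integral>\<^sup>+t. ennreal (gauss_weight ((norm (limit_sum s))\<^sup>2) t) \<partial>lborel \<partial>paths) < \<infinity>"
proof -
  interpret P: pair_sigma_finite paths "lborel :: real measure" ..
  let ?\<kappa> = "sqrt (2 * pi) ^ DIM('a)"
  have \<kappa>: "0 < ?\<kappa>" by simp
  let ?g = "\<lambda>x::'a. exp (- ((norm x)\<^sup>2 / 2))"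
  let ?e = "\<lambda>t s. exp (- ((norm (t *\<^sub>R limit_sum s))\<^sup>2 / 2))"
  have expect: "ennreal ?\<kappa> * (\<integral>\<^sup>+s. ennreal (?e t s) \<partial>paths) = (\<integral>\<^sup>+x. ennreal (?g x * limit_char (t *\<^sub>R x)) \<partial>lborel)" for t
  proof -
    have int1: "integrable paths (?e t)"
      by (rule paths.integrable_const_bound[where B=1]) auto
    have int2: "integrable lborel (\<lambda>x. ?g x * limit_char (t *\<^sub>R x))"
      using limit_char_bounds
      by (intro Bochner_Integration.integrable_bound[OF integrable_gaussian_norm]) (auto intro!: AE_I2 mult_right_le_one_le)
    have "complex_of_real (?\<kappa> * (LINT s|paths. ?e t s)) = (LINT s|paths. complex_of_real (?\<kappa> * ?e t s))"
      by (simp only: integral_mult_right_zero[symmetric] integral_complex_of_real)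
    also have "\<dots> = (LINT s|paths. LINT x|lborel. of_real (?g x) * exp (\<i> * of_real (x \<bullet> (t *\<^sub>R limit_sum s))))"
      by (simp only: integral_gaussian_norm)
    also have "\<dots> = (LINT x|lborel. of_real (?g x) * of_real (limit_char (t *\<^sub>R x)))"
      by (rule integral_fourier_paths) (simp only: complex_of_real_integrable_eq integrable_gaussian_norm)
    also have "\<dots> = complex_of_real (LINT x|lborel. ?g x * limit_char (t *\<^sub>R x))"
      by (simp only: of_real_mult[symmetric] integral_complex_of_real)
    finally have eq: "?\<kappa> * (LINT s|paths. ?e t s) = (LINT x|lborel. ?g x * limit_char (t *\<^sub>R x))"
      by (simp only: of_real_eq_iff)
    have "ennreal ?\<kappa> * (\<integral>\<^sup>+s. ennreal (?e t s) \<partial>paths) = ennreal ?\<kappa> * ennreal (LINT s|paths. ?e t s)"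
      by (subst nn_integral_eq_integral[OF int1]) auto
    also have "\<dots> = ennreal (LINT x|lborel. ?g x * limit_char (t *\<^sub>R x))"
      unfolding eq[symmetric] using \<kappa> by (intro ennreal_mult[symmetric]) auto
    also have "\<dots> = (\<integral>\<^sup>+x. ennreal (?g x * limit_char (t *\<^sub>R x)) \<partial>lborel)"
      using limit_char_bounds by (intro nn_integral_eq_integral[symmetric] int2) auto
    finally show ?thesis .
  qed
  have gw: "gauss_weight ((norm (limit_sum s))\<^sup>2) t = \<bar>t\<bar> powr (2 * \<theta> - 1) * ?e t s" for s t
    by (simp add: gauss_weight_def power_mult_distrib mult.commute)
  have "ennreal ?\<kappa> * (\<integral>\<^sup>+s. \<integral>\<^sup>+t. ennreal (gauss_weight ((norm (limit_sum s))\<^sup>2) t) \<partial>lborel \<partial>paths)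
      = ennreal ?\<kappa> * (\<integral>\<^sup>+t. \<integral>\<^sup>+s. ennreal (\<bar>t\<bar> powr (2 * \<theta> - 1) * ?e t s) \<partial>paths \<partial>lborel)"
    unfolding gw by (subst P.Fubini') auto
  also have "\<dots> = (\<integral>\<^sup>+t. ennreal ?\<kappa> * (\<integral>\<^sup>+s. ennreal (\<bar>t\<bar> powr (2 * \<theta> - 1) * ?e t s) \<partial>paths) \<partial>lborel)"
    by (rule nn_integral_cmult[symmetric]) measurable
  also have "\<dots> = (\<integral>\<^sup>+t. \<integral>\<^sup>+x. ennreal (\<bar>t\<bar> powr (2 * \<theta> - 1) * (?g x * limit_char (t *\<^sub>R x))) \<partial>lborel \<partial>lborel)"
  proof (rule nn_integral_cong)
    fix t :: real
    have "(\<integral>\<^sup>+s. ennreal (\<bar>t\<bar> powr (2 * \<theta> - 1) * ?e t s) \<partial>paths) = ennreal (\<bar>t\<bar> powr (2 * \<theta> - 1)) * (\<integral>\<^sup>+s. ennreal (?e t s) \<partial>paths)"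
      by (subst nn_integral_cmult[symmetric]) (auto simp: ennreal_mult)
    then have "ennreal ?\<kappa> * (\<integral>\<^sup>+s. ennreal (\<bar>t\<bar> powr (2 * \<theta> - 1) * ?e t s) \<partial>paths)
        = ennreal (\<bar>t\<bar> powr (2 * \<theta> - 1)) * (ennreal ?\<kappa> * (\<integral>\<^sup>+s. ennreal (?e t s) \<partial>paths))"
      by (simp only: mult.left_commute)
    also have "\<dots> = ennreal (\<bar>t\<bar> powr (2 * \<theta> - 1)) * (\<integral>\<^sup>+x. ennreal (?g x * limit_char (t *\<^sub>R x)) \<partial>lborel)"
      unfolding expect ..
    also have "\<dots> = (\<integral>\<^sup>+x. ennreal (\<bar>t\<bar> powr (2 * \<theta> - 1)) * ennreal (?g x * limit_char (t *\<^sub>R x)) \<partial>lborel)"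
      by (rule nn_integral_cmult[symmetric]) measurable
    also have "\<dots> = (\<integral>\<^sup>+x. ennreal (\<bar>t\<bar> powr (2 * \<theta> - 1) * (?g x * limit_char (t *\<^sub>R x))) \<partial>lborel)"
      using limit_char_bounds by (intro nn_integral_cong ennreal_mult[symmetric]) auto
    finally show "ennreal ?\<kappa> * (\<integral>\<^sup>+s. ennreal (\<bar>t\<bar> powr (2 * \<theta> - 1) * ?e t s) \<partial>paths)
        = (\<integral>\<^sup>+x. ennreal (\<bar>t\<bar> powr (2 * \<theta> - 1) * (?g x * limit_char (t *\<^sub>R x))) \<partial>lborel)" .
  qed
  also have "\<dots> < \<infinity>"
    using dim \<theta> by (intro nn_integral_limit_char_le integrable_norm_powr_gaussian) auto
  finally show ?thesis
    using \<kappa> by (auto simp: ennreal_mult_less_top)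
qed

text \<open>With cutoff 0 the weight has infinite integral, which the previous lemma permits only on
  a null set. This has to come before the negative moment: since
  \<open>0 powr (- (2 * \<theta>)) = 0\<close>, finiteness of that moment would not exclude an atom
  at the origin.\<close>

lemma AE_limit_sum_neq_0: "AE s in paths. limit_sum s \<noteq> 0"
proof -
  have "AE s in paths. (\<integral>\<^sup>+t. ennreal (gauss_weight ((norm (limit_sum s))\<^sup>2) t) \<partial>lborel) \<noteq> \<infinity>"
    using nn_integral_gauss_weight_limit_sum by (intro nn_integral_PInf_AE) auto
  then show ?thesis
  proof eventually_elim
    case (elim s)
    show ?case
    proof
      assume "limit_sum s = 0"
      then obtain r where r: "(\<integral>\<^sup>+t. ennreal (gauss_weight 0 t) \<partial>lborel) = ennreal r" "0 \<le> r"
        using elim by (cases "\<integral>\<^sup>+t. ennreal (gauss_weight 0 t) \<partial>lborel") auto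
      have le: "gauss_moment * b powr (- \<theta>) \<le> r" if "0 < b" for b
      proof -
        have "ennreal (gauss_moment * b powr (- \<theta>)) \<le> ennreal r"
          unfolding nn_integral_gauss_weight[OF that, symmetric] r(1)[symmetric]
          using that by (intro nn_integral_mono ennreal_leI) (auto simp: gauss_weight_def intro!: mult_left_le)
        then show ?thesis using r by (simp add: ennreal_le_iff)
      qed
      \<comment> \<open>The cutoff \<open>b = ((r + 1) / gauss_moment) powr (- 1 / \<theta>)\<close>
        is chosen to make the lower bound in \<open>le\<close> equal to
        \<open>r + 1\<close>.\<close>
      have "0 < (r + 1) / gauss_moment" using r gauss_moment_pos by simp
      then have "gauss_moment * (((r + 1) / gauss_moment) powr (- 1 / \<theta>)) powr (- \<theta>) = r + 1"
        using \<theta> gauss_moment_pos r by (simp add: powr_powr)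
      moreover have "0 < ((r + 1) / gauss_moment) powr (- 1 / \<theta>)"
        using \<open>0 < (r + 1) / gauss_moment\<close> by (metis powr_gt_zero less_irrefl)
      from le[OF this] have "gauss_moment * (((r + 1) / gauss_moment) powr (- 1 / \<theta>)) powr (- \<theta>) \<le> r" .
      ultimately show False by linarith
    qed
  qed
qed


lemma nn_integral_norm_limit_sum_powr:
  "(\<integral>\<^sup>+s. ennreal (norm (limit_sum s) powr (- (2 * \<theta>))) \<partial>paths) < \<infinity>"
proof -
  have "(\<integral>\<^sup>+s. \<integral>\<^sup>+t. ennreal (gauss_weight ((norm (limit_sum s))\<^sup>2) t) \<partial>lborel \<partial>paths)
      = (\<integral>\<^sup>+s. ennreal gauss_moment * ennreal (norm (limit_sum s) powr (- (2 * \<theta>))) \<partial>paths)"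
  proof (rule nn_integral_cong_AE)
    show "AE s in paths. (\<integral>\<^sup>+t. ennreal (gauss_weight ((norm (limit_sum s))\<^sup>2) t) \<partial>lborel)
        = ennreal gauss_moment * ennreal (norm (limit_sum s) powr (- (2 * \<theta>)))"
      using AE_limit_sum_neq_0
    proof eventually_elim
      case (elim s)
      then have "((norm (limit_sum s))\<^sup>2) powr (- \<theta>) = norm (limit_sum s) powr (- (2 * \<theta>))"
      proof -
        have "(norm (limit_sum s))\<^sup>2 = norm (limit_sum s) powr 2" using elim by simp
        then show ?thesis by (simp only: powr_powr) simp
      qed
      with elim show ?case
        using gauss_moment_pos by (simp add: nn_integral_gauss_weight ennreal_mult[symmetric])
    qed
  qed
  also have "\<dots> = ennreal gauss_moment * (\<integral>\<^sup>+s. ennreal (norm (limit_sum s) powr (- (2 * \<theta>))) \<partial>paths)"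
    by (rule nn_integral_cmult) measurable
  finally show ?thesis
    using nn_integral_gauss_weight_limit_sum gauss_moment_pos by (auto simp: ennreal_mult_less_top)
qed

section \<open>The representing measure on the sphere\<close>

definition radial_fourier :: "('a \<Rightarrow> complex) \<Rightarrow> 'a \<Rightarrow> complex" where
  "radial_fourier \<phi> y = (LINT t|lborel. of_real (\<bar>t\<bar> powr (2 * \<theta> - 1)) * fourier_transform \<phi> (t *\<^sub>R y))"

lemma radial_fourier_measurable[measurable]:
  assumes "schwartz_function \<phi>"
  shows "radial_fourier \<phi> \<in> borel_measurable borel"
proof -
  note [measurable] = schwartz_function_measurable[OF assms]
  show ?thesis unfolding radial_fourier_def by measurable
qed

text \<open>Homogeneity lets \<open>limit_sum\<close> be replaced by its direction, at the price of
  a power of its length that goes into the density. Negative \<open>r\<close> is included because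
  the case \<open>r = - 1\<close> gives evenness, which the symmetrisation relies on.\<close>

lemma radial_fourier_scaleR:
  assumes "r \<noteq> 0"
  shows "radial_fourier \<phi> (r *\<^sub>R y) = \<bar>r\<bar> powr (- (2 * \<theta>)) *\<^sub>R radial_fourier \<phi> y"
proof -
  have "radial_fourier \<phi> (r *\<^sub>R y) = \<bar>1 / r\<bar> *\<^sub>R
      (LINT t|lborel. of_real (\<bar>0 + 1 / r * t\<bar> powr (2 * \<theta> - 1)) * fourier_transform \<phi> ((0 + 1 / r * t) *\<^sub>R (r *\<^sub>R y)))"
    unfolding radial_fourier_def using assms by (intro lborel_integral_real_affine) simp
  also have "\<dots> = \<bar>1 / r\<bar> *\<^sub>R (LINT t|lborel. of_real (\<bar>1 / r\<bar> powr (2 * \<theta> - 1)) *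
      (of_real (\<bar>t\<bar> powr (2 * \<theta> - 1)) * fourier_transform \<phi> (t *\<^sub>R y)))"
    using assms by (simp only: add_0 abs_mult powr_mult abs_ge_zero of_real_mult mult.assoc scaleR_scaleR) simp
  also have "\<dots> = (\<bar>1 / r\<bar> * \<bar>1 / r\<bar> powr (2 * \<theta> - 1)) *\<^sub>R radial_fourier \<phi> y"
    unfolding radial_fourier_def by (simp only: integral_mult_right_zero scaleR_conv_of_real of_real_mult mult.assoc)
  also have "\<bar>1 / r\<bar> * \<bar>1 / r\<bar> powr (2 * \<theta> - 1) = \<bar>r\<bar> powr (- (2 * \<theta>))"
    using assms by (simp add: powr_diff powr_minus powr_divide divide_simps)
  finally show ?thesis .
qed

text \<open>Two exchanges of integrals. The one between paths and \<open>t\<close> is dominated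
  through the decay of the Fourier transform, whose Mellin integral along a ray is at most
  \<open>I\<close> times the negative power of the length of \<open>limit_sum\<close>, of finite
  expectation. The one between \<open>t\<close> and \<open>x\<close> is covered by
  \<open>nn_integral_limit_char_le\<close>. Finally \<open>mellin_limit_char_N\<close> evaluates the
  integral over \<open>t\<close>.\<close>

lemma integral_radial_fourier_limit_sum:
  assumes \<phi>: "schwartz_function \<phi>"
  shows "(LINT s|paths. radial_fourier \<phi> (limit_sum s)) = of_real mass * (LINT x|lborel. of_real (N x powr (- (2 * \<theta>))) * \<phi> x)"
proof -
  interpret P: pair_sigma_finite paths "lborel :: real measure" ..
  note [measurable] = schwartz_function_measurable[OF \<phi>]
  let ?w = "\<lambda>t. \<bar>t\<bar> powr (2 * \<theta> - 1)"
  obtain M where M: "2 * \<theta> < real M" using reals_Archimedean2 by blast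
  obtain B where B: "0 \<le> B" "\<And>y. cmod (fourier_transform \<phi> y) * (1 + norm y) ^ M \<le> B"
    using fourier_transform_decay[OF \<phi>] by blast
  have B': "cmod (fourier_transform \<phi> y) \<le> B / (1 + norm y) ^ M" for y
    using B(2)[of y] by (simp add: le_divide_eq add_pos_nonneg)
  define I where "I = (\<integral>\<^sup>+t. ennreal (?w t) * ennreal (B / (1 + \<bar>t\<bar>) ^ M) \<partial>lborel)"
  have I: "I < \<infinity>"
  proof -
    have "I = (\<integral>\<^sup>+t. ennreal B * ennreal (?w t / (1 + \<bar>t\<bar>) ^ M) \<partial>lborel)"
      unfolding I_def using B(1) by (simp add: ennreal_mult[symmetric] mult.commute)
    also have "\<dots> = ennreal B * (\<integral>\<^sup>+t. ennreal (?w t / (1 + \<bar>t\<bar>) ^ M) \<partial>lborel)"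
      by (rule nn_integral_cmult) measurable
    also have "\<dots> < \<infinity>"
      using nn_integral_abs_powr_finite[of "2 * \<theta>" M] \<theta> M by (simp add: ennreal_mult_less_top)
    finally show ?thesis .
  qed
  have "integrable (paths \<Otimes>\<^sub>M lborel) (\<lambda>(s, t). of_real (?w t) * fourier_transform \<phi> (t *\<^sub>R limit_sum s))"
  proof (rule integrableI_bounded)
    have "(\<integral>\<^sup>+z. ennreal (norm (case z of (s, t) \<Rightarrow> of_real (?w t) * fourier_transform \<phi> (t *\<^sub>R limit_sum s))) \<partial>(paths \<Otimes>\<^sub>M lborel))
        = (\<integral>\<^sup>+s. \<integral>\<^sup>+t. ennreal (?w t * cmod (fourier_transform \<phi> (t *\<^sub>R limit_sum s))) \<partial>lborel \<partial>paths)"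
      by (subst lborel.nn_integral_fst[symmetric]) (auto simp: norm_mult)
    also have "\<dots> \<le> (\<integral>\<^sup>+s. I * ennreal (norm (limit_sum s) powr (- (2 * \<theta>))) \<partial>paths)"
    proof (rule nn_integral_mono_AE)
      show "AE s in paths. (\<integral>\<^sup>+t. ennreal (?w t * cmod (fourier_transform \<phi> (t *\<^sub>R limit_sum s))) \<partial>lborel)
          \<le> I * ennreal (norm (limit_sum s) powr (- (2 * \<theta>)))"
        using AE_limit_sum_neq_0
      proof eventually_elim
        case (elim s)
        have "(\<integral>\<^sup>+t. ennreal (?w t * cmod (fourier_transform \<phi> (t *\<^sub>R limit_sum s))) \<partial>lborel)
            \<le> (\<integral>\<^sup>+t. ennreal (?w t) * ennreal (B / (1 + \<bar>norm (limit_sum s) * t\<bar>) ^ M) \<partial>lborel)"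
        proof (rule nn_integral_mono)
          fix t
          have "cmod (fourier_transform \<phi> (t *\<^sub>R limit_sum s)) \<le> B / (1 + \<bar>norm (limit_sum s) * t\<bar>) ^ M"
            using B'[of "t *\<^sub>R limit_sum s"] by (simp add: abs_mult mult.commute)
          then have "?w t * cmod (fourier_transform \<phi> (t *\<^sub>R limit_sum s)) \<le> ?w t * (B / (1 + \<bar>norm (limit_sum s) * t\<bar>) ^ M)"
            by (intro mult_left_mono) auto
          then show "ennreal (?w t * cmod (fourier_transform \<phi> (t *\<^sub>R limit_sum s)))
              \<le> ennreal (?w t) * ennreal (B / (1 + \<bar>norm (limit_sum s) * t\<bar>) ^ M)"
            using B(1) by (subst ennreal_mult[symmetric]) (auto intro!: ennreal_leI divide_nonneg_nonneg)
        qed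
        also have "\<dots> = ennreal (norm (limit_sum s) powr (- (2 * \<theta>))) * I"
          unfolding I_def using elim
          by (intro nn_integral_abs_powr_scale[where f="\<lambda>t. ennreal (B / (1 + \<bar>t\<bar>) ^ M)"]) auto
        finally show ?case by (simp only: mult.commute)
      qed
    qed
    also have "\<dots> = I * (\<integral>\<^sup>+s. ennreal (norm (limit_sum s) powr (- (2 * \<theta>))) \<partial>paths)"
      by (rule nn_integral_cmult) measurable
    also have "\<dots> < \<infinity>"
      using I nn_integral_norm_limit_sum_powr by (simp add: ennreal_mult_less_top)
    finally show "(\<integral>\<^sup>+z. ennreal (norm (case z of (s, t) \<Rightarrow> of_real (?w t) * fourier_transform \<phi> (t *\<^sub>R limit_sum s))) \<partial>(paths \<Otimes>\<^sub>M lborel)) < \<infinity>" .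
  qed measurable
  then have "(LINT s|paths. radial_fourier \<phi> (limit_sum s))
      = (LINT t|lborel. LINT s|paths. of_real (?w t) * fourier_transform \<phi> (t *\<^sub>R limit_sum s))"
    unfolding radial_fourier_def by (rule P.Fubini_integral[symmetric])
  also have "\<dots> = (LINT t|lborel. LINT x|lborel. of_real (?w t) * (\<phi> x * of_real (limit_char (t *\<^sub>R x))))"
  proof (rule Bochner_Integration.integral_cong[OF refl])
    fix t :: real
    \<comment> \<open>The Fourier transform carries \<open>exp (- \<i> ...)\<close> but a
      characteristic function \<open>exp (\<i> ...)\<close>. The sign is moved to \<open>t\<close>
      and then disappears, since \<open>limit_char\<close> is even.\<close>
    have "(LINT s|paths. fourier_transform \<phi> (t *\<^sub>R limit_sum s))
        = (LINT s|paths. LINT x|lborel. \<phi> x * exp (\<i> * of_real (x \<bullet> ((- t) *\<^sub>R limit_sum s))))"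
      unfolding fourier_transform_def by simp
    also have "\<dots> = (LINT x|lborel. \<phi> x * of_real (limit_char ((- t) *\<^sub>R x)))"
      by (rule integral_fourier_paths[OF schwartz_function_integrable[OF \<phi>]])
    also have "\<dots> = (LINT x|lborel. \<phi> x * of_real (limit_char (t *\<^sub>R x)))"
      by (simp only: scaleR_minus_left limit_char_uminus)
    finally show "(LINT s|paths. of_real (?w t) * fourier_transform \<phi> (t *\<^sub>R limit_sum s))
        = (LINT x|lborel. of_real (?w t) * (\<phi> x * of_real (limit_char (t *\<^sub>R x))))"
      by (simp only: integral_mult_right_zero)
  qed
  also have "\<dots> = (LINT x|lborel. LINT t|lborel. of_real (?w t) * (\<phi> x * of_real (limit_char (t *\<^sub>R x))))"
  proof (rule lborel_pair.Fubini_integral[symmetric], rule integrableI_bounded)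
    have "(\<integral>\<^sup>+z. ennreal (norm (case z of (t, x) \<Rightarrow> of_real (?w t) * (\<phi> x * of_real (limit_char (t *\<^sub>R x))))) \<partial>(lborel \<Otimes>\<^sub>M lborel))
        = (\<integral>\<^sup>+t. \<integral>\<^sup>+x. ennreal (?w t * (cmod (\<phi> x) * limit_char (t *\<^sub>R x))) \<partial>lborel \<partial>lborel)"
      using limit_char_bounds by (subst lborel.nn_integral_fst[symmetric]) (auto simp: norm_mult)
    also have "\<dots> < \<infinity>"
    proof (rule nn_integral_limit_char_le)
      have "integrable lborel (\<lambda>x. norm (norm x powr (- (2 * \<theta>)) *\<^sub>R \<phi> x))"
        using \<theta> dim by (intro integrable_norm schwartz_function_integrable_powr[OF \<phi>]) auto
      then show "integrable lborel (\<lambda>x. norm x powr (- (2 * \<theta>)) *\<^sub>R cmod (\<phi> x))"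
        by simp
    qed auto
    finally show "(\<integral>\<^sup>+z. ennreal (norm (case z of (t, x) \<Rightarrow> of_real (?w t) * (\<phi> x * of_real (limit_char (t *\<^sub>R x))))) \<partial>(lborel \<Otimes>\<^sub>M lborel)) < \<infinity>" .
  qed measurable
  also have "\<dots> = (LINT x|lborel. of_real mass * (of_real (N x powr (- (2 * \<theta>))) * \<phi> x))"
  proof (rule integral_cong_AE)
    show eq: "AE x in lborel. (LINT t|lborel. of_real (?w t) * (\<phi> x * of_real (limit_char (t *\<^sub>R x))))
        = of_real mass * (of_real (N x powr (- (2 * \<theta>))) * \<phi> x)"
      using AE_lborel_singleton[of "0::'a"]
    proof eventually_elim
      case (elim x)
      have "(LINT t|lborel. of_real (?w t) * (\<phi> x * of_real (limit_char (t *\<^sub>R x))))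
          = (LINT t|lborel. \<phi> x * complex_of_real (?w t * limit_char (t *\<^sub>R x)))"
        by (simp only: of_real_mult mult.left_commute)
      also have "\<dots> = \<phi> x * of_real (LINT t|lborel. ?w t * limit_char (t *\<^sub>R x))"
        by (simp only: integral_mult_right_zero integral_complex_of_real)
      also have "(LINT t|lborel. ?w t * limit_char (t *\<^sub>R x)) = mass * N x powr (- (2 * \<theta>))"
        using mellin_limit_char_N[OF elim] mass_pos limit_char_bounds
        by (subst integral_eq_nn_integral) auto
      finally show ?case by simp
    qed
  qed measurable
  also have "\<dots> = of_real mass * (LINT x|lborel. of_real (N x powr (- (2 * \<theta>))) * \<phi> x)"
    by (rule integral_mult_right_zero)
  finally show ?thesis .
qed


lemma radial_fourier_limit_sum:
  "limit_sum s \<noteq> 0 \<Longrightarrow> radial_fourier \<phi> (limit_sum s)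
    = norm (limit_sum s) powr (- (2 * \<theta>)) *\<^sub>R radial_fourier \<phi> (sgn (limit_sum s))"
  using radial_fourier_scaleR[of "norm (limit_sum s)" \<phi> "sgn (limit_sum s)"] by (simp add: sgn_div_norm)

text \<open>The sign \<open>e\<close> symmetrises the law of the direction of \<open>limit_sum\<close>. Where \<open>limit_sum s = 0\<close>,
  the density below vanishes, as \<open>0 powr _ = 0\<close>; \<open>pole\<close> only serves to stay on the sphere.\<close>

definition pole :: 'a where
  "pole = (SOME b. b \<in> Basis)"

definition direction :: "('a \<times> real \<times> real) stream \<times> bool \<Rightarrow> 'a" where
  "direction = (\<lambda>(s, e). (if e then 1 else - 1) *\<^sub>R (if limit_sum s = 0 then pole else sgn (limit_sum s)))"

definition coin_paths :: "(('a \<times> real \<times> real) stream \<times> bool) measure" where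
  "coin_paths = paths \<Otimes>\<^sub>M measure_pmf (bernoulli_pmf (1 / 2))"

text \<open>The power compensates passing from \<open>limit_sum\<close> to its direction; division
  by \<open>mass\<close> removes the constant in
  \<open>integral_radial_fourier_limit_sum\<close>.\<close>

definition radial_density :: "('a \<times> real \<times> real) stream \<times> bool \<Rightarrow> real" where
  "radial_density w = norm (limit_sum (fst w)) powr (- (2 * \<theta>)) / mass"

definition sphere_law :: "'a measure" where
  "sphere_law = distr (density coin_paths (\<lambda>w. ennreal (radial_density w))) (restrict_space borel (sphere 0 1)) direction"

lemma radial_density_measurable[measurable]: "radial_density \<in> borel_measurable coin_paths"
  unfolding radial_density_def coin_paths_def by measurable

lemma direction_measurable_borel: "direction \<in> borel_measurable coin_paths"
  unfolding direction_def coin_paths_def by measurable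

lemma direction_measurable[measurable]: "direction \<in> measurable coin_paths (restrict_space borel (sphere 0 1))"
proof (rule measurable_restrict_space2[OF _ direction_measurable_borel])
  have "pole \<in> Basis" unfolding pole_def by (rule someI_ex) (use nonempty_Basis in blast)
  then show "direction \<in> space coin_paths \<rightarrow> sphere 0 1"
    by (auto simp: direction_def norm_sgn)
qed

lemma sets_sphere_law[simp]: "sets sphere_law = sets (restrict_space borel (sphere 0 1))"
  by (simp add: sphere_law_def)

lemma nn_integral_coin_paths:
  assumes "f \<in> borel_measurable coin_paths"
  shows "(\<integral>\<^sup>+w. f w \<partial>coin_paths) = (\<integral>\<^sup>+s. (f (s, True) + f (s, False)) / 2 \<partial>paths)"
proof -
  have [measurable]: "f \<in> borel_measurable (paths \<Otimes>\<^sub>M measure_pmf (bernoulli_pmf (1 / 2)))"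
    using assms by (simp add: coin_paths_def)
  have "(\<integral>\<^sup>+w. f w \<partial>coin_paths) = (\<integral>\<^sup>+s. \<integral>\<^sup>+e. f (s, e) \<partial>measure_pmf (bernoulli_pmf (1 / 2)) \<partial>paths)"
    unfolding coin_paths_def by (rule measure_pmf.nn_integral_fst[symmetric]) measurable
  also have "\<dots> = (\<integral>\<^sup>+s. (f (s, True) + f (s, False)) / 2 \<partial>paths)"
  proof (rule nn_integral_cong)
    fix s
    have half: "ennreal (1 / 2) = inverse 2" using divide_ennreal[of 1 2] by (simp add: divide_ennreal_def)
    show "(\<integral>\<^sup>+e. f (s, e) \<partial>measure_pmf (bernoulli_pmf (1 / 2))) = (f (s, True) + f (s, False)) / 2"
      by (simp add: half divide_ennreal_def distrib_right)
  qed
  finally show ?thesis .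
qed

lemma emeasure_sphere_law:
  assumes "A \<in> sets (restrict_space borel (sphere 0 1))"
  shows "emeasure sphere_law A = (\<integral>\<^sup>+s. (ennreal (radial_density (s, True)) * indicator A (direction (s, True))
    + ennreal (radial_density (s, False)) * indicator A (direction (s, False))) / 2 \<partial>paths)"
proof -
  note [measurable] = assms
  have "emeasure sphere_law A = (\<integral>\<^sup>+\<xi>. indicator A \<xi> \<partial>sphere_law)"
    using assms by simp
  also have "\<dots> = (\<integral>\<^sup>+w. ennreal (radial_density w) * indicator A (direction w) \<partial>coin_paths)"
    unfolding sphere_law_def by (subst nn_integral_distr, measurable) (subst nn_integral_density, measurable)
  also have "\<dots> = (\<integral>\<^sup>+s. (ennreal (radial_density (s, True)) * indicator A (direction (s, True))
    + ennreal (radial_density (s, False)) * indicator A (direction (s, False))) / 2 \<partial>paths)"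
    by (rule nn_integral_coin_paths) measurable
  finally show ?thesis .
qed

lemma finite_sphere_measure_sphere_law: "finite_sphere_measure sphere_law"
  unfolding finite_sphere_measure_def
proof (intro conjI finite_measureI sets_sphere_law)
  have "emeasure sphere_law (space sphere_law) = (\<integral>\<^sup>+\<xi>. 1 \<partial>sphere_law)" by simp
  also have "\<dots> = (\<integral>\<^sup>+w. ennreal (radial_density w) * 1 \<partial>coin_paths)"
    unfolding sphere_law_def by (subst nn_integral_distr, measurable) (subst nn_integral_density, measurable)
  also have "\<dots> = (\<integral>\<^sup>+w. ennreal (radial_density w) \<partial>coin_paths)" by simp
  also have "\<dots> = (\<integral>\<^sup>+s. ennreal (norm (limit_sum s) powr (- (2 * \<theta>)) / mass) \<partial>paths)"
  proof -
    have "(a + a) / 2 = a" for a :: ennreal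
      by (simp add: mult_2_right[symmetric] ennreal_mult_divide_eq)
    then show ?thesis
      by (subst nn_integral_coin_paths, measurable) (simp add: radial_density_def)
  qed
  also have "\<dots> = (\<integral>\<^sup>+s. ennreal (1 / mass) * ennreal (norm (limit_sum s) powr (- (2 * \<theta>))) \<partial>paths)"
    using mass_pos by (simp add: ennreal_mult[symmetric])
  also have "\<dots> = ennreal (1 / mass) * (\<integral>\<^sup>+s. ennreal (norm (limit_sum s) powr (- (2 * \<theta>))) \<partial>paths)"
    by (rule nn_integral_cmult) measurable
  finally show "emeasure sphere_law (space sphere_law) \<noteq> \<infinity>"
    using nn_integral_norm_limit_sum_powr by (simp add: ennreal_mult_eq_top_iff)
qed

text \<open>Reflection exchanges the two outcomes of the coin, which are equally likely and carry
  the same density.\<close>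

lemma symmetric_measure_sphere_law: "symmetric_measure sphere_law"
  unfolding symmetric_measure_def
proof
  fix A assume "A \<in> sets sphere_law"
  then have A: "A \<in> sets (restrict_space borel (sphere 0 1))" by simp
  then obtain A' where A': "A' \<in> sets borel" "A = sphere 0 1 \<inter> A'"
    by (auto simp: sets_restrict_space)
  have mem: "x \<in> uminus ` A \<longleftrightarrow> - x \<in> A" for x by force
  have "uminus -` A' \<in> sets borel"
    using A'(1) measurable_sets[of uminus borel borel A'] by simp
  moreover have "uminus ` A = sphere 0 1 \<inter> uminus -` A'"
    using A'(2) mem by auto
  ultimately have "uminus ` A \<in> sets (restrict_space borel (sphere 0 1))"
    by (auto simp: sets_restrict_space)
  then show "emeasure sphere_law (uminus ` A) = emeasure sphere_law A"
    unfolding emeasure_sphere_law[OF A] emeasure_sphere_law[OF \<open>uminus ` A \<in> sets (restrict_space borel (sphere 0 1))\<close>]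
    by (intro nn_integral_cong) (simp add: direction_def radial_density_def indicator_def mem add.commute)
qed

text \<open>Evenness of \<open>radial_fourier\<close> makes the coin invisible. By homogeneity,
  density times value at the direction is, almost surely, the value at \<open>limit_sum\<close>
  divided by \<open>mass\<close>.\<close>

lemma integral_sphere_law:
  assumes \<phi>: "schwartz_function \<phi>"
  shows "(LINT \<xi>|sphere_law. radial_fourier \<phi> \<xi>) = (LINT x|lborel. of_real (N x powr (- (2 * \<theta>))) * \<phi> x)"
proof -
  note [measurable] = radial_fourier_measurable[OF \<phi>]
  have [measurable]: "radial_fourier \<phi> \<in> borel_measurable (restrict_space borel (sphere 0 1))"
    by (rule measurable_restrict_space1) measurable
  have even: "radial_fourier \<phi> (- y) = radial_fourier \<phi> y" for y
    using radial_fourier_scaleR[of "- 1" \<phi> y] by simp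
  have "(LINT \<xi>|sphere_law. radial_fourier \<phi> \<xi>) = (LINT w|coin_paths. radial_density w *\<^sub>R radial_fourier \<phi> (direction w))"
    unfolding sphere_law_def
    by (subst integral_distr, measurable) (subst integral_density, use mass_pos in \<open>auto simp: radial_density_def\<close>)
  also have "\<dots> = (LINT w|coin_paths. (1 / mass) *\<^sub>R radial_fourier \<phi> (limit_sum (fst w)))"
  proof (rule integral_cong_AE)
    have "AE s in distr coin_paths paths fst. limit_sum s \<noteq> 0"
      unfolding coin_paths_def measure_pmf.distr_pair_fst by (rule AE_limit_sum_neq_0)
    then have "AE w in coin_paths. limit_sum (fst w) \<noteq> 0"
      by (subst (asm) AE_distr_iff) (auto simp: coin_paths_def)
    then show "AE w in coin_paths. radial_density w *\<^sub>R radial_fourier \<phi> (direction w) = (1 / mass) *\<^sub>R radial_fourier \<phi> (limit_sum (fst w))"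
    proof eventually_elim
      case (elim w)
      have "radial_fourier \<phi> (direction w) = radial_fourier \<phi> (sgn (limit_sum (fst w)))"
        using elim by (cases w) (simp add: direction_def even)
      then show ?case
        using radial_fourier_limit_sum[OF elim, of \<phi>] by (simp add: radial_density_def)
    qed
    show "(\<lambda>w. (1 / mass) *\<^sub>R radial_fourier \<phi> (limit_sum (fst w))) \<in> borel_measurable coin_paths"
      unfolding coin_paths_def by measurable
  qed measurable
  also have "\<dots> = (LINT s|distr coin_paths paths fst. (1 / mass) *\<^sub>R radial_fourier \<phi> (limit_sum s))"
    by (rule integral_distr[symmetric]) (auto simp: coin_paths_def)
  also have "distr coin_paths paths fst = paths"
    unfolding coin_paths_def by (rule measure_pmf.distr_pair_fst)
  also have "(LINT s|paths. (1 / mass) *\<^sub>R radial_fourier \<phi> (limit_sum s)) = (1 / mass) *\<^sub>R (LINT s|paths. radial_fourier \<phi> (limit_sum s))"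
    by (rule integral_scaleR_right)
  also have "\<dots> = (LINT x|lborel. of_real (N x powr (- (2 * \<theta>))) * \<phi> x)"
    unfolding integral_radial_fourier_limit_sum[OF \<phi>] using mass_pos by (simp add: scaleR_conv_of_real)
  finally show ?thesis .
qed

lemma embeds_in_L_neg_log_embedding: "embeds_in_L_neg (2 * \<theta>) N"
  unfolding embeds_in_L_neg_def
  using finite_sphere_measure_sphere_law symmetric_measure_sphere_law integral_sphere_law
  unfolding radial_fourier_def by (intro exI[of _ sphere_law]) auto

end

section \<open>Minkowski functionals\<close>

text \<open>\<open>LEAST\<close> on the reals says nothing until a minimum is known to exist;
  compactness of \<open>K\<close> supplies it.\<close>

lemma minkowski_functional_attained:
  fixes K :: "'a::euclidean_space set"
  assumes K: "symmetric_star_body K"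
  shows "0 \<le> minkowski_functional K x" "x \<in> (\<lambda>y. minkowski_functional K x *\<^sub>R y) ` K"
    and "\<And>a. 0 \<le> a \<Longrightarrow> x \<in> (\<lambda>y. a *\<^sub>R y) ` K \<Longrightarrow> minkowski_functional K x \<le> a"
proof -
  have cpt: "compact K" and int: "0 \<in> interior K"
    using K by (auto simp: symmetric_star_body_def)
  let ?P = "\<lambda>a. 0 \<le> a \<and> x \<in> (\<lambda>y. a *\<^sub>R y) ` K"
  obtain e where e: "0 < e" "cball 0 e \<subseteq> K"
    using int by (auto simp: mem_interior_cball)
  \<comment> \<open>An admissible dilation: dividing \<open>x\<close> by it gives a point of the
    ball of radius \<open>e\<close> inside \<open>K\<close>. The summand 1 keeps the factor positive
    at \<open>x = 0\<close>.\<close>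
  have ex: "?P ((norm x + 1) / e)"
  proof
    have pos: "0 < norm x + 1" using norm_ge_zero[of x] by linarith
    then show "0 \<le> (norm x + 1) / e" using e by simp
    have "(e / (norm x + 1)) *\<^sub>R x \<in> cball 0 e"
      using e pos by (simp add: divide_le_eq mult_left_mono)
    then have "(e / (norm x + 1)) *\<^sub>R x \<in> K" using e by blast
    moreover have "x = ((norm x + 1) / e) *\<^sub>R ((e / (norm x + 1)) *\<^sub>R x)"
      using e pos by simp
    ultimately show "x \<in> (\<lambda>y. ((norm x + 1) / e) *\<^sub>R y) ` K" by (rule image_eqI[rotated])
  qed
  let ?A = "(norm x + 1) / e"
  \<comment> \<open>The admissible dilations up to \<open>?A\<close>, written as the projection of a
    closed part of a compact product, so that they form a compact set.\<close>
  define S where "S = fst ` (({0..?A} \<times> K) \<inter> {w. fst w *\<^sub>R snd w = x})"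
  have S: "a \<in> S \<longleftrightarrow> ?P a \<and> a \<le> ?A" for a
    unfolding S_def by (force simp: image_iff)
  have "closed {w::real \<times> 'a. fst w *\<^sub>R snd w = x}"
    by (intro closed_Collect_eq continuous_intros)
  then have "compact S"
    unfolding S_def by (intro compact_continuous_image continuous_intros compact_Int_closed compact_Times cpt compact_Icc)
  moreover have "?A \<in> S" unfolding S using ex by simp
  then have "S \<noteq> {}" by (metis empty_iff)
  ultimately obtain a where a: "a \<in> S" "\<And>b. b \<in> S \<Longrightarrow> a \<le> b"
    using compact_attains_inf[of S] by blast
  have min: "a \<le> b" if "?P b" for b
    using a that S[of b] S[of a] by (cases "b \<le> ?A") auto
  have "minkowski_functional K x = a"
    unfolding minkowski_functional_def using a S min by (intro Least_equality) blast+
  then show "0 \<le> minkowski_functional K x" "x \<in> (\<lambda>y. minkowski_functional K x *\<^sub>R y) ` K"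
    "\<And>a. 0 \<le> a \<Longrightarrow> x \<in> (\<lambda>y. a *\<^sub>R y) ` K \<Longrightarrow> minkowski_functional K x \<le> a"
    using a S min by auto
qed

lemma minkowski_functional_scaleR:
  fixes K :: "'a::euclidean_space set"
  assumes K: "symmetric_star_body K" and r: "0 < r"
  shows "minkowski_functional K (r *\<^sub>R x) = r * minkowski_functional K x"
proof (rule antisym)
  have le: "minkowski_functional K (r *\<^sub>R x) \<le> r * minkowski_functional K x" if r: "0 < r" for r x
  proof (rule minkowski_functional_attained(3)[OF K])
    show "0 \<le> r * minkowski_functional K x"
      using r minkowski_functional_attained(1)[OF K, of x] by simp
    show "r *\<^sub>R x \<in> (\<lambda>y. (r * minkowski_functional K x) *\<^sub>R y) ` K"
      using minkowski_functional_attained(2)[OF K, of x] by (metis (no_types, lifting) image_iff scaleR_scaleR)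
  qed
  show "minkowski_functional K (r *\<^sub>R x) \<le> r * minkowski_functional K x" by (rule le[OF r])
  have "minkowski_functional K x \<le> inverse r * minkowski_functional K (r *\<^sub>R x)"
    using le[of "inverse r" "r *\<^sub>R x"] r by simp
  then show "r * minkowski_functional K x \<le> minkowski_functional K (r *\<^sub>R x)"
    using r by (simp add: field_simps)
qed

lemma minkowski_functional_ge:
  fixes K :: "'a::euclidean_space set"
  assumes K: "symmetric_star_body K"
  obtains c where "0 < c" "\<And>x. c * norm x \<le> minkowski_functional K x"
proof -
  have "bounded K" using K by (auto simp: symmetric_star_body_def compact_imp_bounded)
  then obtain R where R: "0 < R" "\<And>y. y \<in> K \<Longrightarrow> norm y \<le> R"
    by (auto simp: bounded_pos)
  have "1 / R * norm x \<le> minkowski_functional K x" for x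
  proof -
    obtain y where y: "y \<in> K" "x = minkowski_functional K x *\<^sub>R y"
      using minkowski_functional_attained(2)[OF K, of x] by blast
    then have "norm x = minkowski_functional K x * norm y"
      using minkowski_functional_attained(1)[OF K, of x] by (metis abs_of_nonneg norm_scaleR)
    also have "\<dots> \<le> minkowski_functional K x * R"
      using minkowski_functional_attained(1)[OF K, of x] R y by (intro mult_left_mono) auto
    finally show ?thesis using R by (simp add: divide_le_eq)
  qed
  with R that[of "1 / R"] show ?thesis by auto
qed

lemma finite_sphere_measure_prob_space:
  fixes N :: "'a::euclidean_space \<Rightarrow> real"
  assumes \<mu>: "finite_sphere_measure \<mu>" and x: "x \<noteq> 0" and N: "N (2 *\<^sub>R x) = 2 * N x" "0 < N x"
    and L: "\<And>x. x \<noteq> 0 \<Longrightarrow> (AE \<xi> in \<mu>. x \<bullet> \<xi> \<noteq> 0) \<and> integrable \<mu> (\<lambda>\<xi>. ln \<bar>x \<bullet> \<xi>\<bar>) \<and>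
      ln (N x) = (LINT \<xi>|\<mu>. ln \<bar>x \<bullet> \<xi>\<bar>) + C"
  shows "prob_space \<mu>"
proof -
  interpret finite_measure \<mu> using \<mu> by (simp add: finite_sphere_measure_def)
  have int: "integrable \<mu> (\<lambda>\<xi>. ln \<bar>x \<bullet> \<xi>\<bar>)" using L[OF x] by simp
  have x2: "2 *\<^sub>R x \<noteq> 0" using x by simp
  have "(LINT \<xi>|\<mu>. ln \<bar>(2 *\<^sub>R x) \<bullet> \<xi>\<bar>) = (LINT \<xi>|\<mu>. ln 2 + ln \<bar>x \<bullet> \<xi>\<bar>)"
  proof (rule integral_cong_AE)
    show "AE \<xi> in \<mu>. ln \<bar>(2 *\<^sub>R x) \<bullet> \<xi>\<bar> = ln 2 + ln \<bar>x \<bullet> \<xi>\<bar>"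
      using conjunct1[OF L[OF x]] by eventually_elim (simp add: abs_mult ln_mult)
    show "(\<lambda>\<xi>. ln \<bar>(2 *\<^sub>R x) \<bullet> \<xi>\<bar>) \<in> borel_measurable \<mu>" using L[OF x2] by auto
  qed (use int in auto)
  also have "\<dots> = measure \<mu> (space \<mu>) * ln 2 + (LINT \<xi>|\<mu>. ln \<bar>x \<bullet> \<xi>\<bar>)"
    using int by simp
  finally have "ln (2 * N x) = measure \<mu> (space \<mu>) * ln 2 + ln (N x)"
    using L[OF x2] L[OF x] N by simp
  then have "measure \<mu> (space \<mu>) = 1"
    using N by (simp add: ln_mult)
  then show ?thesis
    by (intro prob_spaceI) (simp add: emeasure_eq_measure)
qed


lemma embeds_in_L0_imp_embeds_in_L_neg:
  fixes K :: "'a::euclidean_space set"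
  assumes K: "symmetric_star_body K" and L0: "embeds_in_L0 (minkowski_functional K)"
    and p: "0 < p" "p < real DIM('a)"
  shows "embeds_in_L_neg p (minkowski_functional K)"
proof -
  let ?N = "minkowski_functional K"
  obtain \<mu> C where \<mu>: "finite_sphere_measure \<mu>"
    and L: "\<And>x. x \<noteq> 0 \<Longrightarrow> (AE \<xi> in \<mu>. x \<bullet> \<xi> \<noteq> 0) \<and> integrable \<mu> (\<lambda>\<xi>. ln \<bar>x \<bullet> \<xi>\<bar>) \<and>
      ln (?N x) = (LINT \<xi>|\<mu>. ln \<bar>x \<bullet> \<xi>\<bar>) + C"
    using L0 unfolding embeds_in_L0_def by blast
  obtain c where c: "0 < c" "\<And>x. c * norm x \<le> ?N x"
    using minkowski_functional_ge[OF K] by blast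
  obtain b :: 'a where b: "b \<in> Basis" using nonempty_Basis by blast
  have "0 < c * norm b" using b c by simp
  then have "0 < ?N b" using c(2)[of b] by linarith
  moreover have "b \<noteq> 0" using b by auto
  ultimately interpret \<mu>: prob_space \<mu>
    using \<mu> L minkowski_functional_scaleR[OF K, of 2] by (intro finite_sphere_measure_prob_space[of \<mu> b ?N C]) auto
  have sets: "sets \<mu> = sets (restrict_space borel (sphere 0 1))"
    using \<mu> by (simp add: finite_sphere_measure_def)
  have id[measurable]: "(\<lambda>\<xi>. \<xi>) \<in> borel_measurable \<mu>"
    by (subst measurable_cong_sets[OF sets refl], rule measurable_restrict_space1) simp
  \<comment> \<open>The push-forward from the sphere to the whole space, as
    \<open>direction_measure\<close> requires.\<close>
  define \<mu>' where "\<mu>' = distr \<mu> borel (\<lambda>\<xi>. \<xi>)"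
  interpret \<mu>': prob_space \<mu>'
    unfolding \<mu>'_def by (rule \<mu>.prob_space_distr[OF id])
  have AE_\<mu>': "(AE \<xi> in \<mu>'. P \<xi>) \<longleftrightarrow> (AE \<xi> in \<mu>. P \<xi>)" if "{\<xi>. P \<xi>} \<in> sets borel" for P
    unfolding \<mu>'_def using that by (subst AE_distr_iff[OF id]) auto
  interpret log_embedding \<mu>' "p / 2" ?N C c
  proof unfold_locales
    show "sets \<mu>' = sets borel" by (simp add: \<mu>'_def)
    have "space \<mu> = sphere 0 1"
      using sets_eq_imp_space_eq[OF sets] by (simp add: space_restrict_space)
    then show "AE \<xi> in \<mu>'. norm \<xi> \<le> 1"
      by (subst AE_\<mu>') (auto intro!: AE_I2)
    show "0 < p / 2" "2 * (p / 2) < real DIM('a)" using p by auto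
    show "0 < c" "\<And>x. c * norm x \<le> ?N x" by (rule c)+
    fix x :: 'a assume x: "x \<noteq> 0"
    show "AE \<xi> in \<mu>'. x \<bullet> \<xi> \<noteq> 0"
      using L[OF x] by (subst AE_\<mu>') auto
    show "integrable \<mu>' (\<lambda>\<xi>. ln \<bar>x \<bullet> \<xi>\<bar>)"
      unfolding \<mu>'_def using L[OF x] by (subst integrable_distr_eq[OF id]) auto
    show "ln (?N x) = (LINT \<xi>|\<mu>'. ln \<bar>x \<bullet> \<xi>\<bar>) + C"
      unfolding \<mu>'_def using L[OF x] by (subst integral_distr[OF id]) auto
  qed
  show ?thesis using embeds_in_L_neg_log_embedding by simp
qed

theorem theorem6p3:
  fixes K :: "(real ^ 'n) set" and p :: real
  assumes "symmetric_star_body K"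
    and "embeds_in_L0 (minkowski_functional K)"
    and "0 < p" and "p < real CARD('n)"
  shows "embeds_in_L_neg p (minkowski_functional K)"
  using assms by (intro embeds_in_L0_imp_embeds_in_L_neg) auto

end
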